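(* The following four statements are equivalent: (1) $\mathrm{Easy}_{\forall}^{\forall}(\mathrm{UP}) \neq \mathrm{P}$; (2) there exists a partial one-one one-way function $f$ with $\mathrm{range}(f)=\Sigma^\ast$; (3) $\Sigma^\ast \notin \mathrm{Easy}_{\forall}^{\forall}(\mathrm{UP})$; (4) $\mathrm{Easy}_{\forall}^{\forall}(\mathrm{UP})$ is not closed under complementation (with respect to $\Sigma^\ast$).
   Context: All languages are subsets of $\Sigma^\ast$ with $\Sigma=\{0,1\}$. An NPM is a nondeterministic polynomial-time Turing machine; for an NPM $M$, $L(M)$ is its accepted language and $\mathrm{acc}_M(x)$ the set of (encodings of) accepting paths of $M$ on input $x$. A UP machine is an NPM that on every input has at most one accepting path; UP is the class of languages accepted by UP machines. FP is the class of total functions computable in deterministic polynomial time. $\mathrm{Easy}_{\forall}^{\forall}(\mathrm{UP})$ is the class of all languages $L$ that either are finite, or satisfy (a) $L\in\mathrm{UP}$ and (b) for every UP machine $N$ with $L(N)=L$ there is $f_N\in\mathrm{FP}$ with $f_N(x)\in\mathrm{acc}_N(x)$ for all $x\in L$. Functions are partial maps $\Sigma^\ast\to\Sigma^\ast$ with domain $\mathrm{dom}(f)$ and range $\mathrm{range}(f)$; "$f\in\mathrm{FP}$" for a partial $f$ means $f$ is computable in polynomial time (including recognizing when it is undefined). $f$ is honest if there is a polynomial $p$ such that for every $y\in\mathrm{range}(f)$ and every $x\in\mathrm{dom}(f)$ with $f(x)=y$, $|x|\le p(|y|)$. $f$ is FP-invertible if there is $g\in\mathrm{FP}$ such that for every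 $y\in\mathrm{range}(f)$, $g(y)$ is some element of $f^{-1}(y)$. A one-one one-way function is a function $f$ that is honest, one-one (injective), computable in polynomial time, and not FP-invertible. *)

theory Defs
  imports Main "HOL-Computational_Algebra.Polynomial"
begin

type_synonym str = "bool list"  \<comment> \<open>strings over \<open>\<Sigma> = {0,1}\<close>\<close>
type_synonym lang = "str set"

section \<open>Multi-tape Turing machines\<close>

text \<open>
  Tapes are infinite in both directions; a tape is given by its contents and the head position.
  States and tape symbols are natural numbers. A program is a finite list of instructions, so only
  finitely many states and symbols are relevant to a machine and no explicit bounds are needed.
\<close>

type_synonym tape = "(int \<Rightarrow> nat) \<times> int"

datatype dir = MoveLeft | Stay | MoveRight

fun shift :: "dir \<Rightarrow> int" where
  "shift MoveLeft = -1"
| "shift Stay = 0"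
| "shift MoveRight = 1"

record instr =
  src :: nat
  reads :: "nat list"
  dst :: nat
  writes :: "nat list"
  moves :: "dir list"

record ntm =
  num_tapes :: nat
  start_state :: nat
  accept_state :: nat
  program :: "instr list"

text \<open>
  Distinctness makes the program list an enumeration of a transition relation: two different
  indices never denote the same transition.
\<close>

definition wf_ntm :: "ntm \<Rightarrow> bool" where
  "wf_ntm M \<longleftrightarrow>
     1 \<le> num_tapes M \<and> distinct (program M) \<and>
     (\<forall>\<iota> \<in> set (program M).
        length (reads \<iota>) = num_tapes M \<and>
        length (writes \<iota>) = num_tapes M \<and>
        length (moves \<iota>) = num_tapes M)"

definition deterministic :: "ntm \<Rightarrow> bool" where
  "deterministic M \<longleftrightarrow>
     (\<forall>\<iota> \<in> set (program M). \<forall>\<kappa> \<in> set (program M).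
        src \<iota> = src \<kappa> \<and> reads \<iota> = reads \<kappa> \<longrightarrow> \<iota> = \<kappa>)"

definition blank :: nat where
  "blank = 0"

definition bit_sym :: "bool \<Rightarrow> nat" where
  "bit_sym b = (if b then 2 else 1)"

type_synonym config = "nat \<times> tape list"

definition blank_tape :: tape where
  "blank_tape = ((\<lambda>_. blank), 0)"

definition input_tape :: "str \<Rightarrow> tape" where
  "input_tape x =
     ((\<lambda>i. if 0 \<le> i \<and> i < int (length x) then bit_sym (x ! nat i) else blank), 0)"

definition init_config :: "ntm \<Rightarrow> str \<Rightarrow> config" where
  "init_config M x = (start_state M, input_tape x # replicate (num_tapes M - 1) blank_tape)"

definition tape_read :: "tape \<Rightarrow> nat" where
  "tape_read t = fst t (snd t)"

definition tape_update :: "tape \<Rightarrow> nat \<Rightarrow> dir \<Rightarrow> tape" where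
  "tape_update t s d = ((fst t)(snd t := s), snd t + shift d)"

definition applicable :: "instr \<Rightarrow> config \<Rightarrow> bool" where
  "applicable \<iota> c \<longleftrightarrow> src \<iota> = fst c \<and> reads \<iota> = map tape_read (snd c)"

definition apply_instr :: "instr \<Rightarrow> config \<Rightarrow> config" where
  "apply_instr \<iota> c =
     (dst \<iota>, map (\<lambda>(t, s, d). tape_update t s d) (zip (snd c) (zip (writes \<iota>) (moves \<iota>))))"

definition halted :: "ntm \<Rightarrow> config \<Rightarrow> bool" where
  "halted M c \<longleftrightarrow> (\<forall>\<iota> \<in> set (program M). \<not> applicable \<iota> c)"

text \<open>
  A computation path is the list of the program indices of the instructions executed;
  \<open>run M c \<pi> c'\<close> says that \<open>\<pi>\<close> is a path of \<open>M\<close> leading from \<open>c\<close> to \<open>c'\<close>.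
\<close>

fun run :: "ntm \<Rightarrow> config \<Rightarrow> nat list \<Rightarrow> config \<Rightarrow> bool" where
  "run M c [] c' \<longleftrightarrow> c' = c"
| "run M c (i # \<pi>) c' \<longleftrightarrow>
     i < length (program M) \<and> applicable (program M ! i) c \<and>
     run M (apply_instr (program M ! i) c) \<pi> c'"

definition accepting_path :: "ntm \<Rightarrow> str \<Rightarrow> nat list \<Rightarrow> bool" where
  "accepting_path M x \<pi> \<longleftrightarrow>
     (\<exists>c. run M (init_config M x) \<pi> c \<and> halted M c \<and> fst c = accept_state M)"

text \<open>
  Paths are encoded as strings by the prefix code \<open>i \<mapsto> 1\<^sup>i0\<close>. For a fixed machine the
  indices are bounded, so this lengthens a path only by a constant factor.
\<close>

definition encode_path :: "nat list \<Rightarrow> str" where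
  "encode_path \<pi> = concat (map (\<lambda>i. replicate i True @ [False]) \<pi>)"

definition acc :: "ntm \<Rightarrow> str \<Rightarrow> str set" where
  "acc M x = {encode_path \<pi> | \<pi>. accepting_path M x \<pi>}"

definition language :: "ntm \<Rightarrow> lang" where
  "language M = {x. \<exists>\<pi>. accepting_path M x \<pi>}"

text \<open>Every computation path, accepting or not, has polynomially bounded length.\<close>

definition poly_time :: "ntm \<Rightarrow> bool" where
  "poly_time M \<longleftrightarrow>
     (\<exists>p :: nat poly. \<forall>x \<pi> c. run M (init_config M x) \<pi> c \<longrightarrow> length \<pi> \<le> poly p (length x))"

definition NPM :: "ntm \<Rightarrow> bool" where
  "NPM M \<longleftrightarrow> wf_ntm M \<and> poly_time M"

definition DPM :: "ntm \<Rightarrow> bool" where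
  "DPM M \<longleftrightarrow> NPM M \<and> deterministic M"

definition UP_machine :: "ntm \<Rightarrow> bool" where
  "UP_machine M \<longleftrightarrow>
     NPM M \<and> (\<forall>x \<pi> \<pi>'. accepting_path M x \<pi> \<and> accepting_path M x \<pi>' \<longrightarrow> \<pi> = \<pi>')"


section \<open>Complexity classes\<close>

definition class_P :: "lang set" where
  "class_P = {language M | M. DPM M}"

definition class_UP :: "lang set" where
  "class_UP = {language M | M. UP_machine M}"

text \<open>
  The output of a transducer is the string written on its last tape, from the head position
  up to the first blank.
\<close>

definition tape_output :: "tape \<Rightarrow> str \<Rightarrow> bool" where
  "tape_output t y \<longleftrightarrow>
     (\<forall>j < length y. fst t (snd t + int j) = bit_sym (y ! j)) \<and>
     fst t (snd t + int (length y)) = blank"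

text \<open>
  A machine computing a partial function signals definedness by halting in its accepting state,
  and undefinedness by halting in any other state.
\<close>

definition computes :: "ntm \<Rightarrow> (str \<rightharpoonup> str) \<Rightarrow> bool" where
  "computes M f \<longleftrightarrow>
     (\<forall>x. \<exists>\<pi> c. run M (init_config M x) \<pi> c \<and> halted M c \<and>
        (case f x of
           None \<Rightarrow> fst c \<noteq> accept_state M
         | Some y \<Rightarrow> fst c = accept_state M \<and> tape_output (last (snd c)) y))"

definition partial_FP :: "(str \<rightharpoonup> str) set" where
  "partial_FP = {f. \<exists>M. DPM M \<and> computes M f}"

definition FP :: "(str \<Rightarrow> str) set" where
  "FP = {f. (\<lambda>x. Some (f x)) \<in> partial_FP}"

definition Easy_all_all_UP :: "lang set" where
  "Easy_all_all_UP =
     {L. finite L \<or>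
         (L \<in> class_UP \<and>
          (\<forall>N. UP_machine N \<and> language N = L \<longrightarrow> (\<exists>f \<in> FP. \<forall>x \<in> L. f x \<in> acc N x)))}"


section \<open>One-way functions\<close>

definition honest :: "(str \<rightharpoonup> str) \<Rightarrow> bool" where
  "honest f \<longleftrightarrow>
     (\<exists>p :: nat poly. \<forall>y \<in> ran f. \<forall>x \<in> dom f. f x = Some y \<longrightarrow> length x \<le> poly p (length y))"

definition FP_invertible :: "(str \<rightharpoonup> str) \<Rightarrow> bool" where
  "FP_invertible f \<longleftrightarrow> (\<exists>g \<in> FP. \<forall>y \<in> ran f. f (g y) = Some y)"

definition one_one_one_way :: "(str \<rightharpoonup> str) \<Rightarrow> bool" where
  "one_one_one_way f \<longleftrightarrow>
     honest f \<and> inj_on f (dom f) \<and> f \<in> partial_FP \<and> \<not> FP_invertible f"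

end

theory Submission
  imports Defs "HOL-Library.Multiset" "HOL-Library.Countable"
begin

text \<open>
  All machines are obtained from a few building blocks by one construction, the pipeline: a finite-state
  transduction of the input, a deterministic machine, a transduction of its output, and a possibly
  nondeterministic machine. Its labelled paths determine the guessed bits and the paths of the last
  machine; as a path is encoded in a prefix code, a finite-state transduction of the path recovers them.

  If all strings form an easy language and \<open>L\<close> is in P, then a UP machine \<open>N\<close> for \<open>L\<close> is prolonged to one
  for all strings by first deciding \<open>L\<close> and accepting outside of \<open>L\<close>; an accepting path of the latter,
  computed in polynomial time, contains one of \<open>N\<close>. Likewise, a machine that on input \<open>y\<close> guesses a
  preimage of \<open>y\<close> under a one-one function \<open>f\<close> onto all strings is a UP machine for all strings, and
  its accepting paths contain the preimages. Conversely, if \<open>N\<close> is a UP machine for all strings whose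
  accepting paths are hard to compute, then mapping a pair of \<open>x\<close> and an accepting path of \<open>N\<close> on \<open>x\<close>
  to \<open>x\<close> is a one-one one-way function. For closure under complement, note that the empty language is
  easy and that P is closed under complement.
\<close>

text \<open>A simulation that reaches the same acceptance along two branches destroys unambiguity,
  so accepting branches are counted with multiplicity throughout. The guesser reaches every string
  up to a length bound along exactly one branch; uniqueness of the preimage under an injective
  function thereby becomes uniqueness of the accepting path.

  The program of a composed machine is an arbitrary enumeration of a finite relation, so its indices
  say nothing about the stages. Labels attached to moves survive the composition, and a fixed
  program has only finitely many of them.

  A guesser has to know when to stop. Honesty bounds the preimage by a polynomial in
  \<open>length y\<close>, and a deterministic first stage writes a string at least that long,
  obtained by iterated squaring of lengths.

  Two further tests are reduced to the verification of a given path: equality of strings, and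
  membership in a finite language. Verification also shows that every infinite easy language is in
  P.\<close>

type_synonym 'q move = "'q \<times> nat list \<times> dir list"
type_synonym 'q trans = "'q \<Rightarrow> nat list \<Rightarrow> 'q move set"
type_synonym 'q lab = "'q \<Rightarrow> nat list \<Rightarrow> 'q move \<Rightarrow> str"
type_synonym outcomes = "(str \<times> tape) multiset"

section \<open>Computation trees and the outcomes of accepting branches\<close>

definition upd :: "tape list \<Rightarrow> nat list \<Rightarrow> dir list \<Rightarrow> tape list" where
  "upd ts w m = map (\<lambda>(t, s, d). tape_update t s d) (zip ts (zip w m))"

definition pref :: "str \<Rightarrow> outcomes \<Rightarrow> outcomes" where
  "pref u V = image_mset (\<lambda>(s, t). (u @ s, t)) V"

lemma pref_Nil [simp]: "pref [] V = V"
  by (simp add: pref_def)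

lemma pref_empty [simp]: "pref u {#} = {#}"
  by (simp add: pref_def)

lemma pref_single [simp]: "pref u {#(s, t)#} = {#(u @ s, t)#}"
  by (simp add: pref_def)

lemma pref_add [simp]: "pref u (V + W) = pref u V + pref u W"
  by (simp add: pref_def)

lemma pref_pref [simp]: "pref u (pref v V) = pref (u @ v) V"
  by (simp add: pref_def multiset.map_comp o_def case_prod_beta')

lemma size_pref [simp]: "size (pref u V) = size V"
  by (simp add: pref_def)

lemma pref_sum: "pref u (\<Sum>x\<in>S. W x) = (\<Sum>x\<in>S. pref u (W x))"
  by (induction S rule: infinite_finite_induct) auto

text \<open>
  A computation tree is summarised by a bound on its depth and by the multiset of outcomes of its
  accepting branches. An outcome consists of the concatenated labels of a branch and of the final
  content of the last tape. As a multiset, the outcomes are additive over nondeterministic choices,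
  and at most one outcome means at most one accepting path.
\<close>

inductive tree :: "'q trans \<Rightarrow> 'q \<Rightarrow> 'q lab \<Rightarrow> 'q \<times> tape list \<Rightarrow> nat \<Rightarrow> outcomes \<Rightarrow> bool"
  for \<delta> a e where
  halt: "\<delta> q (map tape_read ts) = {} \<Longrightarrow>
    tree \<delta> a e (q, ts) n (if q = a then {#([], last ts)#} else {#})"
| step: "finite (\<delta> q (map tape_read ts)) \<Longrightarrow> \<delta> q (map tape_read ts) \<noteq> {} \<Longrightarrow>
    \<forall>d \<in> \<delta> q (map tape_read ts). tree \<delta> a e (fst d, upd ts (fst (snd d)) (snd (snd d))) n (W d) \<Longrightarrow>
    V = (\<Sum>d\<in>\<delta> q (map tape_read ts). pref (e q (map tape_read ts) d) (W d)) \<Longrightarrow>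
    tree \<delta> a e (q, ts) (Suc n) V"

text \<open>\<open>halt\<close> admits every bound, so the number is only an upper bound on the
  depth. \<open>step\<close> demands one bound for all children, and this lemma equalises branches
  of different length.\<close>

lemma tree_mono: "tree \<delta> a e c n V \<Longrightarrow> n \<le> m \<Longrightarrow> tree \<delta> a e c m V"
proof (induction arbitrary: m rule: tree.induct)
  case (halt q ts n)
  then show ?case by (intro tree.halt)
next
  case (step q ts n W V)
  then obtain m' where m: "m = Suc m'" "n \<le> m'" by (cases m) auto
  show ?case unfolding m(1)
    by (rule tree.step[where W = W]) (use step.IH step.hyps m in auto)
qed

lemma tree_det:
  assumes "\<delta> q (map tape_read ts) = {(q', w, m)}" "tree \<delta> a e (q', upd ts w m) n V"
    and "e q (map tape_read ts) (q', w, m) = []" "n < n'"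
  shows "tree \<delta> a e (q, ts) n' V"
proof -
  have "tree \<delta> a e (q, ts) (Suc n) V"
    by (rule tree.step[where W = "\<lambda>_. V"]) (use assms in auto)
  then show ?thesis by (rule tree_mono) (use assms in simp)
qed

lemma tree_halt:
  assumes "\<delta> q (map tape_read ts) = {}" "V = (if q = a then {#([], last ts)#} else {#})"
  shows "tree \<delta> a e (q, ts) n V"
  unfolding assms(2) by (rule tree.halt) (rule assms(1))

subsection \<open>Turing machines as transition functions\<close>

text \<open>Moves replace indices: for fixed state and read symbols an instruction is determined by
  its move, so for a distinct program the elements of \<open>delta M s r\<close> correspond to the
  applicable indices. Accepting paths can then be counted through moves.\<close>

definition delta :: "ntm \<Rightarrow> nat trans" where
  "delta M s r = {(dst \<iota>, writes \<iota>, moves \<iota>) | \<iota>. \<iota> \<in> set (program M) \<and> src \<iota> = s \<and> reads \<iota> = r}"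

definition instr_lab :: "nat lab \<Rightarrow> instr \<Rightarrow> str" where
  "instr_lab e \<iota> = e (src \<iota>) (reads \<iota>) (dst \<iota>, writes \<iota>, moves \<iota>)"

definition path_lab :: "nat lab \<Rightarrow> ntm \<Rightarrow> nat list \<Rightarrow> str" where
  "path_lab e M \<pi> = concat (map (\<lambda>i. instr_lab e (program M ! i)) \<pi>)"

lemma finite_delta [simp]: "finite (delta M s r)"
proof -
  have "delta M s r \<subseteq> (\<lambda>\<iota>. (dst \<iota>, writes \<iota>, moves \<iota>)) ` set (program M)"
    by (auto simp: delta_def)
  then show ?thesis by (rule finite_subset) simp
qed

lemma apply_instr_upd: "apply_instr \<iota> (s, ts) = (dst \<iota>, upd ts (writes \<iota>) (moves \<iota>))"
  by (simp add: apply_instr_def upd_def)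

lemma halted_delta: "halted M (s, ts) \<longleftrightarrow> delta M s (map tape_read ts) = {}"
  by (auto simp: halted_def applicable_def delta_def)

lemma applicable_delta:
  "i < length (program M) \<Longrightarrow> applicable (program M ! i) (s, ts) \<Longrightarrow>
    (dst (program M ! i), writes (program M ! i), moves (program M ! i)) \<in> delta M s (map tape_read ts)"
  by (auto simp: applicable_def delta_def)

lemma delta_index:
  assumes "d \<in> delta M s (map tape_read ts)"
  obtains i where "i < length (program M)" "applicable (program M ! i) (s, ts)"
    "d = (dst (program M ! i), writes (program M ! i), moves (program M ! i))"
  using assms by (auto simp: applicable_def delta_def in_set_conv_nth)

text \<open>Induction on the bound: the paths from a successor configuration are shorter by
  one.\<close>

lemma tree_exists:
  assumes "\<And>\<pi> c'. run M c \<pi> c' \<Longrightarrow> length \<pi> \<le> n"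
  shows "\<exists>V. tree (delta M) a e c n V"
  using assms
proof (induction n arbitrary: c)
  case 0
  obtain s ts where c: "c = (s, ts)" by (cases c)
  have "delta M s (map tape_read ts) = {}"
  proof (rule ccontr)
    assume "\<not> ?thesis"
    then obtain d where "d \<in> delta M s (map tape_read ts)" by blast
    then obtain i where "i < length (program M)" "applicable (program M ! i) (s, ts)"
      by (rule delta_index)
    then have "run M c [i] (apply_instr (program M ! i) c)" by (simp add: c)
    from 0[OF this] show False by simp
  qed
  then show ?case unfolding c by (blast intro: tree.halt)
next
  case (Suc n)
  obtain s ts where c: "c = (s, ts)" by (cases c)
  show ?case
  proof (cases "delta M s (map tape_read ts) = {}")
    case True
    then show ?thesis unfolding c by (blast intro: tree.halt)
  next
    case False
    have "\<forall>d\<in>delta M s (map tape_read ts).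
       \<exists>V. tree (delta M) a e (fst d, upd ts (fst (snd d)) (snd (snd d))) n V"
    proof
      fix d assume "d \<in> delta M s (map tape_read ts)"
      then obtain i where i: "i < length (program M)" "applicable (program M ! i) (s, ts)"
        "d = (dst (program M ! i), writes (program M ! i), moves (program M ! i))"
        by (rule delta_index)
      show "\<exists>V. tree (delta M) a e (fst d, upd ts (fst (snd d)) (snd (snd d))) n V"
      proof (rule Suc.IH)
        fix \<pi> c'
        assume "run M (fst d, upd ts (fst (snd d)) (snd (snd d))) \<pi> c'"
        then have "run M c (i # \<pi>) c'" using i by (simp add: c apply_instr_upd)
        from Suc.prems[OF this] show "length \<pi> \<le> n" by simp
      qed
    qed
    then obtain W where "\<forall>d\<in>delta M s (map tape_read ts).
       tree (delta M) a e (fst d, upd ts (fst (snd d)) (snd (snd d))) n (W d)" by metis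
    then have "tree (delta M) a e c (Suc n)
        (\<Sum>d\<in>delta M s (map tape_read ts). pref (e s (map tape_read ts) d) (W d))"
      unfolding c using False by (intro tree.step[where W = W]) auto
    then show ?thesis by blast
  qed
qed

lemma tree_bound: "tree (delta M) a e c n V \<Longrightarrow> run M c \<pi> c' \<Longrightarrow> length \<pi> \<le> n"
proof (induction arbitrary: \<pi> rule: tree.induct)
  case (halt q ts n)
  then show ?case by (cases \<pi>) (auto dest: applicable_delta)
next
  case (step q ts n W V)
  show ?case
  proof (cases \<pi>)
    case (Cons i \<pi>')
    let ?\<iota> = "program M ! i"
    have i: "i < length (program M)" "applicable ?\<iota> (q, ts)" "run M (apply_instr ?\<iota> (q, ts)) \<pi>' c'"
      using step.prems Cons by auto
    have "length \<pi>' \<le> n"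
      using step.IH applicable_delta[OF i(1,2)] i(3) by (auto simp: apply_instr_upd)
    then show ?thesis using Cons by simp
  qed simp
qed

lemma tree_sound:
  "tree (delta M) a e c n V \<Longrightarrow> run M c \<pi> c' \<Longrightarrow> halted M c' \<Longrightarrow> fst c' = a \<Longrightarrow>
    (path_lab e M \<pi>, last (snd c')) \<in># V"
proof (induction arbitrary: \<pi> rule: tree.induct)
  case (halt q ts n)
  then show ?case by (cases \<pi>) (auto dest: applicable_delta simp: path_lab_def)
next
  case (step q ts n W V)
  show ?case
  proof (cases \<pi>)
    case Nil
    then show ?thesis using step by (cases c') (auto simp: halted_delta)
  next
    case (Cons i \<pi>')
    let ?\<iota> = "program M ! i"
    let ?d = "(dst ?\<iota>, writes ?\<iota>, moves ?\<iota>)"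
    have i: "i < length (program M)" "applicable ?\<iota> (q, ts)" "run M (apply_instr ?\<iota> (q, ts)) \<pi>' c'"
      using step.prems Cons by auto
    have d: "?d \<in> delta M q (map tape_read ts)" by (rule applicable_delta[OF i(1,2)])
    have "(path_lab e M \<pi>', last (snd c')) \<in># W ?d"
      using step.IH d i(3) step.prems(2,3) by (auto simp: apply_instr_upd)
    then have "(path_lab e M \<pi>, last (snd c')) \<in># pref (e q (map tape_read ts) ?d) (W ?d)"
      using i(2) by (force simp: Cons path_lab_def instr_lab_def pref_def applicable_def image_iff)
    then show ?thesis unfolding step.hyps(3) using d step.hyps(1) by (auto simp: set_mset_sum)
  qed
qed

lemma tree_complete:
  "tree (delta M) a e c n V \<Longrightarrow> (s, t) \<in># V \<Longrightarrow>
    \<exists>\<pi> c'. run M c \<pi> c' \<and> halted M c' \<and> fst c' = a \<and> s = path_lab e M \<pi> \<and> t = last (snd c')"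
proof (induction arbitrary: s t rule: tree.induct)
  case (halt q ts n)
  then show ?case
    by (intro exI[of _ "[]"] exI[of _ "(q, ts)"]) (auto simp: halted_delta path_lab_def split: if_splits)
next
  case (step q ts n W V)
  from step.prems obtain d where d: "d \<in> delta M q (map tape_read ts)"
    "(s, t) \<in># pref (e q (map tape_read ts) d) (W d)"
    unfolding step.hyps(3) using step.hyps(1) by (auto simp: set_mset_sum)
  from d(2) obtain s' where s': "(s', t) \<in># W d" "s = e q (map tape_read ts) d @ s'"
    by (auto simp: pref_def)
  obtain \<pi> c' where \<pi>: "run M (fst d, upd ts (fst (snd d)) (snd (snd d))) \<pi> c'" "halted M c'" "fst c' = a"
    "s' = path_lab e M \<pi>" "t = last (snd c')"
    using step.IH d(1) s'(1) by blast
  from d(1) obtain i where i: "i < length (program M)" "applicable (program M ! i) (q, ts)"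
        "d = (dst (program M ! i), writes (program M ! i), moves (program M ! i))"
        by (rule delta_index)
  show ?case
    by (rule exI[of _ "i # \<pi>"], rule exI[of _ c'])
      (use i \<pi> s'(2) in \<open>auto simp: apply_instr_upd path_lab_def instr_lab_def applicable_def\<close>)
qed

text \<open>Two accepting paths that split at different moves would each add an outcome to the sum
  at the splitting node. If the moves agree, then so do the indices, since the program is
  distinct.\<close>

lemma tree_unambiguous:
  assumes "distinct (program M)"
  shows "tree (delta M) a e c n V \<Longrightarrow> size V \<le> 1 \<Longrightarrow>
    run M c \<pi>1 c1 \<Longrightarrow> halted M c1 \<Longrightarrow> fst c1 = a \<Longrightarrow>
    run M c \<pi>2 c2 \<Longrightarrow> halted M c2 \<Longrightarrow> fst c2 = a \<Longrightarrow> \<pi>1 = \<pi>2"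
proof (induction arbitrary: \<pi>1 \<pi>2 rule: tree.induct)
  case (halt q ts n)
  then show ?case by (cases \<pi>1; cases \<pi>2) (auto dest: applicable_delta)
next
  case (step q ts n W V)
  have "\<pi>1 \<noteq> []" "\<pi>2 \<noteq> []"
    using step.prems step.hyps(2) by (auto simp: halted_delta)
  then obtain i1 \<rho>1 i2 \<rho>2 where p: "\<pi>1 = i1 # \<rho>1" "\<pi>2 = i2 # \<rho>2"
    by (meson list.exhaust)
  let ?d = "\<lambda>i. (dst (program M ! i), writes (program M ! i), moves (program M ! i))"
  let ?r = "map tape_read ts"
  have i1: "i1 < length (program M)" "applicable (program M ! i1) (q, ts)"
      "run M (fst (?d i1), upd ts (fst (snd (?d i1))) (snd (snd (?d i1)))) \<rho>1 c1" and
    i2: "i2 < length (program M)" "applicable (program M ! i2) (q, ts)"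
      "run M (fst (?d i2), upd ts (fst (snd (?d i2))) (snd (snd (?d i2)))) \<rho>2 c2"
    using step.prems by (auto simp: p apply_instr_upd)
  note d1 = applicable_delta[OF i1(1,2)] and d2 = applicable_delta[OF i2(1,2)]
  have t: "\<And>d. d \<in> delta M q ?r \<Longrightarrow>
      tree (delta M) a e (fst d, upd ts (fst (snd d)) (snd (snd d))) n (W d)"
    using step.IH by blast
  have W1: "W (?d i1) \<noteq> {#}" using tree_sound[OF t[OF d1] i1(3) step.prems(3,4)] by auto
  have W2: "W (?d i2) \<noteq> {#}" using tree_sound[OF t[OF d2] i2(3) step.prems(6,7)] by auto
  have sz: "(\<Sum>d\<in>delta M q ?r. size (W d)) \<le> 1"
    using step.prems(1) unfolding step.hyps(3) by (simp add: size_multiset_sum)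
  have d_eq: "?d i1 = ?d i2"
  proof (rule ccontr)
    assume "?d i1 \<noteq> ?d i2"
    then have "size (W (?d i1)) + size (W (?d i2)) = (\<Sum>d\<in>{?d i1, ?d i2}. size (W d))" by auto
    also have "\<dots> \<le> (\<Sum>d\<in>delta M q ?r. size (W d))"
      by (rule sum_mono2) (use d1 d2 in auto)
    finally show False using sz W1 W2 by (auto simp: Suc_le_eq nonempty_has_size)
  qed
  then have "program M ! i1 = program M ! i2"
    using i1(2) i2(2) by (simp add: applicable_def)
  then have ieq: "i1 = i2" using assms i1(1) i2(1) by (simp add: nth_eq_iff_index_eq)
  have "size (W (?d i1)) \<le> (\<Sum>d\<in>delta M q ?r. size (W d))"
    by (rule member_le_sum[OF d1]) auto
  then have "size (W (?d i1)) \<le> 1" using sz by simp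
  then have "\<rho>1 = \<rho>2"
    using step.IH d1 i1(3) i2(3) step.prems ieq by blast
  then show ?case using p ieq by simp
qed

text \<open>This direction lets a given UP machine be used as a stage. At most one child can have
  outcomes, because accepting paths through two children would begin with different moves.\<close>

lemma unambiguous_tree:
  "tree (delta M) a e c n V \<Longrightarrow>
    (\<And>\<pi>1 c1 \<pi>2 c2. run M c \<pi>1 c1 \<Longrightarrow> halted M c1 \<Longrightarrow> fst c1 = a \<Longrightarrow>
      run M c \<pi>2 c2 \<Longrightarrow> halted M c2 \<Longrightarrow> fst c2 = a \<Longrightarrow> \<pi>1 = \<pi>2) \<Longrightarrow> size V \<le> 1"
proof (induction rule: tree.induct)
  case (halt q ts n)
  then show ?case by simp
next
  case (step q ts n W V)
  let ?r = "map tape_read ts"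
  let ?next = "\<lambda>d. (fst d, upd ts (fst (snd d)) (snd (snd d)))"
  have path: "\<exists>i. d = (dst (program M ! i), writes (program M ! i), moves (program M ! i)) \<and>
      (\<forall>\<pi> c'. run M (?next d) \<pi> c' \<longrightarrow> run M (q, ts) (i # \<pi>) c')"
    if d: "d \<in> delta M q ?r" for d
  proof -
    obtain i where "i < length (program M)" "applicable (program M ! i) (q, ts)"
      "d = (dst (program M ! i), writes (program M ! i), moves (program M ! i))"
      by (rule delta_index[OF d])
    then show ?thesis by (intro exI[of _ i]) (simp add: apply_instr_upd)
  qed
  have IH: "size (W d) \<le> 1" if d: "d \<in> delta M q ?r" for d
  proof -
    obtain i where i: "\<And>\<pi> c'. run M (?next d) \<pi> c' \<Longrightarrow> run M (q, ts) (i # \<pi>) c'"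
      using path[OF d] by metis
    show ?thesis
      using step.IH[rule_format, OF d] step.prems[OF i _ _ i] by blast
  qed
  have uniq: "d = d'" if d: "d \<in> delta M q ?r" "W d \<noteq> {#}" and d': "d' \<in> delta M q ?r" "W d' \<noteq> {#}" for d d'
  proof -
    have t: "tree (delta M) a e (?next d) n (W d)" "tree (delta M) a e (?next d') n (W d')"
      using step.IH d(1) d'(1) by auto
    obtain \<pi> c1 where 1: "run M (?next d) \<pi> c1" "halted M c1" "fst c1 = a"
      using tree_complete[OF t(1)] d(2) by (metis multiset_nonemptyE prod.collapse)
    obtain \<pi>' c2 where 2: "run M (?next d') \<pi>' c2" "halted M c2" "fst c2 = a"
      using tree_complete[OF t(2)] d'(2) by (metis multiset_nonemptyE prod.collapse)
    obtain i where i: "d = (dst (program M ! i), writes (program M ! i), moves (program M ! i))"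
      "run M (q, ts) (i # \<pi>) c1" using path[OF d(1)] 1 by blast
    obtain i' where i': "d' = (dst (program M ! i'), writes (program M ! i'), moves (program M ! i'))"
      "run M (q, ts) (i' # \<pi>') c2" using path[OF d'(1)] 2 by blast
    have "i # \<pi> = i' # \<pi>'" by (rule step.prems[OF i(2) 1(2,3) i'(2) 2(2,3)])
    then show ?thesis using i i' by simp
  qed
  have "size V = (\<Sum>d\<in>delta M q ?r. size (W d))"
    by (simp add: step.hyps(3) size_multiset_sum)
  also have "\<dots> \<le> 1"
  proof (cases "\<exists>d \<in> delta M q ?r. W d \<noteq> {#}")
    case True
    then obtain d where d: "d \<in> delta M q ?r" "W d \<noteq> {#}" by blast
    have "\<forall>d' \<in> delta M q ?r - {d}. size (W d') = 0" using uniq[OF d] by fastforce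
    then have "(\<Sum>d\<in>delta M q ?r. size (W d)) = (\<Sum>d\<in>{d}. size (W d))"
      by (rule sum.mono_neutral_right[rotated 2]) (use d in auto)
    then show ?thesis using IH[OF d(1)] by simp
  qed simp
  finally show ?case .
qed

section \<open>Polynomial bounds and outcome functions of machines\<close>

definition pbounded :: "(nat \<Rightarrow> nat) \<Rightarrow> bool" where
  "pbounded g \<longleftrightarrow> (\<exists>p :: nat poly. \<forall>n. g n \<le> poly p n)"

lemma poly_nat_mono: "m \<le> n \<Longrightarrow> poly p m \<le> poly p n" for p :: "nat poly"
  by (induction p) (auto intro!: add_mono mult_mono)

lemma pbounded_poly [intro]: "pbounded (poly p)"
  unfolding pbounded_def by blast

lemma pbounded_id [intro]: "pbounded (\<lambda>n. n)"
  unfolding pbounded_def by (rule exI[of _ "[:0, 1:]"]) simp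

lemma pbounded_const [intro]: "pbounded (\<lambda>_. k)"
  unfolding pbounded_def by (rule exI[of _ "[:k:]"]) simp

lemma pbounded_add [intro]: "pbounded f \<Longrightarrow> pbounded g \<Longrightarrow> pbounded (\<lambda>n. f n + g n)"
  unfolding pbounded_def by (metis add_mono poly_add)

lemma pbounded_mult [intro]: "pbounded f \<Longrightarrow> pbounded g \<Longrightarrow> pbounded (\<lambda>n. f n * g n)"
  unfolding pbounded_def by (metis mult_le_mono poly_mult)

lemma pbounded_Suc [intro]: "pbounded f \<Longrightarrow> pbounded (\<lambda>n. Suc (f n))"
  using pbounded_add[of f "\<lambda>_. 1"] by auto

lemma pbounded_comp [intro]: "pbounded f \<Longrightarrow> pbounded (\<lambda>n. poly p (f n))"
  unfolding pbounded_def by (metis poly_nat_mono poly_pcompose)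

text \<open>The interface through which machines are used from here on: acceptance, unambiguity and
  output can all be read off \<open>V\<close>.\<close>

definition mach :: "nat lab \<Rightarrow> ntm \<Rightarrow> (str \<Rightarrow> outcomes) \<Rightarrow> bool" where
  "mach e M V \<longleftrightarrow> wf_ntm M \<and>
     (\<exists>p. \<forall>x. tree (delta M) (accept_state M) e (init_config M x) (poly p (length x)) (V x))"

text \<open>The labelling \<open>e\<close> is arbitrary; it is chosen later according to what has to
  be recovered from a path.\<close>

lemma NPM_mach:
  assumes "NPM M"
  obtains V where "mach e M V"
proof -
  from assms obtain p :: "nat poly" where
    "\<And>x \<pi> c. run M (init_config M x) \<pi> c \<Longrightarrow> length \<pi> \<le> poly p (length x)"
    unfolding NPM_def poly_time_def by blast
  then have "\<exists>V. tree (delta M) (accept_state M) e (init_config M x) (poly p (length x)) V" for x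
    by (rule tree_exists)
  then obtain V where "\<And>x. tree (delta M) (accept_state M) e (init_config M x) (poly p (length x)) (V x)"
    by metis
  then show ?thesis using assms that by (auto simp: mach_def NPM_def)
qed

lemma mach_NPM: "mach e M V \<Longrightarrow> NPM M"
  unfolding NPM_def poly_time_def mach_def using tree_bound by blast

lemma mach_sound:
  assumes "mach e M V" "run M (init_config M x) \<pi> c" "halted M c" "fst c = accept_state M"
  shows "(path_lab e M \<pi>, last (snd c)) \<in># V x"
  using assms tree_sound unfolding mach_def by metis

lemma mach_complete:
  assumes "mach e M V" "(s, t) \<in># V x"
  obtains \<pi> c where "run M (init_config M x) \<pi> c" "halted M c" "fst c = accept_state M"
    "s = path_lab e M \<pi>" "t = last (snd c)"
  using assms tree_complete unfolding mach_def by metis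

lemma mach_accepting:
  assumes "mach e M V" "accepting_path M x \<pi>"
  shows "\<exists>t. (path_lab e M \<pi>, t) \<in># V x"
  using mach_sound[OF assms(1)] assms(2) unfolding accepting_path_def by blast

lemma mach_language: "mach e M V \<Longrightarrow> language M = {x. V x \<noteq> {#}}"
  unfolding language_def
  by (auto dest: mach_accepting) (metis accepting_path_def mach_complete multiset_nonemptyE prod.collapse)

lemma mach_UP:
  assumes "mach e M V" "\<And>x. size (V x) \<le> 1"
  shows "UP_machine M"
proof -
  have d: "distinct (program M)" using assms(1) by (auto simp: mach_def wf_ntm_def)
  show ?thesis unfolding UP_machine_def accepting_path_def
    using mach_NPM[OF assms(1)] assms tree_unambiguous[OF d]
    unfolding mach_def by blast
qed

lemma UP_size:
  assumes "UP_machine M" "mach e M V"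
  shows "size (V x) \<le> 1"
proof -
  obtain n where t: "tree (delta M) (accept_state M) e (init_config M x) n (V x)"
    using assms(2) unfolding mach_def by blast
  show ?thesis
    by (rule unambiguous_tree[OF t]) (use assms(1) in \<open>unfold UP_machine_def accepting_path_def, blast\<close>)
qed

lemma run_extend:
  assumes "\<And>\<pi> c'. run M c \<pi> c' \<Longrightarrow> length \<pi> \<le> n"
  shows "\<exists>\<pi> c'. run M c \<pi> c' \<and> halted M c'"
  using assms
proof (induction n arbitrary: c)
  case 0
  have "halted M c"
  proof (rule ccontr)
    assume "\<not> ?thesis"
    then obtain i where "i < length (program M)" "applicable (program M ! i) c"
      by (auto simp: halted_def in_set_conv_nth)
    then have "run M c [i] (apply_instr (program M ! i) c)" by simp
    from 0[OF this] show False by simp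
  qed
  then show ?case by (intro exI[of _ "[]"] exI[of _ c]) simp
next
  case (Suc n)
  show ?case
  proof (cases "halted M c")
    case True
    then show ?thesis by (intro exI[of _ "[]"] exI[of _ c]) simp
  next
    case False
    then obtain i where i: "i < length (program M)" "applicable (program M ! i) c"
      by (auto simp: halted_def in_set_conv_nth)
    have "\<exists>\<pi> c'. run M (apply_instr (program M ! i) c) \<pi> c' \<and> halted M c'"
    proof (rule Suc.IH)
      fix \<pi> c' assume "run M (apply_instr (program M ! i) c) \<pi> c'"
      then have "run M c (i # \<pi>) c'" using i by simp
      from Suc.prems[OF this] show "length \<pi> \<le> n" by simp
    qed
    then show ?thesis using i by (metis run.simps(2))
  qed
qed

lemma det_run_unique:
  assumes "distinct (program M)" "deterministic M"
  shows "run M c \<pi>1 c1 \<Longrightarrow> halted M c1 \<Longrightarrow> run M c \<pi>2 c2 \<Longrightarrow> halted M c2 \<Longrightarrow> \<pi>1 = \<pi>2 \<and> c1 = c2"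
proof (induction \<pi>1 arbitrary: c \<pi>2)
  case Nil
  then show ?case by (cases \<pi>2) (auto simp: halted_def)
next
  case (Cons i \<pi>)
  then obtain j \<rho> where j: "\<pi>2 = j # \<rho>"
    by (cases \<pi>2) (auto simp: halted_def)
  have "program M ! i = program M ! j"
    using Cons.prems assms(2) by (auto simp: deterministic_def j applicable_def)
  then have "i = j" using Cons.prems assms(1) by (simp add: j nth_eq_iff_index_eq)
  have "\<pi> = \<rho> \<and> c1 = c2"
    by (rule Cons.IH) (use Cons.prems j \<open>i = j\<close> in auto)
  then show ?case using \<open>i = j\<close> j by simp
qed

lemma DPM_UP: "DPM M \<Longrightarrow> UP_machine M"
  unfolding UP_machine_def accepting_path_def DPM_def
  using det_run_unique unfolding NPM_def wf_ntm_def by blast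

lemma NPM_halting_run:
  assumes "NPM M"
  shows "\<exists>\<pi> c. run M (init_config M x) \<pi> c \<and> halted M c"
  using assms run_extend unfolding NPM_def poly_time_def by blast

text \<open>\<open>computes\<close> asks for one halting run. In the undefined case any halting run
  will do, since an accepting one would yield an outcome.\<close>

lemma mach_computes:
  assumes "mach e M V"
    and "\<And>x. f x = None \<Longrightarrow> V x = {#}"
    and "\<And>x y. f x = Some y \<Longrightarrow> V x \<noteq> {#} \<and> (\<forall>(s, t) \<in># V x. tape_output t y)"
  shows "computes M f"
  unfolding computes_def
proof
  fix x
  show "\<exists>\<pi> c. run M (init_config M x) \<pi> c \<and> halted M c \<and>
        (case f x of None \<Rightarrow> fst c \<noteq> accept_state M
         | Some y \<Rightarrow> fst c = accept_state M \<and> tape_output (last (snd c)) y)"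
  proof (cases "f x")
    case None
    then show ?thesis
      using NPM_halting_run[OF mach_NPM[OF assms(1)], of x] assms(2)[OF None] mach_sound[OF assms(1)]
      by fastforce
  next
    case (Some y)
    then obtain s t where st: "(s, t) \<in># V x" "tape_output t y"
      using assms(3)[OF Some] by (metis (mono_tags, lifting) case_prodD multiset_nonemptyE prod.collapse)
    then obtain \<pi> c where "run M (init_config M x) \<pi> c" "halted M c" "fst c = accept_state M"
      "t = last (snd c)"
      using mach_complete[OF assms(1)] by metis
    then show ?thesis using Some st(2) by (intro exI[of _ \<pi>] exI[of _ c]) simp
  qed
qed

text \<open>A deterministic machine has only one halting run, so every outcome stems from the run
  described by \<open>computes\<close>.\<close>

lemma computes_mach:
  assumes "DPM M" "computes M f" "mach e M V"
  shows "f x = None \<Longrightarrow> V x = {#}"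
    and "f x = Some y \<Longrightarrow> V x \<noteq> {#} \<and> (\<forall>(s, t) \<in># V x. tape_output t y)"
proof -
  have d: "distinct (program M)" "deterministic M"
    using assms(1) by (auto simp: DPM_def NPM_def wf_ntm_def)
  from assms(2) obtain \<pi> c where c: "run M (init_config M x) \<pi> c" "halted M c"
     "(case f x of None \<Rightarrow> fst c \<noteq> accept_state M
         | Some y \<Rightarrow> fst c = accept_state M \<and> tape_output (last (snd c)) y)"
    unfolding computes_def by blast
  have u: "fst c = accept_state M \<and> t = last (snd c)" if "(s, t) \<in># V x" for s t
    by (rule mach_complete[OF assms(3) that]) (use det_run_unique[OF d c(1,2)] in blast)
  show "V x = {#}" if "f x = None"
    using u c(3) that by (metis multiset_nonemptyE option.simps(4) prod.collapse)
  show "V x \<noteq> {#} \<and> (\<forall>(s, t) \<in># V x. tape_output t y)" if "f x = Some y"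
    using u c that mach_sound[OF assms(3) c(1,2)] by fastforce
qed

section \<open>Compiling transition functions into programs\<close>

definition symtuples :: "nat \<Rightarrow> nat \<Rightarrow> nat list set" where
  "symtuples K A = {r. length r = K \<and> set r \<subseteq> {..<A}}"

lemma finite_symtuples [simp]: "finite (symtuples K A)"
  using finite_lists_length_eq[of "{..<A}" K] by (simp add: symtuples_def conj_commute)

definition tapes_ok :: "nat \<Rightarrow> nat \<Rightarrow> tape list \<Rightarrow> bool" where
  "tapes_ok K A ts \<longleftrightarrow> length ts = K \<and> (\<forall>t \<in> set ts. \<forall>i. fst t i < A)"

lemma tapes_ok_reads: "tapes_ok K A ts \<Longrightarrow> map tape_read ts \<in> symtuples K A"
  by (auto simp: tapes_ok_def symtuples_def tape_read_def)

lemma tapes_ok_upd: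
  assumes "tapes_ok K A ts" "w \<in> symtuples K A" "length m = K"
  shows "tapes_ok K A (upd ts w m)"
proof -
  have "fst t i < A" if "t \<in> set (upd ts w m)" for t i
  proof -
    from that obtain j where "j < K" "t = tape_update (ts ! j) (w ! j) (m ! j)"
      using assms by (auto simp: upd_def in_set_conv_nth tapes_ok_def symtuples_def)
    moreover have "w ! k < A \<and> (\<forall>i. fst (ts ! k) i < A)" if "k < K" for k
      using that assms nth_mem[of k w] nth_mem[of k ts]
      by (auto simp: tapes_ok_def symtuples_def subset_iff simp del: nth_mem)
    ultimately show ?thesis by (simp add: tape_update_def)
  qed
  then show ?thesis using assms by (auto simp: tapes_ok_def upd_def symtuples_def)
qed

definition encode_instr :: "'q::countable \<times> nat list \<times> 'q move \<Rightarrow> instr" where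
  "encode_instr = (\<lambda>(q, r, (q', w, m)).
     \<lparr>src = to_nat q, reads = r, dst = to_nat q', writes = w, moves = m\<rparr>)"

text \<open>Only states in \<open>Q\<close> and symbols below \<open>A\<close> can occur, so the
  restriction of \<open>\<delta>\<close> to them is a finite relation, and any enumeration of it is
  a program. The bound \<open>3 \<le> A\<close> leaves room for the blank and both bits.\<close>

lemma compile:
  fixes \<delta> :: "'q::countable trans"
  assumes Q: "finite Q" "q0 \<in> Q" and K: "1 \<le> K" and A: "3 \<le> A"
    and fin: "\<And>q r. finite (\<delta> q r)"
    and closed: "\<And>q r q' w m. q \<in> Q \<Longrightarrow> r \<in> symtuples K A \<Longrightarrow> (q', w, m) \<in> \<delta> q r \<Longrightarrow>
      q' \<in> Q \<and> w \<in> symtuples K A \<and> length m = K"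
    and B: "pbounded B"
    and V: "\<And>x. tree \<delta> a e (q0, input_tape x # replicate (K - 1) blank_tape) (B (length x)) (V x)"
  shows "\<exists>M e'. mach e' M V \<and>
    ((\<forall>q\<in>Q. \<forall>r d d'. d \<in> \<delta> q r \<longrightarrow> d' \<in> \<delta> q r \<longrightarrow> d = d') \<longrightarrow> deterministic M)"
proof -
  define X where "X = (SIGMA q:Q. SIGMA r:symtuples K A. \<delta> q r)"
  have "finite X" unfolding X_def using Q fin by (intro finite_SigmaI) auto
  then obtain P where P: "set P = encode_instr ` X" "distinct P"
    using finite_distinct_list[of "encode_instr ` X"] by auto
  define M where "M = \<lparr>num_tapes = K, start_state = to_nat q0, accept_state = to_nat a, program = P\<rparr>"
  \<comment> \<open>Labels are transported back along \<open>from_nat\<close>, so the renaming of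
    states preserves the outcomes and not only acceptance.\<close>
  define e' :: "nat lab" where
    "e' s r d = e (from_nat s) r (from_nat (fst d), snd d)" for s r d
  let ?h = "\<lambda>d :: 'q move. (to_nat (fst d), snd d)"
  have inj: "inj_on ?h S" for S
    by (auto simp: inj_on_def)
  have del: "delta M (to_nat q) r = ?h ` \<delta> q r" if "q \<in> Q" "r \<in> symtuples K A" for q r
  proof -
    have "delta M (to_nat q) r = {(dst \<iota>, writes \<iota>, moves \<iota>) | \<iota>.
        \<iota> \<in> encode_instr ` X \<and> src \<iota> = to_nat q \<and> reads \<iota> = r}"
      by (simp add: delta_def M_def P)
    also have "\<dots> = ?h ` \<delta> q r"
      using that by (force simp: X_def encode_instr_def image_iff)
    finally show ?thesis .
  qed
  have sim: "tree \<delta> a e c n V \<Longrightarrow> fst c \<in> Q \<Longrightarrow> tapes_ok K A (snd c) \<Longrightarrow>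
    tree (delta M) (to_nat a) e' (to_nat (fst c), snd c) n V" for c n V
  proof (induction rule: tree.induct)
    case (halt q ts n)
    have "delta M (to_nat q) (map tape_read ts) = {}"
      using halt del tapes_ok_reads by force
    then show ?case by (auto intro!: tree_halt)
  next
    case (step q ts n W V)
    let ?r = "map tape_read ts"
    have r: "q \<in> Q" "?r \<in> symtuples K A" using step.prems tapes_ok_reads by auto
    let ?W = "\<lambda>d :: nat move. W (from_nat (fst d), snd d)"
    have "tree (delta M) (to_nat a) e' (to_nat q, ts) (Suc n) V"
    proof (rule tree.step[where W = ?W])
      show "\<forall>d\<in>delta M (to_nat q) ?r.
         tree (delta M) (to_nat a) e' (fst d, upd ts (fst (snd d)) (snd (snd d))) n (?W d)"
      proof
        fix d assume "d \<in> delta M (to_nat q) ?r"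
        then obtain q' w m where d: "(q', w, m) \<in> \<delta> q ?r" "d = (to_nat q', w, m)"
          using del[OF r] by auto
        show "tree (delta M) (to_nat a) e' (fst d, upd ts (fst (snd d)) (snd (snd d))) n (?W d)"
          using step.IH[rule_format, OF d(1)] closed[OF r d(1)] tapes_ok_upd[of K A ts w m] step.prems
          by (auto simp: d(2))
      qed
      show "V = (\<Sum>d\<in>delta M (to_nat q) ?r. pref (e' (to_nat q) ?r d) (?W d))"
        unfolding del[OF r] step.hyps(3) by (subst sum.reindex[OF inj]) (simp add: e'_def)
    qed (use del[OF r] step.hyps in auto)
    then show ?case by simp
  qed
  have wf: "wf_ntm M" unfolding wf_ntm_def
  proof (intro conjI ballI)
    fix \<iota> assume "\<iota> \<in> set (program M)"
    then obtain q r q' w m where "q \<in> Q" "r \<in> symtuples K A" "(q', w, m) \<in> \<delta> q r"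
      "\<iota> = encode_instr (q, r, (q', w, m))"
      by (auto simp: M_def P X_def)
    then show "length (reads \<iota>) = num_tapes M" "length (writes \<iota>) = num_tapes M"
      "length (moves \<iota>) = num_tapes M"
      using closed[of q r q' w m] by (auto simp: encode_instr_def M_def symtuples_def)
  qed (use K P in \<open>auto simp: M_def\<close>)
  from B obtain p :: "nat poly" where p: "\<And>n. B n \<le> poly p n" by (auto simp: pbounded_def)
  have "tree (delta M) (accept_state M) e' (init_config M x) (poly p (length x)) (V x)" for x
  proof -
    have ok: "tapes_ok K A (input_tape x # replicate (K - 1) blank_tape)"
      using K A by (auto simp: tapes_ok_def input_tape_def blank_tape_def bit_sym_def blank_def)
    have "tree (delta M) (to_nat a) e' (to_nat q0, input_tape x # replicate (K - 1) blank_tape)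
        (B (length x)) (V x)"
      using sim[OF V[of x]] Q(2) ok by simp
    from tree_mono[OF this p] show ?thesis by (simp add: M_def init_config_def)
  qed
  then have "mach e' M V" using wf by (auto simp: mach_def)
  moreover have "deterministic M" if det: "\<forall>q\<in>Q. \<forall>r d d'. d \<in> \<delta> q r \<longrightarrow> d' \<in> \<delta> q r \<longrightarrow> d = d'"
    unfolding deterministic_def
  proof (intro ballI impI)
    fix \<iota> \<kappa> assume "\<iota> \<in> set (program M)" "\<kappa> \<in> set (program M)"
    then obtain q r d q' r' d' where "q \<in> Q" "d \<in> \<delta> q r" "d' \<in> \<delta> q' r'"
      "\<iota> = encode_instr (q, r, d)" "\<kappa> = encode_instr (q', r', d')"
      by (auto simp: M_def P X_def)
    moreover assume "src \<iota> = src \<kappa> \<and> reads \<iota> = reads \<kappa>"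
    ultimately show "\<iota> = \<kappa>" using det[rule_format, of q d r d']
      by (cases d; cases d') (auto simp: encode_instr_def)
  qed
  ultimately show ?thesis by blast
qed

subsection \<open>Tapes\<close>

text \<open>A tape being written from left to right: the head is on the first cell behind
  \<open>u\<close>, so writing appends.\<close>

definition out_tape :: "str \<Rightarrow> tape" where
  "out_tape u = (fst (input_tape u), int (length u))"

lemma upd_Nil [simp]: "upd [] [] [] = []"
  by (simp add: upd_def)

lemma upd_Cons [simp]: "upd (t # ts) (w # ws) (m # ms) = tape_update t w m # upd ts ws ms"
  by (simp add: upd_def)

lemma upd_append [simp]:
  "length ts1 = length w1 \<Longrightarrow> length w1 = length m1 \<Longrightarrow>
    upd (ts1 @ ts2) (w1 @ w2) (m1 @ m2) = upd ts1 w1 m1 @ upd ts2 w2 m2"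
  by (simp add: upd_def)

lemma length_upd [simp]:
  "length w = length ts \<Longrightarrow> length m = length ts \<Longrightarrow> length (upd ts w m) = length ts"
  by (simp add: upd_def)

lemma tape_update_read: "tape_update t (tape_read t) d = (fst t, snd t + shift d)"
  by (simp add: tape_update_def tape_read_def)

lemma tape_update_Stay [simp]: "tape_update t (tape_read t) Stay = t"
  by (simp add: tape_update_read)

lemma upd_Stay [simp]: "n = length ts \<Longrightarrow> upd ts (map tape_read ts) (replicate n Stay) = ts"
  by (induction ts arbitrary: n) auto

lemma bit_sym_eq_iff [simp]: "bit_sym b = bit_sym b' \<longleftrightarrow> b = b'"
  by (auto simp: bit_sym_def)

lemma bit_sym_2 [simp]: "bit_sym b = 2 \<longleftrightarrow> b"
  by (simp add: bit_sym_def)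

lemma bit_sym_blank [simp]: "bit_sym b \<noteq> blank" "blank \<noteq> bit_sym b"
  by (simp_all add: bit_sym_def blank_def)

lemma bit_sym_less [simp]: "bit_sym b < 3"
  by (simp add: bit_sym_def)

lemma out_tape_Nil: "out_tape [] = blank_tape"
  by (auto simp: out_tape_def input_tape_def blank_tape_def)

lemma tape_read_out [simp]: "tape_read (out_tape u) = blank"
  by (simp add: tape_read_def out_tape_def input_tape_def)

lemma out_tape_write [simp]: "tape_update (out_tape u) (bit_sym b) MoveRight = out_tape (u @ [b])"
  by (auto simp: tape_update_def out_tape_def input_tape_def nth_append fun_eq_iff)

lemma out_tape_left:
  "tape_update (out_tape u) blank MoveLeft = (fst (input_tape u), int (length u) - 1)"
  using tape_update_read[of "out_tape u" MoveLeft] by simp (simp add: out_tape_def)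

lemma tape_output_input [simp]: "tape_output (input_tape x) x"
  by (simp add: tape_output_def input_tape_def)

lemma tape_output_Nil: "tape_output t [] \<Longrightarrow> tape_read t = blank"
  by (simp add: tape_output_def tape_read_def)

lemma tape_output_Cons_read: "tape_output t (b # y) \<Longrightarrow> tape_read t = bit_sym b"
  by (force simp: tape_output_def tape_read_def)

lemma tape_output_Cons_move:
  assumes "tape_output t (b # y)"
  shows "tape_output (tape_update t (bit_sym b) MoveRight) y"
proof -
  have "tape_update t (bit_sym b) MoveRight = (fst t, snd t + 1)"
    using tape_update_read[of t MoveRight] tape_output_Cons_read[OF assms] by simp
  moreover have "fst t (snd t + 1 + int j) = bit_sym (y ! j)" if "j < length y" for j
    using assms that unfolding tape_output_def
    by (metis (no_types, lifting) Suc_less_eq add.assoc length_Cons nth_Cons_Suc of_nat_Suc)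
  ultimately show ?thesis
    using assms by (simp add: tape_output_def add.assoc)
qed

subsection \<open>Finite-state transductions\<close>

text \<open>State \<open>0\<close> is final: it stops reading, even before the end of the input.\<close>

fun tr :: "(nat \<Rightarrow> bool option \<Rightarrow> nat \<times> 'o list) \<Rightarrow> nat \<Rightarrow> str \<Rightarrow> 'o list" where
  "tr T q [] = (if q = 0 then [] else snd (T q None))"
| "tr T q (b # w) = (if q = 0 then [] else snd (T q (Some b)) @ tr T (fst (T q (Some b))) w)"

text \<open>The input still unread when state \<open>0\<close> is reached; guided pipelines
  interpret it as an encoded path.\<close>

fun rst :: "(nat \<Rightarrow> bool option \<Rightarrow> nat \<times> 'o list) \<Rightarrow> nat \<Rightarrow> str \<Rightarrow> str" where
  "rst T q [] = []"
| "rst T q (b # w) = (if q = 0 then b # w else rst T (fst (T q (Some b))) w)"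

lemma tr_0 [simp]: "tr T 0 w = []"
  by (cases w) auto

lemma rst_0 [simp]: "rst T 0 w = w"
  by (cases w) auto

lemma length_tr: "(\<And>q a. length (snd (T q a)) \<le> L) \<Longrightarrow> length (tr T q w) \<le> L * (length w + 1)"
  by (induction w arbitrary: q) (auto intro: add_mono)

definition fst_bounded :: "(nat \<Rightarrow> bool option \<Rightarrow> nat \<times> 'o list) \<Rightarrow> nat \<Rightarrow> nat \<Rightarrow> bool" where
  "fst_bounded T B L \<longleftrightarrow> (\<forall>q a. length (snd (T q a)) \<le> L) \<and> (\<forall>q<B. \<forall>a. fst (T q a) < B)"

text \<open>The tag of an output bit is its destination: \<open>True\<close> for the first tape of
  \<open>F\<close>, \<open>False\<close> for the first tape of \<open>M\<close>.\<close>

definition sel :: "bool \<Rightarrow> (bool \<times> bool) list \<Rightarrow> str" where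
  "sel c E = map snd (filter (\<lambda>e. fst e = c) E)"

lemma sel_Nil [simp]: "sel c [] = []"
  by (simp add: sel_def)

lemma sel_Cons [simp]: "sel c ((d, b) # E) = (if d = c then b # sel c E else sel c E)"
  by (simp add: sel_def)

lemma sel_append [simp]: "sel c (E @ E') = sel c E @ sel c E'"
  by (simp add: sel_def)

text \<open>Modes: \<open>0\<close> writes as told, \<open>1\<close> guesses a bit or switches to \<open>2\<close>, which writes nothing.\<close>

fun guess :: "(str \<Rightarrow> str \<Rightarrow> outcomes) \<Rightarrow> nat \<Rightarrow> (bool \<times> bool) list \<Rightarrow> str \<Rightarrow> str \<Rightarrow> outcomes" where
  "guess W m [] u v = W u v"
| "guess W m ((False, b) # E) u v = guess W m E u (v @ [b])"
| "guess W m ((True, b) # E) u v =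
    (if m = 0 then guess W 0 E (u @ [b]) v
     else if m = 1 then pref [True] (guess W 1 E (u @ [True]) v) +
       pref [False] (guess W 1 E (u @ [False]) v) + guess W 2 E u v
     else guess W m E u v)"

lemma guess_0: "guess W 0 E u v = W (u @ sel True E) (v @ sel False E)"
proof (induction E arbitrary: u v)
  case (Cons a E)
  then show ?case by (cases a; cases "fst a") auto
qed simp

lemma guess_2: "guess W 2 E u v = W u (v @ sel False E)"
proof (induction E arbitrary: u v)
  case (Cons a E)
  then show ?case by (cases a; cases "fst a") auto
qed simp

lemma lists_le_Suc:
  "{u :: str. length u \<le> Suc k} =
    insert [] ((#) True ` {u. length u \<le> k} \<union> (#) False ` {u. length u \<le> k})"
  (is "?L = ?R")
proof -
  have "u \<in> ?L \<longleftrightarrow> u \<in> ?R" for u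
    by (cases u) auto
  then show ?thesis by blast
qed

lemma finite_lists_le [simp]: "finite {u :: str. length u \<le> k}"
  using finite_lists_length_le[of "UNIV :: bool set" k] by simp

text \<open>A guessed string is fixed by its bits and the moment of the switch to mode
  \<open>2\<close>, so each string within the length bound is guessed along exactly one branch.
  Hence guessing by itself never duplicates an outcome.\<close>

lemma guess_1:
  "guess W 1 E u v = (\<Sum>u' | length u' \<le> length (sel True E). pref u' (W (u @ u') (v @ sel False E)))"
proof (induction E arbitrary: u v)
  case Nil
  then show ?case by simp
next
  case (Cons a E)
  show ?case
  proof (cases "fst a")
    case False
    then show ?thesis using Cons by (cases a) simp
  next
    case True
    let ?S = "{u :: str. length u \<le> length (sel True E)}"
    let ?g = "\<lambda>u'. pref u' (W (u @ u') (v @ sel False E))"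
    have inj: "inj_on ((#) b) ?S" for b by (simp add: inj_on_def)
    have b: "pref [b] (guess W 1 E (u @ [b]) v) = sum ?g ((#) b ` ?S)" for b
      unfolding Cons pref_sum by (subst sum.reindex[OF inj]) simp
    \<comment> \<open>The empty string comes from switching at once, the others from guessing their
      first bit; the three index sets are disjoint.\<close>
    have "sum ?g {u'. length u' \<le> length (sel True (a # E))} =
        ?g [] + (sum ?g ((#) True ` ?S) + sum ?g ((#) False ` ?S))"
      using True by (cases a) (simp add: lists_le_Suc, subst sum.insert, auto intro!: sum.union_disjoint)
    also have "\<dots> = guess W 1 (a # E) u v"
      using True by (cases a) (simp add: guess_2 b[symmetric] add_ac)
    finally show ?thesis using True by (cases a) simp
  qed
qed

subsection \<open>Guided runs\<close>

definition follows :: "ntm \<Rightarrow> config \<Rightarrow> str \<Rightarrow> bool" where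
  "follows F c w \<longleftrightarrow>
    (\<exists>\<pi> c'. w = encode_path \<pi> \<and> run F c \<pi> c' \<and> halted F c' \<and> fst c' = accept_state F)"

lemma encode_path_Nil [simp]: "encode_path [] = []"
  by (simp add: encode_path_def)

lemma encode_path_Cons [simp]: "encode_path (i # \<pi>) = replicate i True @ False # encode_path \<pi>"
  by (simp add: encode_path_def)

lemma replicate_eq_encode: "replicate i True = encode_path \<pi> \<longleftrightarrow> i = 0 \<and> \<pi> = []"
proof (cases \<pi>)
  case (Cons j \<rho>)
  have "False \<in> set (encode_path \<pi>)" by (simp add: Cons)
  then show ?thesis by (metis Cons in_set_replicate list.distinct(1))
qed simp

lemma replicate_False_eq:
  "replicate i True @ False # w = replicate j True @ False # w' \<longleftrightarrow> i = j \<and> w = w'"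
proof (induction i arbitrary: j)
  case 0
  then show ?case by (cases j) auto
next
  case (Suc i)
  then show ?case by (cases j) auto
qed

lemma replicate_False_eq_encode:
  "replicate i True @ False # w = encode_path \<pi> \<longleftrightarrow> (\<exists>\<rho>. \<pi> = i # \<rho> \<and> w = encode_path \<rho>)"
  by (cases \<pi>) (auto simp: replicate_False_eq)

lemma follows_step:
  assumes "i < length (program F)"
  shows "follows F c (replicate i True @ False # w) \<longleftrightarrow>
    applicable (program F ! i) c \<and> follows F (apply_instr (program F ! i) c) w"
proof
  assume "follows F c (replicate i True @ False # w)"
  then show "applicable (program F ! i) c \<and> follows F (apply_instr (program F ! i) c) w"
    unfolding follows_def replicate_False_eq_encode by fastforce
next
  assume r: "applicable (program F ! i) c \<and> follows F (apply_instr (program F ! i) c) w"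
  then obtain \<pi> c' where "w = encode_path \<pi>" "run F (apply_instr (program F ! i) c) \<pi> c'"
    "halted F c'" "fst c' = accept_state F"
    by (auto simp: follows_def)
  then show "follows F c (replicate i True @ False # w)"
    unfolding follows_def using r assms by (intro exI[of _ "i # \<pi>"] exI[of _ c']) auto
qed

text \<open>The first \<open>False\<close> of an encoded nonempty path of \<open>F\<close> comes
  after fewer than \<open>length (program F)\<close> symbols \<open>True\<close>. A verifier may
  therefore reject after that many, which keeps its counter finite.\<close>

lemma follows_no_instr:
  assumes "length (program F) \<le> i" "replicate i True @ w \<noteq> []"
  shows "\<not> follows F c (replicate i True @ w)"
proof
  assume "follows F c (replicate i True @ w)"
  then obtain \<pi> c' where \<pi>: "replicate i True @ w = encode_path \<pi>" "run F c \<pi> c'"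
    by (auto simp: follows_def)
  from \<pi>(1) assms(2) obtain j \<rho> where Cons: "\<pi> = j # \<rho>" by (cases \<pi>) auto
  then have "j < i" using \<pi>(2) assms by auto
  have "replicate i True @ w = replicate j True @ False # encode_path \<rho>" using \<pi>(1) Cons by simp
  then have "(replicate i True @ w) ! j = (replicate j True @ False # encode_path \<rho>) ! j" by simp
  then show False using \<open>j < i\<close> by (simp add: nth_append)
qed

subsection \<open>Pipelines\<close>

datatype state = T1 nat nat "(bool \<times> bool) list" | R1 | RF nat | RG nat nat
  | T2 nat "bool list" | R2 | RM nat | Acc

instance state :: countable
  by countable_datatype

text \<open>
  The tapes of a pipeline are its input tape, the tapes of \<open>F\<close> and the tapes of \<open>M\<close>. The transducer
  \<open>t1\<close> reads the input and writes to the first tapes of \<open>F\<close> and \<open>M\<close>; after a rewind, \<open>F\<close> runs. The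
  transducer \<open>t2\<close> appends the output of \<open>F\<close> to the first tape of \<open>M\<close>; after another rewind, \<open>M\<close> runs.
  If \<open>F\<close> rejects, the pipeline halts and accepts iff \<open>flag\<close> is set. With \<open>g0 = 1\<close>, the bits written by
  \<open>t1\<close> for \<open>F\<close> are replaced by guessed ones. If \<open>guided\<close> is set, the rest of the input, left unread by \<open>t1\<close>,
  is taken as an encoded path which \<open>F\<close> has to follow, and the pipeline accepts iff this path is
  accepting.
\<close>

locale pipe =
  fixes t1 :: "nat \<Rightarrow> bool option \<Rightarrow> nat \<times> (bool \<times> bool) list"
    and t2 :: "nat \<Rightarrow> bool option \<Rightarrow> nat \<times> bool list"
    and F M :: ntm and lF lM :: nat
    and guided flag :: bool and g0 q2 :: nat
    and eM :: "nat lab"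
  assumes wfF: "wf_ntm F" and wfM: "wf_ntm M"
    and lF: "num_tapes F = Suc lF" and lM: "num_tapes M = Suc lM"
begin

definition stayF where "stayF = replicate (Suc lF) Stay"
definition stayM where "stayM = replicate (Suc lM) Stay"

text \<open>The reads are split into \<open>a\<close> for the input tape, \<open>rf\<close> for the
  tapes of \<open>F\<close> and \<open>rm\<close> for those of \<open>M\<close>; writing them back
  leaves the content as it is. The list in \<open>T1\<close> and \<open>T2\<close> is a queue of
  output symbols, processed one per step, and \<open>i\<close> in \<open>RG s i\<close> counts the
  symbols \<open>True\<close> read since the last instruction.\<close>

fun stp :: "state \<Rightarrow> nat \<Rightarrow> nat list \<Rightarrow> nat list \<Rightarrow> state move set" where
  "stp (T1 m q []) a rf rm =
     (if q = 0 then {(R1, a # rf @ rm, Stay # (MoveLeft # replicate lF Stay) @ stayM)}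
      else if a = blank then {(T1 m 0 (snd (t1 q None)), a # rf @ rm, Stay # stayF @ stayM)}
      else {(T1 m (fst (t1 q (Some (a = 2)))) (snd (t1 q (Some (a = 2)))), a # rf @ rm,
              MoveRight # stayF @ stayM)})"
| "stp (T1 m q ((False, b) # p)) a rf rm =
     {(T1 m q p, a # rf @ (bit_sym b # tl rm), Stay # stayF @ (MoveRight # replicate lM Stay))}"
| "stp (T1 m q ((True, b) # p)) a rf rm =
     (if m = 0 then
       {(T1 m q p, a # (bit_sym b # tl rf) @ rm, Stay # (MoveRight # replicate lF Stay) @ stayM)}
      else if m = 1 then
       {(T1 m q p, a # (bit_sym True # tl rf) @ rm, Stay # (MoveRight # replicate lF Stay) @ stayM),
        (T1 m q p, a # (bit_sym False # tl rf) @ rm, Stay # (MoveRight # replicate lF Stay) @ stayM),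
        (T1 2 q p, a # rf @ rm, Stay # stayF @ stayM)}
      else {(T1 m q p, a # rf @ rm, Stay # stayF @ stayM)})"
| "stp R1 a rf rm =
     (if hd rf = blank then
       {(if guided then RG (start_state F) 0 else RF (start_state F),
         a # rf @ rm, Stay # (MoveRight # replicate lF Stay) @ stayM)}
      else {(R1, a # rf @ rm, Stay # (MoveLeft # replicate lF Stay) @ stayM)})"
| "stp (RF s) a rf rm =
     (\<lambda>(d, w, m). (RF d, a # w @ rm, Stay # m @ stayM)) ` delta F s rf \<union>
     (if delta F s rf = {} then
        if s = accept_state F then {(T2 q2 [], a # rf @ rm, Stay # stayF @ stayM)}
        else if flag then {(Acc, a # rf @ rm, Stay # stayF @ stayM)} else {}
      else {})"
| "stp (RG s i) a rf rm =
     (if i < length (program F) then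
        if a = bit_sym True then
          (if Suc i < length (program F)
           then {(RG s (Suc i), a # rf @ rm, MoveRight # stayF @ stayM)} else {})
        else if a = bit_sym False then
          (if src (program F ! i) = s \<and> reads (program F ! i) = rf
           then {(RG (dst (program F ! i)) 0, a # writes (program F ! i) @ rm,
              MoveRight # moves (program F ! i) @ stayM)} else {})
        else {}
      else {}) \<union>
     (if a = blank \<and> i = 0 \<and> s = accept_state F \<and> delta F s rf = {}
      then {(Acc, a # rf @ rm, Stay # stayF @ stayM)} else {})"
| "stp (T2 q []) a rf rm =
     (if q = 0 then {(R2, a # rf @ rm, Stay # stayF @ (MoveLeft # replicate lM Stay))}
      else if last rf = blank then {(T2 0 (snd (t2 q None)), a # rf @ rm, Stay # stayF @ stayM)}
      else {(T2 (fst (t2 q (Some (last rf = 2)))) (snd (t2 q (Some (last rf = 2)))), a # rf @ rm,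
              Stay # (replicate lF Stay @ [MoveRight]) @ stayM)})"
| "stp (T2 q (b # p)) a rf rm =
     {(T2 q p, a # rf @ (bit_sym b # tl rm), Stay # stayF @ (MoveRight # replicate lM Stay))}"
| "stp R2 a rf rm =
     (if hd rm = blank then
       {(RM (start_state M), a # rf @ rm, Stay # stayF @ (MoveRight # replicate lM Stay))}
      else {(R2, a # rf @ rm, Stay # stayF @ (MoveLeft # replicate lM Stay))})"
| "stp (RM s) a rf rm =
     (\<lambda>(d, w, m). (RM d, a # rf @ w, Stay # stayF @ m)) ` delta M s rm \<union>
     (if delta M s rm = {} \<and> s = accept_state M then {(Acc, a # rf @ rm, Stay # stayF @ stayM)} else {})"
| "stp Acc a rf rm = {}"

definition \<delta> :: "state trans" where
  "\<delta> q r = stp q (hd r) (take (Suc lF) (tl r)) (drop (Suc lF) (tl r))"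

text \<open>A guessing step is recognised by mode \<open>1\<close> before and after it and a pending
  symbol for \<open>F\<close>; this excludes the switch to mode \<open>2\<close>. Entry
  \<open>w ! 1\<close> is the symbol written on the first tape of \<open>F\<close>, and
  \<open>2\<close> codes the bit \<open>True\<close>. Steps of \<open>M\<close> keep their labels,
  all others are silent.\<close>

fun lab :: "state lab" where
  "lab (T1 m q p) r (T1 m' q' p', w, mv) =
     (if m = 1 \<and> m' = 1 \<and> p \<noteq> [] \<and> fst (hd p) then [w ! 1 = 2] else [])"
| "lab (RM s) r (RM s', w, mv) =
     eM s (drop (Suc lF) (tl r)) (s', drop (Suc lF) (tl w), drop (Suc lF) (tl mv))"
| "lab _ _ _ = []"

abbreviation "Tr \<equiv> tree \<delta> Acc lab"

lemma length_stay [simp]: "length stayF = Suc lF" "length stayM = Suc lM"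
  by (simp_all add: stayF_def stayM_def)

lemma upd_stayF [simp]: "length ts = Suc lF \<Longrightarrow> upd ts (map tape_read ts) stayF = ts"
  by (simp add: stayF_def del: replicate.simps)

lemma upd_stayM [simp]: "length ts = Suc lM \<Longrightarrow> upd ts (map tape_read ts) stayM = ts"
  by (simp add: stayM_def del: replicate.simps)

lemma upd_stay_out [simp]:
  "length Fr = lF \<Longrightarrow> upd (out_tape u # Fr) (blank # map tape_read Fr) stayF = out_tape u # Fr"
  "length Mr = lM \<Longrightarrow> upd (out_tape u # Mr) (blank # map tape_read Mr) stayM = out_tape u # Mr"
  using upd_stayF[of "out_tape u # Fr"] upd_stayM[of "out_tape u # Mr"]
  by (simp_all del: upd_stayF upd_stayM)

lemma \<delta>_stp:
  "length Fts = Suc lF \<Longrightarrow> \<delta> q (map tape_read (a # Fts @ Mts)) =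
    stp q (tape_read a) (map tape_read Fts) (map tape_read Mts)"
  by (simp add: \<delta>_def)

lemma stp_det:
  assumes "stp q (tape_read a) (map tape_read Fts) (map tape_read Mts) = {(q', wa # wF @ wM, da # dF @ dM)}"
    and "Tr (q', tape_update a wa da # upd Fts wF dF @ upd Mts wM dM) n V"
    and "length Fts = Suc lF" "length wF = Suc lF" "length dF = Suc lF" "n < n'"
    and "lab q (map tape_read (a # Fts @ Mts)) (q', wa # wF @ wM, da # dF @ dM) = []"
  shows "Tr (q, a # Fts @ Mts) n' V"
proof (rule tree_det[OF _ _ _ assms(6)])
  show "\<delta> q (map tape_read (a # Fts @ Mts)) = {(q', wa # wF @ wM, da # dF @ dM)}"
    using assms by (simp only: \<delta>_stp)
qed (use assms in auto)

lemma stp_stay: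
  assumes "stp q (tape_read a) (map tape_read Fts) (map tape_read Mts) =
      {(q', tape_read a # map tape_read Fts @ map tape_read Mts, Stay # stayF @ stayM)}"
    and "Tr (q', a # Fts @ Mts) n V"
    and "length Fts = Suc lF" "length Mts = Suc lM" "n < n'"
    and "lab q (map tape_read (a # Fts @ Mts))
      (q', tape_read a # map tape_read Fts @ map tape_read Mts, Stay # stayF @ stayM) = []"
  shows "Tr (q, a # Fts @ Mts) n' V"
  by (rule stp_det[OF assms(1) _ _ _ _ assms(5,6)]) (use assms in auto)

lemma stp_F0:
  assumes "stp q (tape_read a) (map tape_read (f # Fr)) (map tape_read Mts) =
      {(q', tape_read a # (w # map tape_read Fr) @ map tape_read Mts,
        Stay # (d # replicate lF Stay) @ stayM)}"
    and "Tr (q', a # (tape_update f w d # Fr) @ Mts) n V"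
    and "length Fr = lF" "length Mts = Suc lM" "n < n'"
    and "lab q (map tape_read (a # (f # Fr) @ Mts))
      (q', tape_read a # (w # map tape_read Fr) @ map tape_read Mts,
        Stay # (d # replicate lF Stay) @ stayM) = []"
  shows "Tr (q, a # (f # Fr) @ Mts) n' V"
proof -
  have "Tr (q', tape_update a (tape_read a) Stay #
      upd (f # Fr) (w # map tape_read Fr) (d # replicate lF Stay) @ upd Mts (map tape_read Mts) stayM) n V"
    using assms by simp
  from stp_det[OF assms(1) this _ _ _ assms(5,6)] show ?thesis using assms by simp
qed

lemma stp_M0:
  assumes "stp q (tape_read a) (map tape_read Fts) (map tape_read (g # Mr)) =
      {(q', tape_read a # map tape_read Fts @ (w # map tape_read Mr),
        Stay # stayF @ (d # replicate lM Stay))}"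
    and "Tr (q', a # Fts @ (tape_update g w d # Mr)) n V"
    and "length Fts = Suc lF" "length Mr = lM" "n < n'"
    and "lab q (map tape_read (a # Fts @ (g # Mr)))
      (q', tape_read a # map tape_read Fts @ (w # map tape_read Mr),
        Stay # stayF @ (d # replicate lM Stay)) = []"
  shows "Tr (q, a # Fts @ (g # Mr)) n' V"
proof -
  have "Tr (q', tape_update a (tape_read a) Stay #
      upd Fts (map tape_read Fts) stayF @ upd (g # Mr) (w # map tape_read Mr) (d # replicate lM Stay)) n V"
    using assms by simp
  from stp_det[OF assms(1) this _ _ _ assms(5,6)] show ?thesis using assms by simp
qed

lemma stp_halt:
  assumes "stp q (tape_read a) (map tape_read Fts) (map tape_read Mts) = {}"
    and "length Fts = Suc lF" "V = (if q = Acc then {#([], last (a # Fts @ Mts))#} else {#})"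
  shows "Tr (q, a # Fts @ Mts) n V"
  by (rule tree_halt) (use assms \<delta>_stp[of Fts q a Mts] in auto)

lemma Tr_Acc: "length Fts = Suc lF \<Longrightarrow> Mts \<noteq> [] \<Longrightarrow> Tr (Acc, a # Fts @ Mts) n {#([], last Mts)#}"
  by (rule stp_halt) auto

lemma delta_lengths:
  "(d, w, m) \<in> delta F s rf \<Longrightarrow> length w = Suc lF \<and> length m = Suc lF"
  "(d, w, m) \<in> delta M s rm \<Longrightarrow> length w = Suc lM \<and> length m = Suc lM"
  using wfF wfM lF lM by (auto simp: delta_def wf_ntm_def)

text \<open>The extra step leads from the accepting state of \<open>M\<close> to \<open>Acc\<close>.
  If \<open>M\<close> halts in another state, the pipeline halts as well, outside of
  \<open>Acc\<close>.\<close>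

lemma Tr_M:
  assumes "tree (delta M) (accept_state M) eM c n V" "length (snd c) = Suc lM" "length Fts = Suc lF"
  shows "Tr (RM (fst c), a # Fts @ snd c) (Suc n) V"
  using assms(1,2)
proof (induction rule: tree.induct)
  case (halt s ts n)
  show ?case
  proof (cases "s = accept_state M")
    case True
    have "Tr (RM s, a # Fts @ ts) (Suc n) {#([], last ts)#}"
      by (rule stp_stay[where q' = Acc and n = n, OF _ Tr_Acc])
        (use True assms(3) halt in auto)
    then show ?thesis using True by simp
  next
    case False
    then show ?thesis using halt assms(3) by (auto intro!: stp_halt)
  qed
next
  case (step s ts n W V)
  let ?r = "map tape_read ts"
  let ?h = "\<lambda>(d, w, m). (RM d, tape_read a # map tape_read Fts @ w, Stay # stayF @ m)"
  \<comment> \<open>Recovers the move of \<open>M\<close> from the move of the pipeline, since the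
    rule \<open>step\<close> wants the outcomes as a function of the latter.\<close>
  let ?W = "\<lambda>(q', w, m). W (case q' of RM d \<Rightarrow> (d, drop (Suc lF) (tl w), drop (Suc lF) (tl m)))"
  have del: "\<delta> (RM s) (map tape_read (a # Fts @ ts)) = ?h ` delta M s ?r"
    using step.hyps(2) assms(3) by (subst \<delta>_stp) auto
  have inj: "inj_on ?h (delta M s ?r)" by (auto simp: inj_on_def)
  have "Tr (RM s, a # Fts @ ts) (Suc (Suc n)) V"
  proof (rule tree.step[where W = ?W])
    show "\<forall>d\<in>\<delta> (RM s) (map tape_read (a # Fts @ ts)).
       Tr (fst d, upd (a # Fts @ ts) (fst (snd d)) (snd (snd d))) (Suc n) (?W d)"
      unfolding del
    proof
      fix d' assume "d' \<in> ?h ` delta M s ?r"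
      then obtain d w m where d: "(d, w, m) \<in> delta M s ?r" "d' = ?h (d, w, m)" by auto
      show "Tr (fst d', upd (a # Fts @ ts) (fst (snd d')) (snd (snd d'))) (Suc n) (?W d')"
        using step.IH[rule_format, OF d(1)] delta_lengths(2)[OF d(1)] step.prems assms(3)
        by (simp add: d(2))
    qed
    show "V = (\<Sum>d\<in>\<delta> (RM s) (map tape_read (a # Fts @ ts)).
        pref (lab (RM s) (map tape_read (a # Fts @ ts)) d) (?W d))"
      unfolding del sum.reindex[OF inj] step.hyps(3)
      using assms(3) by (intro sum.cong) auto
  qed (use del step.hyps in auto)
  then show ?case by simp
qed

text \<open>The simulation of a deterministic \<open>F\<close> is a chain of silent steps, so the
  outcomes at the end of its run are those at its start.\<close>

lemma Tr_F:
  assumes "deterministic F" "length Fts = Suc lF"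
  shows "run F (s, Fts) \<pi> (s', Fts') \<Longrightarrow> length Fts' = Suc lF \<Longrightarrow> Tr (RF s', a # Fts' @ Mts) n V \<Longrightarrow>
    length Mts = Suc lM \<Longrightarrow> Tr (RF s, a # Fts @ Mts) (n + length \<pi>) V"
  using assms(2)
proof (induction \<pi> arbitrary: s Fts)
  case (Cons i \<pi>)
  let ?\<iota> = "program F ! i"
  have i: "i < length (program F)" "applicable ?\<iota> (s, Fts)"
    "run F (dst ?\<iota>, upd Fts (writes ?\<iota>) (moves ?\<iota>)) \<pi> (s', Fts')"
    using Cons.prems(1) by (auto simp: apply_instr_upd)
  have "\<And>\<kappa>. \<kappa> \<in> set (program F) \<Longrightarrow> src \<kappa> = s \<Longrightarrow> reads \<kappa> = map tape_read Fts \<Longrightarrow> \<kappa> = ?\<iota>"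
    using i(1,2) assms(1) unfolding deterministic_def applicable_def by auto
  then have d: "delta F s (map tape_read Fts) = {(dst ?\<iota>, writes ?\<iota>, moves ?\<iota>)}"
    using i(1,2) by (auto simp: delta_def applicable_def)
  have l: "length (writes ?\<iota>) = Suc lF" "length (moves ?\<iota>) = Suc lF"
    using delta_lengths(1) d by blast+
  have "Tr (RF (dst ?\<iota>), a # upd Fts (writes ?\<iota>) (moves ?\<iota>) @ Mts) (n + length \<pi>) V"
    by (rule Cons.IH) (use Cons.prems i l in auto)
  then have t: "Tr (RF (dst ?\<iota>), tape_update a (tape_read a) Stay #
      upd Fts (writes ?\<iota>) (moves ?\<iota>) @ upd Mts (map tape_read Mts) stayM) (n + length \<pi>) V"
    using Cons.prems by simp
  show ?case
    by (rule stp_det[OF _ t]) (use Cons.prems l d in auto)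
qed simp

lemma Tr_F_accept:
  assumes "halted F (accept_state F, Fts)" "length Fts = Suc lF" "length Mts = Suc lM"
    "Tr (T2 q2 [], a # Fts @ Mts) n V"
  shows "Tr (RF (accept_state F), a # Fts @ Mts) (Suc n) V"
  by (rule stp_stay[where q' = "T2 q2 []", OF _ assms(4)]) (use assms in \<open>auto simp: halted_delta\<close>)

lemma Tr_F_reject:
  assumes "halted F (s, Fts)" "s \<noteq> accept_state F" "length Fts = Suc lF" "length Mts = Suc lM"
  shows "Tr (RF s, a # Fts @ Mts) (Suc n) (if flag then {#([], last Mts)#} else {#})"
proof -
  have e: "stp (RF s) (tape_read a) (map tape_read Fts) (map tape_read Mts) =
    (if flag then {(Acc, tape_read a # map tape_read Fts @ map tape_read Mts, Stay # stayF @ stayM)}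
     else {})"
    using assms by (simp add: halted_delta)
  show ?thesis
  proof (cases flag)
    case True
    have "Tr (RF s, a # Fts @ Mts) (Suc n) {#([], last Mts)#}"
      by (rule stp_stay[OF trans[OF e if_P[OF True]] Tr_Acc[of Fts Mts a n]]) (use assms in auto)
    then show ?thesis using True by simp
  next
    case False
    have "Tr (RF s, a # Fts @ Mts) (Suc n) {#}"
      by (rule stp_halt[OF trans[OF e if_not_P[OF False]]]) (use assms in auto)
    then show ?thesis using False by simp
  qed
qed

text \<open>Along a prescribed path even a nondeterministic \<open>F\<close> is simulated without
  branching. The induction runs over the rest of the path, with the \<open>i\<close> symbols already
  counted put in front again; the alternative \<open>i = 0\<close> covers an empty program.\<close>

lemma Tr_guided:
  assumes Mts: "length Mts = Suc lM"
  shows "tape_output a w \<Longrightarrow> length Fts = Suc lF \<Longrightarrow> i < length (program F) \<or> i = 0 \<Longrightarrow>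
    Tr (RG s i, a # Fts @ Mts) (Suc (length w))
      (if follows F (s, Fts) (replicate i True @ w) then {#([], last Mts)#} else {#})"
proof (induction w arbitrary: a i s Fts)
  case Nil
  have r: "tape_read a = blank" by (rule tape_output_Nil) (rule Nil)
  have f: "follows F (s, Fts) (replicate i True @ []) \<longleftrightarrow>
    i = 0 \<and> s = accept_state F \<and> delta F s (map tape_read Fts) = {}"
    by (auto simp: follows_def replicate_eq_encode halted_delta)
  show ?case
  proof (cases "i = 0 \<and> s = accept_state F \<and> delta F s (map tape_read Fts) = {}")
    case True
    then have "Tr (RG s i, a # Fts @ Mts) (Suc (length [])) {#([], last Mts)#}"
      using Nil Mts r
      by (intro stp_stay[OF _ Tr_Acc[of Fts Mts a 0]]) auto
    moreover have "follows F (s, Fts) (replicate i True @ [])" using True f by blast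
    ultimately show ?thesis by simp
  next
    case False
    then have "stp (RG s i) (tape_read a) (map tape_read Fts) (map tape_read Mts) = {}"
      using r by auto
    then have "Tr (RG s i, a # Fts @ Mts) (Suc (length [])) {#}"
      using Nil by (intro stp_halt) auto
    moreover have "\<not> follows F (s, Fts) (replicate i True @ [])" using False f by blast
    ultimately show ?thesis by simp
  qed
next
  case (Cons b w)
  have r: "tape_read a = bit_sym b" by (rule tape_output_Cons_read) (rule Cons.prems(1))
  let ?a = "tape_update a (bit_sym b) MoveRight"
  have a': "tape_output ?a w" by (rule tape_output_Cons_move) (rule Cons.prems(1))
  have rej: "Tr (RG s i, a # Fts @ Mts) (Suc (length (b # w)))
      (if follows F (s, Fts) (replicate i True @ b # w) then {#([], last Mts)#} else {#})"
    if "stp (RG s i) (tape_read a) (map tape_read Fts) (map tape_read Mts) = {}"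
      "\<not> follows F (s, Fts) (replicate i True @ b # w)"
    using that Cons.prems by (auto intro!: stp_halt)
  have rep: "replicate i True @ True # w = replicate (Suc i) True @ w"
    by (simp add: replicate_app_Cons_same)
  consider (no) "\<not> i < length (program F)" | (T) "i < length (program F)" "b" "Suc i < length (program F)"
    | (T') "i < length (program F)" "b" "\<not> Suc i < length (program F)"
    | (F) "i < length (program F)" "\<not> b" "applicable (program F ! i) (s, Fts)"
    | (F') "i < length (program F)" "\<not> b" "\<not> applicable (program F ! i) (s, Fts)"
    by blast
  then show ?case
  proof cases
    case no
    then show ?thesis using r by (intro rej follows_no_instr) auto
  next
    case T
    have t: "Tr (RG s (Suc i), ?a # upd Fts (map tape_read Fts) stayF @ upd Mts (map tape_read Mts) stayM)
      (Suc (length w)) (if follows F (s, Fts) (replicate (Suc i) True @ w) then {#([], last Mts)#} else {#})"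
      using Cons.IH[OF a' Cons.prems(2), of "Suc i" s] T(3) Cons.prems(2) Mts
      by (simp del: replicate.simps)
    have e: "replicate i True @ b # w = replicate (Suc i) True @ w" using rep T(2) by simp
    show ?thesis unfolding e
      by (rule stp_det[OF _ t]) (use T r Cons.prems(2) in auto)
  next
    case T'
    have e: "replicate i True @ b # w = replicate (Suc i) True @ w" using rep T'(2) by simp
    have "\<not> follows F (s, Fts) (replicate i True @ b # w)"
      unfolding e using T'(3) by (intro follows_no_instr) auto
    then show ?thesis using T' r by (intro rej) auto
  next
    case F
    let ?\<iota> = "program F ! i"
    have \<iota>: "src ?\<iota> = s" "reads ?\<iota> = map tape_read Fts" using F(3) by (auto simp: applicable_def)
    have l: "length (writes ?\<iota>) = Suc lF" "length (moves ?\<iota>) = Suc lF"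
      using wfF lF F(1) by (auto simp: wf_ntm_def)
    have t: "Tr (RG (dst ?\<iota>) 0, ?a # upd Fts (writes ?\<iota>) (moves ?\<iota>) @ upd Mts (map tape_read Mts) stayM)
      (Suc (length w)) (if follows F (dst ?\<iota>, upd Fts (writes ?\<iota>) (moves ?\<iota>)) w then {#([], last Mts)#} else {#})"
      using Cons.IH[OF a', of "upd Fts (writes ?\<iota>) (moves ?\<iota>)" 0 "dst ?\<iota>"] l Cons.prems(2) Mts
      by simp
    have "Tr (RG s i, a # Fts @ Mts) (Suc (length (b # w)))
      (if follows F (dst ?\<iota>, upd Fts (writes ?\<iota>) (moves ?\<iota>)) w then {#([], last Mts)#} else {#})"
      by (rule stp_det[OF _ t]) (use F(1,2) \<iota> l r Cons.prems(2) in auto)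
    then show ?thesis using F(2,3) follows_step[OF F(1), of "(s, Fts)" w] by (simp add: apply_instr_upd)
  next
    case F'
    then have "\<not> follows F (s, Fts) (replicate i True @ b # w)"
      using follows_step[OF F'(1), of "(s, Fts)" w] by simp
    then show ?thesis using F' r by (intro rej) (auto simp: applicable_def)
  qed
qed

lemma rewind_read:
  assumes "0 \<le> j" "j < int (length u)"
  shows "tape_read (fst (input_tape u), j) \<noteq> blank"
  using assms by (simp add: tape_read_def input_tape_def)

lemma rewind_read_left: "tape_read (fst (input_tape u), -1) = blank"
  by (simp add: tape_read_def input_tape_def)

lemma rewind_start: "tape_update (fst (input_tape u), -1) blank MoveRight = input_tape u"
  using tape_update_read[of "(fst (input_tape u), -1)" MoveRight]
  by (simp add: rewind_read_left) (simp add: input_tape_def)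

text \<open>\<open>k\<close> cells of content remain to be crossed. For \<open>k = 0\<close> the
  head is on the blank to the left of the content, one step before the initial position.\<close>

lemma rewind_F:
  assumes l: "length Fr = lF" "length Mts = Suc lM" and k: "k \<le> length u"
    and t: "Tr (if guided then RG (start_state F) 0 else RF (start_state F), a # (input_tape u # Fr) @ Mts) n V"
  shows "Tr (R1, a # ((fst (input_tape u), int k - 1) # Fr) @ Mts) (Suc (n + k)) V"
  using k
proof (induction k)
  case 0
  show ?case
    by (rule stp_F0[OF _ _ l, where w = blank and d = MoveRight and n = n and
        q' = "if guided then RG (start_state F) 0 else RF (start_state F)"])
      (use t in \<open>simp_all add: rewind_read_left rewind_start\<close>)
next
  case (Suc k)
  let ?f = "(fst (input_tape u), int k)"
  show ?case
    by (rule stp_F0[OF _ _ l, where w = "tape_read ?f" and d = MoveLeft and q' = R1 and n = "Suc (n + k)"])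
      (use Suc rewind_read[of k u] in \<open>simp_all add: tape_update_read\<close>)
qed

lemma rewind_M:
  assumes l: "length Fts = Suc lF" "length Mr = lM" and k: "k \<le> length u"
    and t: "Tr (RM (start_state M), a # Fts @ (input_tape u # Mr)) n V"
  shows "Tr (R2, a # Fts @ ((fst (input_tape u), int k - 1) # Mr)) (Suc (n + k)) V"
  using k
proof (induction k)
  case 0
  show ?case
    by (rule stp_M0[OF _ _ l, where w = blank and d = MoveRight and n = n and q' = "RM (start_state M)"])
      (use t in \<open>simp_all add: rewind_read_left rewind_start\<close>)
next
  case (Suc k)
  let ?f = "(fst (input_tape u), int k)"
  show ?case
    by (rule stp_M0[OF _ _ l, where w = "tape_read ?f" and d = MoveLeft and q' = R2 and n = "Suc (n + k)"])
      (use Suc rewind_read[of k u] in \<open>simp_all add: tape_update_read\<close>)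
qed

text \<open>The inner induction, over the queue; \<open>nil\<close> is the case of an empty queue,
  provided by the outer induction over the input. Only a symbol for \<open>F\<close> in mode
  \<open>1\<close> causes branching.\<close>

lemma Tr_T1_pending:
  fixes n N W a q w Fr Mr
  defines "P \<equiv> \<lambda>m p u v. Tr (T1 m q p, a # (out_tape u # Fr) @ (out_tape v # Mr))
      (n + 2 * length (p @ tr t1 q w) + length w + (if q = 0 then 1 else 2))
      (guess W m (p @ tr t1 q w) u v)"
  assumes l: "length Fr = lF" "length Mr = lM"
    and nil: "\<And>u v m. length u + length (tr t1 q w) \<le> N \<Longrightarrow> length v + length (tr t1 q w) \<le> N \<Longrightarrow> P m [] u v"
  shows "length u + length (p @ tr t1 q w) \<le> N \<Longrightarrow> length v + length (p @ tr t1 q w) \<le> N \<Longrightarrow> P m p u v"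
proof (induction p arbitrary: m u v)
  case Nil
  then show ?case using nil by simp
next
  case (Cons e p)
  have F: ?case if "e = (False, b)" for b
  proof -
    have t: "P m p u (v @ [b])" using Cons.prems by (intro Cons.IH) auto
    then have "Tr (T1 m q p, a # (out_tape u # Fr) @ tape_update (out_tape v) (bit_sym b) MoveRight # Mr)
       (n + 2 * length (p @ tr t1 q w) + length w + (if q = 0 then 1 else 2))
       (guess W m (p @ tr t1 q w) u (v @ [b]))" by (simp add: P_def)
    from stp_M0[OF _ this] show ?thesis using l that by (simp add: P_def)
  qed
  have T: ?case if "e = (True, b)" "m \<noteq> 1" for b
  proof (cases "m = 0")
    case True
    have "P 0 p (u @ [b]) v" using Cons.prems by (intro Cons.IH) auto
    then have "Tr (T1 0 q p, a # (tape_update (out_tape u) (bit_sym b) MoveRight # Fr) @ (out_tape v # Mr))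
       (n + 2 * length (p @ tr t1 q w) + length w + (if q = 0 then 1 else 2))
       (guess W 0 (p @ tr t1 q w) (u @ [b]) v)" by (simp add: P_def)
    from stp_F0[OF _ this] show ?thesis using l that True by (simp add: P_def)
  next
    case False
    have "P m p u v" using Cons.prems by (intro Cons.IH) auto
    from stp_stay[OF _ this[unfolded P_def]] show ?thesis using l that False by (simp add: P_def)
  qed
  have G: ?case if "e = (True, b)" "m = 1" for b
  proof -
    let ?n = "n + 2 * length (p @ tr t1 q w) + length w + (if q = 0 then 1 else 2)"
    let ?ra = "tape_read a" and ?rf = "map tape_read Fr" and ?rm = "map tape_read (out_tape v # Mr)"
    let ?d = "\<lambda>b. (T1 1 q p, ?ra # (bit_sym b # ?rf) @ ?rm, Stay # (MoveRight # replicate lF Stay) @ stayM)"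
    let ?d2 = "(T1 2 q p, ?ra # (blank # ?rf) @ ?rm, Stay # stayF @ stayM)"
    let ?g = "\<lambda>b. guess W 1 (p @ tr t1 q w) (u @ [b]) v"
    \<comment> \<open>The switch is told apart by its target state, the two guesses by the symbol
      written on the first tape of \<open>F\<close>.\<close>
    let ?W = "\<lambda>d. if fst d = T1 2 q p then guess W 2 (p @ tr t1 q w) u v
      else ?g (fst (snd d) ! 1 = 2)"
    let ?ts = "a # (out_tape u # Fr) @ (out_tape v # Mr)"
    have d: "\<delta> (T1 1 q (e # p)) (map tape_read ?ts) = {?d True, ?d False, ?d2}"
      using that l \<delta>_stp[of "out_tape u # Fr" "T1 1 q (e # p)" a "out_tape v # Mr"] by simp
    have ne: "?d True \<noteq> ?d False" "?d True \<noteq> ?d2" "?d False \<noteq> ?d2" by auto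
    have "Tr (T1 1 q (e # p), ?ts) (Suc ?n) (guess W 1 ((e # p) @ tr t1 q w) u v)"
    proof (rule tree.step[where W = ?W])
      have "P 1 p (u @ [b']) v" for b'
        using Cons.prems by (intro Cons.IH) auto
      moreover have "upd ?ts (?ra # (bit_sym b' # ?rf) @ ?rm) (Stay # (MoveRight # replicate lF Stay) @ stayM) =
          a # (out_tape (u @ [b']) # Fr) @ (out_tape v # Mr)" for b'
        using l by simp
      ultimately have b: "Tr (T1 1 q p, upd ?ts (?ra # (bit_sym b' # ?rf) @ ?rm)
          (Stay # (MoveRight # replicate lF Stay) @ stayM)) ?n (?g b')" for b' by (simp add: P_def)
      have "P 2 p u v" using Cons.prems by (intro Cons.IH) auto
      moreover have "upd ?ts (?ra # (blank # ?rf) @ ?rm) (Stay # stayF @ stayM) = ?ts"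
        using l upd_append[of "out_tape u # Fr" "blank # ?rf" stayF "out_tape v # Mr"
          "blank # map tape_read Mr" stayM] by simp
      ultimately have "Tr (T1 2 q p, upd ?ts (?ra # (blank # ?rf) @ ?rm) (Stay # stayF @ stayM)) ?n
         (guess W 2 (p @ tr t1 q w) u v)" by (simp add: P_def)
      then show "\<forall>d\<in>\<delta> (T1 1 q (e # p)) (map tape_read ?ts).
          Tr (fst d, upd ?ts (fst (snd d)) (snd (snd d))) ?n (?W d)"
        unfolding d using b[of True] b[of False] by simp
      show "guess W 1 ((e # p) @ tr t1 q w) u v = (\<Sum>d\<in>\<delta> (T1 1 q (e # p)) (map tape_read ?ts).
          pref (lab (T1 1 q (e # p)) (map tape_read ?ts) d) (?W d))"
        unfolding d using ne that by (simp add: add_ac)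
    qed (unfold d, auto)
    from tree_mono[OF this, of "Suc (Suc ?n)"] show ?thesis using that by (simp add: P_def)
  qed
  show ?case using F T G by (cases e; cases "fst e"; cases "m = 1") auto
qed

text \<open>The continuation is assumed for all \<open>u\<close> and \<open>v\<close> up to length
  \<open>N\<close>, since guessing branches end with different strings for \<open>F\<close> and need
  one common bound.\<close>

lemma Tr_T1:
  assumes l: "length Fr = lF" "length Mr = lM"
  shows "(\<And>a' u v. tape_output a' (rst t1 q w) \<Longrightarrow> length u \<le> N \<Longrightarrow> length v \<le> N \<Longrightarrow>
      Tr (R1, a' # ((fst (input_tape u), int (length u) - 1) # Fr) @ (out_tape v # Mr)) n (W u v)) \<Longrightarrow>
    tape_output a w \<Longrightarrow> length u + length (p @ tr t1 q w) \<le> N \<Longrightarrow>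
    length v + length (p @ tr t1 q w) \<le> N \<Longrightarrow>
    Tr (T1 m q p, a # (out_tape u # Fr) @ (out_tape v # Mr))
      (n + 2 * length (p @ tr t1 q w) + length w + (if q = 0 then 1 else 2))
      (guess W m (p @ tr t1 q w) u v)"
proof (induction w arbitrary: q p a u v m)
  case Nil
  let ?P = "\<lambda>a m q p w u v. Tr (T1 m q p, a # (out_tape u # Fr) @ (out_tape v # Mr))
      (n + 2 * length (p @ tr t1 q w) + length w + (if q = 0 then 1 else 2))
      (guess W m (p @ tr t1 q w) u v)"
  show ?case
  proof (rule Tr_T1_pending[OF l])
    fix u v :: str and m :: nat
    assume N: "length u + length (tr t1 q []) \<le> N" "length v + length (tr t1 q []) \<le> N"
    have zero: "Tr (T1 m 0 [], a # (out_tape u # Fr) @ (out_tape v # Mr)) (Suc n) (W u v)"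
      if "length u \<le> N" "length v \<le> N" for u v m
    proof -
      have "tape_output a (rst t1 q [])" using Nil by simp
      then have "Tr (R1, a # (tape_update (out_tape u) blank MoveLeft # Fr) @ (out_tape v # Mr)) n (W u v)"
        using Nil(1)[of a u v] that by (simp add: out_tape_left)
      from stp_F0[OF _ this] show ?thesis using l by simp
    qed
    show "?P a m q [] [] u v"
    proof (cases "q = 0")
      case True
      then show ?thesis using zero[of u v m] N by simp
    next
      case False
      let ?o = "snd (t1 q None)"
      have "?P a m 0 ?o [] u v"
        by (rule Tr_T1_pending[OF l]) (use zero N False in auto)
      moreover have "tape_read a = blank" using Nil(2) by (rule tape_output_Nil)
      ultimately show ?thesis
        using stp_stay[of "T1 m q []" a "out_tape u # Fr" "out_tape v # Mr" "T1 m 0 ?o"] False l by simp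
    qed
  qed (use Nil in auto)
next
  case (Cons b w)
  let ?P = "\<lambda>a m q p w u v. Tr (T1 m q p, a # (out_tape u # Fr) @ (out_tape v # Mr))
      (n + 2 * length (p @ tr t1 q w) + length w + (if q = 0 then 1 else 2))
      (guess W m (p @ tr t1 q w) u v)"
  show ?case
  proof (rule Tr_T1_pending[OF l])
    fix u v :: str and m :: nat
    assume N: "length u + length (tr t1 q (b # w)) \<le> N" "length v + length (tr t1 q (b # w)) \<le> N"
    show "?P a m q [] (b # w) u v"
    proof (cases "q = 0")
      case True
      have "Tr (R1, a # (tape_update (out_tape u) blank MoveLeft # Fr) @ (out_tape v # Mr)) n (W u v)"
        using Cons.prems(1)[of a u v] Cons.prems(2) N True
        by (simp add: out_tape_left)
      from stp_F0[OF _ this] show ?thesis using l True by simp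
    next
      case False
      let ?q = "fst (t1 q (Some b))" and ?o = "snd (t1 q (Some b))"
      let ?a = "tape_update a (bit_sym b) MoveRight"
      have r: "tape_read a = bit_sym b" using Cons.prems(2) by (rule tape_output_Cons_read)
      have "?P ?a m ?q ?o w u v"
        by (rule Cons.IH) (use Cons.prems(1) N False tape_output_Cons_move[OF Cons.prems(2)] in auto)
      then have "Tr (T1 m ?q ?o, tape_update a (tape_read a) MoveRight #
          upd (out_tape u # Fr) (map tape_read (out_tape u # Fr)) stayF @
          upd (out_tape v # Mr) (map tape_read (out_tape v # Mr)) stayM)
          (n + 2 * length (?o @ tr t1 ?q w) + length w + (if ?q = 0 then 1 else 2))
          (guess W m (?o @ tr t1 ?q w) u v)"
        using l r by simp
      from stp_det[OF _ this] show ?thesis using l False r by simp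
    qed
  qed (use Cons.prems in auto)
qed

lemma Tr_T2_pending:
  fixes n V q y Fts Mr a
  defines "P \<equiv> \<lambda>p v. Tr (T2 q p, a # Fts @ (out_tape v # Mr))
      (n + length (p @ tr t2 q y) + length y + (if q = 0 then 1 else 2)) V"
  assumes l: "length Fts = Suc lF" "length Mr = lM"
    and nil: "\<And>v. X = v @ tr t2 q y \<Longrightarrow> P [] v"
  shows "X = v @ p @ tr t2 q y \<Longrightarrow> P p v"
proof (induction p arbitrary: v)
  case Nil
  then show ?case using nil by simp
next
  case (Cons b p)
  have "P p (v @ [b])" using Cons by simp
  then have "Tr (T2 q p, a # Fts @ (tape_update (out_tape v) (bit_sym b) MoveRight # Mr))
    (n + length (p @ tr t2 q y) + length y + (if q = 0 then 1 else 2)) V" by (simp add: P_def)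
  from stp_M0[OF _ this] show ?case using l by (simp add: P_def)
qed

lemma Tr_T2_done:
  assumes l: "length Fts = Suc lF" "length Mr = lM"
    and R: "Tr (R2, a # Fts @ ((fst (input_tape X), int (length X) - 1) # Mr)) n V"
  shows "Tr (T2 0 [], a # Fts @ (out_tape X # Mr)) (Suc n) V"
proof -
  have "Tr (R2, a # Fts @ (tape_update (out_tape X) blank MoveLeft # Mr)) n V"
    using R by (simp add: out_tape_left)
  from stp_M0[OF _ this] show ?thesis using l by simp
qed

text \<open>\<open>X\<close> is the final content of the first tape of \<open>M\<close>: what is
  written, what is queued and what is still to be produced. Reading moves the head of the last tape
  of \<open>F\<close>, hence \<open>R\<close> for every \<open>t'\<close>. With \<open>q = 0\<close>
  that tape is not read and may hold anything.\<close>

lemma Tr_T2: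
  assumes l: "length Fr = lF" "length Mr = lM"
    and R: "\<And>t'. Tr (R2, a # (Fr @ [t']) @ ((fst (input_tape X), int (length X) - 1) # Mr)) n V"
  shows "X = v @ p @ tr t2 q y \<Longrightarrow> q = 0 \<or> tape_output t y \<Longrightarrow>
    Tr (T2 q p, a # (Fr @ [t]) @ (out_tape v # Mr))
      (n + length (p @ tr t2 q y) + length y + (if q = 0 then 1 else 2)) V"
proof (induction y arbitrary: q p v t)
  case Nil
  have l': "length (Fr @ [t]) = Suc lF" "length Mr = lM" for t using l by auto
  let ?P = "\<lambda>t q p y v. Tr (T2 q p, a # (Fr @ [t]) @ (out_tape v # Mr))
      (n + length (p @ tr t2 q y) + length y + (if q = 0 then 1 else 2)) V"
  show ?case
  proof (rule Tr_T2_pending[OF l'])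
    fix v assume X: "X = v @ tr t2 q []"
    show "?P t q [] [] v"
    proof (cases "q = 0")
      case True
      then show ?thesis using Tr_T2_done[OF l' R] X by simp
    next
      case False
      let ?o = "snd (t2 q None)"
      have "?P t 0 ?o [] v" by (rule Tr_T2_pending[OF l']) (use Tr_T2_done[OF l' R] X False in auto)
      moreover have "tape_read t = blank" using Nil False by (auto intro: tape_output_Nil)
      ultimately show ?thesis
        using stp_stay[of "T2 q []" a "Fr @ [t]" "out_tape v # Mr" "T2 0 ?o"] False l by simp
    qed
  qed (use Nil in auto)
next
  case (Cons b y)
  have l': "length (Fr @ [t]) = Suc lF" "length Mr = lM" for t using l by auto
  let ?P = "\<lambda>t q p y v. Tr (T2 q p, a # (Fr @ [t]) @ (out_tape v # Mr))
      (n + length (p @ tr t2 q y) + length y + (if q = 0 then 1 else 2)) V"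
  show ?case
  proof (rule Tr_T2_pending[OF l'])
    fix v assume X: "X = v @ tr t2 q (b # y)"
    show "?P t q [] (b # y) v"
    proof (cases "q = 0")
      case True
      then show ?thesis using tree_mono[OF Tr_T2_done[OF l' R]] X by simp
    next
      case False
      let ?q = "fst (t2 q (Some b))" and ?o = "snd (t2 q (Some b))"
      let ?t = "tape_update t (bit_sym b) MoveRight"
      have o: "tape_output t (b # y)" using Cons.prems False by simp
      have r: "tape_read t = bit_sym b" using o by (rule tape_output_Cons_read)
      have "?P ?t ?q ?o y v"
        by (rule Cons.IH) (use X False tape_output_Cons_move[OF o] in auto)
      then have "Tr (T2 ?q ?o, tape_update a (tape_read a) Stay #
          upd (Fr @ [t]) (map tape_read (Fr @ [t])) (replicate lF Stay @ [MoveRight]) @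
          upd (out_tape v # Mr) (map tape_read (out_tape v # Mr)) stayM)
          (n + length (?o @ tr t2 ?q y) + length y + (if ?q = 0 then 1 else 2)) V"
        using l r by simp
      from stp_det[OF _ this] show ?thesis using l False r by simp
    qed
  qed (use Cons.prems in auto)
qed

end

section \<open>Length of the output in terms of the running time\<close>

lemma run_length_tapes:
  "wf_ntm M \<Longrightarrow> run M c \<pi> c' \<Longrightarrow> length (snd c) = num_tapes M \<Longrightarrow> length (snd c') = num_tapes M"
  by (induction \<pi> arbitrary: c) (auto simp: apply_instr_def wf_ntm_def)

definition tape_within :: "nat \<Rightarrow> nat \<Rightarrow> tape \<Rightarrow> bool" where
  "tape_within l k t \<longleftrightarrow> \<bar>snd t\<bar> \<le> int k \<and> (\<forall>i. fst t i \<noteq> blank \<longrightarrow> i < int (l + k))"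

lemma tape_within_update:
  assumes "tape_within l k t"
  shows "tape_within l (Suc k) (tape_update t s d)"
proof -
  have "\<bar>snd t + shift d\<bar> \<le> int (Suc k)"
    using assms by (cases d) (auto simp: tape_within_def)
  moreover have "i < int (l + Suc k)" if "((fst t)(snd t := s)) i \<noteq> blank" for i
  proof (cases "i = snd t")
    case True
    then show ?thesis using assms by (auto simp: tape_within_def)
  next
    case False
    then have "i < int (l + k)" using assms that by (auto simp: tape_within_def)
    then show ?thesis by simp
  qed
  ultimately show ?thesis by (simp add: tape_within_def tape_update_def)
qed

lemma run_tapes_within:
  "run M c \<pi> c' \<Longrightarrow> \<forall>t \<in> set (snd c). tape_within l k t \<Longrightarrow>
    \<forall>t \<in> set (snd c'). tape_within l (k + length \<pi>) t"
proof (induction \<pi> arbitrary: c k)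
  case (Cons i \<pi>)
  have "\<forall>t \<in> set (snd (apply_instr (program M ! i) c)). tape_within l (Suc k) t"
    using Cons.prems(2) by (auto simp: apply_instr_def dest!: set_zip_leftD intro!: tape_within_update)
  from Cons.IH[OF _ this] Cons.prems(1) show ?case by simp
qed simp

text \<open>The last cell of a nonempty output is nonblank, so after \<open>k\<close> steps it lies
  to the left of \<open>length x + k\<close>, while the head is not to the left of
  \<open>- k\<close>.\<close>

lemma output_length:
  assumes "run M (init_config M x) \<pi> c" "t \<in> set (snd c)" "tape_output t y"
  shows "length y \<le> length x + 2 * length \<pi>"
proof (cases y)
  case (Cons b y')
  have "\<forall>t \<in> set (snd (init_config M x)). tape_within (length x) 0 t"
    by (auto simp: init_config_def tape_within_def input_tape_def blank_tape_def split: if_splits)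
  from run_tapes_within[OF assms(1) this] assms(2) have w: "tape_within (length x) (length \<pi>) t" by simp
  have "fst t (snd t + int (length y - 1)) = bit_sym (y ! (length y - 1))"
    using assms(3) Cons unfolding tape_output_def by auto
  then have "fst t (snd t + int (length y - 1)) \<noteq> blank" by simp
  with w have "snd t + int (length y - 1) < int (length x + length \<pi>)" "- int (length \<pi>) \<le> snd t"
    unfolding tape_within_def by auto
  then show ?thesis using Cons by simp
qed simp

lemma length_init_config: "wf_ntm M \<Longrightarrow> length (snd (init_config M x)) = num_tapes M"
  by (auto simp: init_config_def wf_ntm_def)

section \<open>Finiteness and determinism of pipelines\<close>

context pipe
begin

text \<open>The states \<open>RF s\<close> are left out of a guided pipeline: there \<open>F\<close>
  may be nondeterministic, and its free simulation must not spoil the determinism of the compiled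
  machine.\<close>

definition states :: "nat \<Rightarrow> nat \<Rightarrow> nat \<Rightarrow> nat \<Rightarrow> state set" where
  "states B1 L1 B2 L2 =
     (\<lambda>(m, q, p). T1 m q p) ` ({g0, 2} \<times> {..<B1} \<times> {p. length p \<le> L1}) \<union>
     (\<lambda>(q, p). T2 q p) ` ({..<B2} \<times> {p. length p \<le> L2}) \<union>
     {R1, R2, Acc} \<union>
     RF ` {s \<in> insert (start_state F) (dst ` set (program F)). \<not> guided} \<union>
     (\<lambda>(s, i). RG s i) ` (insert (start_state F) (dst ` set (program F)) \<times> {..length (program F)}) \<union>
     RM ` (insert (start_state M) (dst ` set (program M)))"

lemma finite_states: "finite (states B1 L1 B2 L2)"
proof -
  have "finite {p :: (bool \<times> bool) list. length p \<le> L}" for L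
    using finite_lists_length_le[of "UNIV :: (bool \<times> bool) set" L] by simp
  then show ?thesis unfolding states_def by (auto intro!: finite_imageI finite_cartesian_product)
qed

lemma stp_closed:
  assumes t1: "fst_bounded t1 B1 L1" "1 < B1" and t2: "fst_bounded t2 B2 L2" "q2 < B2"
    and q: "q \<in> states B1 L1 B2 L2" and A: "3 \<le> A" "a < A"
    and AF: "\<And>\<iota>. \<iota> \<in> set (program F) \<Longrightarrow> set (writes \<iota>) \<subseteq> {..<A}"
    and AM: "\<And>\<iota>. \<iota> \<in> set (program M) \<Longrightarrow> set (writes \<iota>) \<subseteq> {..<A}"
    and rf: "length rf = Suc lF" "set rf \<subseteq> {..<A}" and rm: "length rm = Suc lM" "set rm \<subseteq> {..<A}"
    and d: "(q', w, m) \<in> stp q a rf rm"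
  shows "q' \<in> states B1 L1 B2 L2 \<and> length w = Suc (Suc lF + Suc lM) \<and> set w \<subseteq> {..<A} \<and>
    length m = Suc (Suc lF + Suc lM)"
proof -
  obtain f rf' where rf': "rf = f # rf'" "length rf' = lF" using rf by (cases rf) auto
  obtain g rm' where rm': "rm = g # rm'" "length rm' = lM" using rm by (cases rm) auto
  have b: "bit_sym b < A" for b using A(1) by (auto simp: bit_sym_def)
  have S: "f < A" "set rf' \<subseteq> {..<A}" "g < A" "set rm' \<subseteq> {..<A}" using rf rm rf' rm' by auto
  have bl: "blank < A" using A(1) by (simp add: blank_def)
  have s1: "length (snd (t1 q a)) \<le> L1" "q < B1 \<Longrightarrow> fst (t1 q a) < B1" for q a
    using t1 by (auto simp: fst_bounded_def)
  have s2: "length (snd (t2 q a)) \<le> L2" "q < B2 \<Longrightarrow> fst (t2 q a) < B2" for q a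
    using t2 by (auto simp: fst_bounded_def)
  have pF: "program F ! i \<in> set (program F)" if "i < length (program F)" for i
    using that by simp
  have lF': "length (writes \<iota>) = Suc lF" "length (moves \<iota>) = Suc lF" if "\<iota> \<in> set (program F)" for \<iota>
    using wfF lF that by (auto simp: wf_ntm_def)
  show ?thesis
  proof (cases q)
    case (T1 k q0 p)
    have k: "k = g0 \<or> k = 2" "q0 < B1" "length p \<le> L1" using q T1 by (auto simp: states_def)
    show ?thesis
    proof (cases p)
      case Nil
      then show ?thesis using d T1 k s1 t1(2) S A
        by (auto simp: states_def image_iff rf' rm' split: if_splits)
    next
      case (Cons e p')
      then show ?thesis using d T1 k S A b bl
        by (cases e; cases "fst e") (auto simp: states_def image_iff rf' rm' split: if_splits)
    qed
  next
    case R1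
    then show ?thesis using d S A by (auto simp: states_def image_iff rf' rm' split: if_splits)
  next
    case (RF s)
    have *: "d \<in> dst ` set (program F)" "set w \<subseteq> {..<A}" "length w = Suc lF" "length m = Suc lF"
      if "(d, w, m) \<in> delta F s rf" for d w m
      using that AF lF' by (auto simp: delta_def)
    have "(\<exists>d w' m'. (d, w', m') \<in> delta F s rf \<and> q' = RF d \<and> w = a # w' @ rm \<and> m = Stay # m' @ stayM) \<or>
      ((q' = T2 q2 [] \<or> q' = Acc) \<and> w = a # rf @ rm \<and> m = Stay # stayF @ stayM)"
      using d RF by (auto split: if_splits)
    then show ?thesis
    proof (elim disjE exE conjE)
      fix d w' m' assume "(d, w', m') \<in> delta F s rf" "q' = RF d" "w = a # w' @ rm" "m = Stay # m' @ stayM"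
      then show ?thesis using *[of d w' m'] rm A q RF by (auto simp: states_def split: if_splits)
    qed (use rf rm A t2(2) in \<open>auto simp: states_def\<close>)
  next
    case (RG s i)
    have i: "i \<le> length (program F)" using q RG by (auto simp: states_def)
    from d RG consider
      "Suc i < length (program F)" "q' = RG s (Suc i)" "w = a # rf @ rm" "m = MoveRight # stayF @ stayM"
      | "i < length (program F)" "q' = RG (dst (program F ! i)) 0" "w = a # writes (program F ! i) @ rm"
        "m = MoveRight # moves (program F ! i) @ stayM"
      | "q' = Acc" "w = a # rf @ rm" "m = Stay # stayF @ stayM"
      by (auto split: if_splits)
    then show ?thesis
    proof cases
      case 1
      then show ?thesis using q RG rf rm A by (auto simp: states_def)
    next
      case 2
      then show ?thesis using rm A AF[OF pF[OF 2(1)]] lF'[OF pF[OF 2(1)]] by (auto simp: states_def)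
    next
      case 3
      then show ?thesis using rf rm A by (auto simp: states_def)
    qed
  next
    case (T2 q0 p)
    have k: "q0 < B2" "length p \<le> L2" using q T2 by (auto simp: states_def)
    show ?thesis
    proof (cases p)
      case Nil
      then show ?thesis using d T2 k s2 t2(2) S A
        by (auto simp: states_def image_iff rf' rm' split: if_splits)
    next
      case (Cons e p')
      then show ?thesis using d T2 k S A b bl
        by (auto simp: states_def image_iff rf' rm' split: if_splits)
    qed
  next
    case R2
    then show ?thesis using d S A by (auto simp: states_def image_iff rf' rm' split: if_splits)
  next
    case (RM s)
    have *: "d \<in> dst ` set (program M)" "set w \<subseteq> {..<A}" "length w = Suc lM" "length m = Suc lM"
      if "(d, w, m) \<in> delta M s rm" for d w m
      using that AM wfM lM by (auto simp: delta_def wf_ntm_def)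
    have "(\<exists>d w' m'. (d, w', m') \<in> delta M s rm \<and> q' = RM d \<and> w = a # rf @ w' \<and> m = Stay # stayF @ m') \<or>
      (q' = Acc \<and> w = a # rf @ rm \<and> m = Stay # stayF @ stayM)"
      using d RM by (auto split: if_splits)
    then show ?thesis
    proof (elim disjE exE conjE)
      fix d w' m' assume "(d, w', m') \<in> delta M s rm" "q' = RM d" "w = a # rf @ w'" "m = Stay # stayF @ m'"
      then show ?thesis using *[of d w' m'] rf A by (auto simp: states_def)
    qed (use rf rm A in \<open>auto simp: states_def\<close>)
  next
    case Acc
    then show ?thesis using d by simp
  qed
qed

lemma finite_stp: "finite (stp q a rf rm)"
  by (induction q a rf rm rule: stp.induct) auto

lemma det_delta:
  assumes "deterministic N" "d \<in> delta N s r" "d' \<in> delta N s r"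
  shows "d = d'"
proof -
  from assms(2,3) obtain \<iota> \<kappa> where
    "\<iota> \<in> set (program N)" "src \<iota> = s" "reads \<iota> = r" "d = (dst \<iota>, writes \<iota>, moves \<iota>)"
    "\<kappa> \<in> set (program N)" "src \<kappa> = s" "reads \<kappa> = r" "d' = (dst \<kappa>, writes \<kappa>, moves \<kappa>)"
    unfolding delta_def by blast
  moreover have "\<iota> = \<kappa>" using calculation assms(1) unfolding deterministic_def by metis
  ultimately show ?thesis by simp
qed

text \<open>Branching has just three sources: guessing in mode \<open>1\<close>, the free simulation
  of \<open>F\<close>, and the simulation of \<open>M\<close>.\<close>

lemma stp_deterministic:
  assumes "deterministic F \<or> (\<forall>s. q \<noteq> RF s)" "deterministic M" "\<forall>q' p. q \<noteq> T1 1 q' p"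
    "d \<in> stp q a rf rm" "d' \<in> stp q a rf rm"
  shows "d = d'"
  using assms(1,3-5)
proof (induction q a rf rm rule: stp.induct)
  case (5 s a rf rm)
  then show ?case using det_delta[of F] by (auto split: if_splits)
next
  case (6 s i a rf rm)
  then show ?case by (auto split: if_splits)
next
  case (10 s a rf rm)
  then show ?case by (auto split: if_splits dest: det_delta[OF assms(2)])
qed (auto split: if_splits)

lemma symbol_bound:
  "\<exists>A\<ge>3. \<forall>\<iota> \<in> set (program F) \<union> set (program M). set (writes \<iota>) \<subseteq> {..<A}"
proof -
  define X where "X = insert 3 (\<Union>\<iota>\<in>set (program F) \<union> set (program M). set (writes \<iota>))"
  have lt: "s < Suc (Max X)" if "s \<in> X" for s
    using that unfolding less_Suc_eq_le by (intro Max_ge) (auto simp: X_def)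
  have "3 \<le> Suc (Max X)" using lt[of 3] by (simp only: X_def insertI1 less_imp_le)
  moreover have "\<forall>\<iota> \<in> set (program F) \<union> set (program M). set (writes \<iota>) \<subseteq> X"
    by (auto simp: X_def)
  ultimately show ?thesis by (intro exI[of _ "Suc (Max X)"]) (use lt in auto)
qed

lemma compile_pipe:
  assumes t1: "fst_bounded t1 B1 L1" "1 < B1" and t2: "fst_bounded t2 B2 L2" "q2 < B2"
    and F: "guided \<or> deterministic F" and B: "pbounded B"
    and V: "\<And>x. Tr (T1 g0 1 [], input_tape x # (out_tape [] # replicate lF blank_tape) @
      (out_tape [] # replicate lM blank_tape)) (B (length x)) (V x)"
  shows "\<exists>G e. mach e G V \<and> (g0 \<noteq> 1 \<and> deterministic M \<longrightarrow> deterministic G)"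
proof -
  obtain A where A: "3 \<le> A" "\<And>\<iota>. \<iota> \<in> set (program F) \<Longrightarrow> set (writes \<iota>) \<subseteq> {..<A}"
    "\<And>\<iota>. \<iota> \<in> set (program M) \<Longrightarrow> set (writes \<iota>) \<subseteq> {..<A}"
    using symbol_bound by (meson UnI1 UnI2)
  let ?K = "Suc (Suc lF + Suc lM)" and ?Q = "states B1 L1 B2 L2"
  have "\<exists>G e. mach e G V \<and>
     ((\<forall>q\<in>?Q. \<forall>r d d'. d \<in> \<delta> q r \<longrightarrow> d' \<in> \<delta> q r \<longrightarrow> d = d') \<longrightarrow> deterministic G)"
  proof (rule compile[OF finite_states _ _ A(1) _ _ B, where K = ?K])
    show "T1 g0 1 [] \<in> ?Q" using t1(2) by (auto simp: states_def image_iff)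
    show "finite (\<delta> q r)" for q r by (simp add: \<delta>_def finite_stp)
    show "q' \<in> ?Q \<and> w \<in> symtuples ?K A \<and> length m = ?K"
      if "q \<in> ?Q" "r \<in> symtuples ?K A" "(q', w, m) \<in> \<delta> q r" for q r q' w m
    proof -
      from that(2) obtain a r' where r: "r = a # r'" "a < A" "length r' = Suc lF + Suc lM"
        "set r' \<subseteq> {..<A}"
        by (cases r) (auto simp: symtuples_def)
      have s: "set (take (Suc lF) r') \<subseteq> {..<A}" "set (drop (Suc lF) r') \<subseteq> {..<A}"
        using r(4) by (auto dest: in_set_takeD in_set_dropD)
      have d: "(q', w, m) \<in> stp q a (take (Suc lF) r') (drop (Suc lF) r')"
        using that(3) by (simp add: \<delta>_def r(1))
      show ?thesis
        using stp_closed[OF t1 t2 that(1) A(1) r(2) A(2,3) _ s(1) _ s(2) d] r(3)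
        by (simp add: symtuples_def)
    qed
    have "input_tape x # replicate (?K - 1) blank_tape =
        input_tape x # (out_tape [] # replicate lF blank_tape) @ (out_tape [] # replicate lM blank_tape)" for x
      by (simp add: out_tape_Nil replicate_app_Cons_same flip: replicate_add replicate_Suc)
    then show "Tr (T1 g0 1 [], input_tape x # replicate (?K - 1) blank_tape) (B (length x)) (V x)" for x
      using V[of x] by simp
  qed simp
  moreover have "\<forall>q\<in>?Q. \<forall>r d d'. d \<in> \<delta> q r \<longrightarrow> d' \<in> \<delta> q r \<longrightarrow> d = d'" if "g0 \<noteq> 1" "deterministic M"
  proof (intro ballI allI impI)
    fix q r d d' assume q: "q \<in> ?Q" and d: "d \<in> \<delta> q r" "d' \<in> \<delta> q r"
    have "\<forall>q' p. q \<noteq> T1 1 q' p" using q that(1) by (auto simp: states_def)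
    moreover have "deterministic F \<or> (\<forall>s. q \<noteq> RF s)" using q F by (auto simp: states_def)
    ultimately show "d = d'" using stp_deterministic[OF _ that(2)] d by (simp add: \<delta>_def)
  qed
  ultimately show ?thesis by blast
qed

end

text \<open>For \<open>q2 = 0\<close> the output of \<open>F\<close> is never read, so any defined
  value of \<open>f\<close> is allowed. In this way a decider counts as a machine for a partial
  function.\<close>

definition runs_as :: "ntm \<Rightarrow> nat \<Rightarrow> (str \<rightharpoonup> str) \<Rightarrow> bool" where
  "runs_as F q2 f \<longleftrightarrow> (\<forall>u. \<exists>\<pi> c. run F (init_config F u) \<pi> c \<and> halted F c \<and>
     (case f u of None \<Rightarrow> fst c \<noteq> accept_state F
      | Some y \<Rightarrow> fst c = accept_state F \<and> (q2 = 0 \<or> tape_output (last (snd c)) y)))"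

lemma computes_runs_as: "computes F f \<Longrightarrow> runs_as F q2 f"
  unfolding runs_as_def computes_def by (metis (mono_tags, lifting) option.case_eq_if)

text \<open>\<open>u\<close> and \<open>v\<close> are what the first transducer has written for
  \<open>F\<close> and \<open>M\<close>. If \<open>F\<close> rejects, \<open>M\<close> is never
  started and its tapes are still as that transducer left them.\<close>

definition pipe_outcome ::
    "nat \<Rightarrow> bool \<Rightarrow> (nat \<Rightarrow> bool option \<Rightarrow> nat \<times> bool list) \<Rightarrow> nat \<Rightarrow> (str \<rightharpoonup> str) \<Rightarrow>
     (str \<Rightarrow> outcomes) \<Rightarrow> str \<Rightarrow> str \<Rightarrow> outcomes" where
  "pipe_outcome lM flag t2 q2 f VM u v = (case f u of
      None \<Rightarrow> if flag then {#([], last (out_tape v # replicate lM blank_tape))#} else {#}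
    | Some y \<Rightarrow> VM (v @ tr t2 q2 y))"

section \<open>Outcomes and running time of whole pipelines\<close>

context pipe
begin

lemma Tr_init:
  assumes "fst_bounded t1 B1 L1"
    and "\<And>a u v. tape_output a (rst t1 1 x) \<Longrightarrow> length u \<le> L1 * (length x + 1) \<Longrightarrow>
      length v \<le> L1 * (length x + 1) \<Longrightarrow>
      Tr (if guided then RG (start_state F) 0 else RF (start_state F),
        a # snd (init_config F u) @ (out_tape v # replicate lM blank_tape)) n (W u v)"
  shows "Tr (T1 g0 1 [], input_tape x # (out_tape [] # replicate lF blank_tape) @
      (out_tape [] # replicate lM blank_tape))
      (Suc (n + L1 * (length x + 1)) + 2 * (L1 * (length x + 1)) + length x + 2)
      (guess W g0 (tr t1 1 x) [] [])"
proof -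
  let ?N = "L1 * (length x + 1)"
  have E: "length (tr t1 1 x) \<le> ?N" using assms(1) by (intro length_tr) (auto simp: fst_bounded_def)
  have "Tr (T1 g0 1 [], input_tape x # (out_tape [] # replicate lF blank_tape) @
      (out_tape [] # replicate lM blank_tape))
      (Suc (n + ?N) + 2 * length ([] @ tr t1 1 x) + length x + (if (1::nat) = 0 then 1 else 2))
      (guess W g0 ([] @ tr t1 1 x) [] [])"
  proof (rule Tr_T1)
    fix a' and u v :: str assume h: "tape_output a' (rst t1 1 x)" "length u \<le> ?N" "length v \<le> ?N"
    have t: "Tr (if guided then RG (start_state F) 0 else RF (start_state F),
        a' # (input_tape u # replicate lF blank_tape) @ (out_tape v # replicate lM blank_tape)) n (W u v)"
      using assms(2)[OF h] lF by (simp add: init_config_def)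
    have "Tr (R1, a' # ((fst (input_tape u), int (length u) - 1) # replicate lF blank_tape) @
        (out_tape v # replicate lM blank_tape)) (Suc (n + length u)) (W u v)"
      by (rule rewind_F[OF _ _ _ t]) auto
    then show "Tr (R1, a' # ((fst (input_tape u), int (length u) - 1) # replicate lF blank_tape) @
        (out_tape v # replicate lM blank_tape)) (Suc (n + ?N)) (W u v)"
      by (rule tree_mono) (use h in simp)
  qed (use E in auto)
  then show ?thesis unfolding append_Nil
    by (rule tree_mono) (use E in auto)
qed

lemma Tr_run:
  assumes F: "deterministic F" and M: "tree (delta M) (accept_state M) eM (init_config M w) nM V"
    and run: "run F (init_config F u) \<pi> c" "halted F c" "fst c = accept_state F"
    and y: "q2 = 0 \<or> tape_output (last (snd c)) y" and w: "w = v @ tr t2 q2 y"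
    and b: "length \<pi> \<le> n1" "length (tr t2 q2 y) \<le> n2" "length y \<le> n3" "length w \<le> n4"
  shows "Tr (RF (start_state F), a # snd (init_config F u) @ (out_tape v # replicate lM blank_tape))
     (nM + n4 + n2 + n3 + n1 + 5) V"
proof -
  have len: "length (snd (init_config F u)) = Suc lF" "length (snd c) = Suc lF"
    using length_init_config[OF wfF] run_length_tapes[OF wfF run(1)] lF by auto
  obtain Fr t where Fr: "snd c = Fr @ [t]" "length Fr = lF"
    using len(2) by (cases "snd c" rule: rev_cases) auto
  have M': "Tr (RM (start_state M), a # (Fr @ [t']) @ (input_tape w # replicate lM blank_tape)) (Suc nM) V" for t'
    using Tr_M[OF M, of "Fr @ [t']" a] Fr lM by (simp add: init_config_def)
  have "Tr (R2, a # (Fr @ [t']) @ ((fst (input_tape w), int (length w) - 1) # replicate lM blank_tape))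
      (Suc (Suc nM + length w)) V" for t'
    by (rule rewind_M[OF _ _ _ M']) (use Fr in auto)
  then have "Tr (T2 q2 [], a # (Fr @ [t]) @ (out_tape v # replicate lM blank_tape))
      (Suc (Suc nM + length w) + length ([] @ tr t2 q2 y) + length y + (if q2 = 0 then 1 else 2)) V"
    by (rule Tr_T2[rotated 2]) (use Fr y w in auto)
  then have "Tr (T2 q2 [], a # snd c @ (out_tape v # replicate lM blank_tape)) (nM + n4 + n2 + n3 + 4) V"
    unfolding Fr(1) by (rule tree_mono) (use b in auto)
  then have "Tr (RF (accept_state F), a # snd c @ (out_tape v # replicate lM blank_tape))
      (Suc (nM + n4 + n2 + n3 + 4)) V"
    by (rule Tr_F_accept[rotated 3]) (use run len in \<open>auto simp flip: run(3)\<close>)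
  then have "Tr (RF (start_state F), a # snd (init_config F u) @ (out_tape v # replicate lM blank_tape))
      (Suc (nM + n4 + n2 + n3 + 4) + length \<pi>) V"
    by (rule Tr_F[OF F len(1), rotated 2])
      (use run len in \<open>auto simp flip: run(3) simp: init_config_def\<close>)
  then show ?thesis by (rule tree_mono) (use b in auto)
qed

lemma pipe_run:
  assumes g: "\<not> guided" and t1: "fst_bounded t1 B1 L1" "1 < B1" and t2: "fst_bounded t2 B2 L2" "q2 < B2"
    and F: "DPM F" "runs_as F q2 f" and M: "mach eM M VM"
  shows "\<exists>G e. mach e G (\<lambda>x. guess (pipe_outcome lM flag t2 q2 f VM) g0 (tr t1 1 x) [] []) \<and>
    (g0 \<noteq> 1 \<and> deterministic M \<longrightarrow> deterministic G)"
proof -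
  have det: "deterministic F" using F(1) by (simp add: DPM_def)
  from F(1) obtain pF :: "nat poly" where
    pF: "\<And>x \<pi> c. run F (init_config F x) \<pi> c \<Longrightarrow> length \<pi> \<le> poly pF (length x)"
    unfolding DPM_def NPM_def poly_time_def by blast
  from M obtain pM where
    pM: "\<And>x. tree (delta M) (accept_state M) eM (init_config M x) (poly pM (length x)) (VM x)"
    unfolding mach_def by blast
  \<comment> \<open>For inputs of length \<open>k\<close>: \<open>N\<close> bounds the strings
    written by \<open>t1\<close>, \<open>Y\<close> the output of \<open>F\<close>, \<open>T\<close>
    its transduction, \<open>R\<close> the steps from the start of \<open>F\<close> on, and
    \<open>B\<close> all steps.\<close>
  define N where "N k = L1 * (k + 1)" for k
  define Y where "Y k = N k + 2 * poly pF (N k)" for k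
  define T where "T k = L2 * (Y k + 1)" for k
  define R where "R k = poly pM (N k + T k) + (N k + T k) + T k + Y k + poly pF (N k) + 5" for k
  define B where "B k = Suc (R k + N k) + 2 * N k + k + 2" for k
  have N: "pbounded N" unfolding N_def by (intro pbounded_mult pbounded_const pbounded_add pbounded_id)
  have Y: "pbounded Y" unfolding Y_def
    by (intro pbounded_mult pbounded_const pbounded_add pbounded_comp N)
  have T: "pbounded T" unfolding T_def
    by (intro pbounded_mult pbounded_const pbounded_add Y)
  have R: "pbounded R" unfolding R_def
    by (intro pbounded_mult pbounded_const pbounded_add pbounded_comp N Y T)
  have B: "pbounded B" unfolding B_def
    by (intro pbounded_Suc pbounded_mult pbounded_const pbounded_add pbounded_id N R)
  show ?thesis
  proof (rule compile_pipe[OF t1 t2 disjI2[OF det] B])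
    fix x :: str
    let ?W = "pipe_outcome lM flag t2 q2 f VM"
    let ?n = "length x"
    show "Tr (T1 g0 1 [], input_tape x # (out_tape [] # replicate lF blank_tape) @
      (out_tape [] # replicate lM blank_tape)) (B ?n) (guess ?W g0 (tr t1 1 x) [] [])"
      unfolding B_def N_def
    proof (rule Tr_init[OF t1(1)])
      fix a and u v :: str assume h: "length u \<le> L1 * (?n + 1)" "length v \<le> L1 * (?n + 1)"
      then have uv: "length u \<le> N ?n" "length v \<le> N ?n" by (auto simp: N_def)
      from F(2) obtain \<pi> c where c: "run F (init_config F u) \<pi> c" "halted F c"
        "case f u of None \<Rightarrow> fst c \<noteq> accept_state F
         | Some y \<Rightarrow> fst c = accept_state F \<and> (q2 = 0 \<or> tape_output (last (snd c)) y)"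
        unfolding runs_as_def by blast
      have \<pi>: "length \<pi> \<le> poly pF (N ?n)"
        using pF[OF c(1)] poly_nat_mono[OF uv(1)] by (rule order_trans)
      have len: "length (snd (init_config F u)) = Suc lF" "length (snd c) = Suc lF"
        using length_init_config[OF wfF] run_length_tapes[OF wfF c(1)] lF by auto
      have "Tr (RF (start_state F), a # snd (init_config F u) @ (out_tape v # replicate lM blank_tape))
        (R ?n) (?W u v)"
      proof (cases "f u")
        case None
        let ?V = "if flag then {#([], last (out_tape v # replicate lM blank_tape))#} else {#}"
        have "Tr (RF (fst c), a # snd c @ (out_tape v # replicate lM blank_tape)) (Suc 0) ?V"
          by (rule Tr_F_reject) (use c None len in auto)
        then have "Tr (RF (start_state F), a # snd (init_config F u) @ (out_tape v # replicate lM blank_tape))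
          (Suc 0 + length \<pi>) ?V"
          by (rule Tr_F[OF det len(1), rotated 2]) (use c len in \<open>auto simp: init_config_def\<close>)
        moreover have "Suc 0 + length \<pi> \<le> R ?n" using \<pi> by (simp add: R_def)
        ultimately show ?thesis using None tree_mono by (fastforce simp: pipe_outcome_def)
      next
        case (Some y)
        \<comment> \<open>If the output is not read, \<open>y\<close> may be unrelated to the tape
          and of uncontrolled length. The empty string takes its place, which \<open>tr t2 0\<close>
          cannot distinguish from \<open>y\<close>.\<close>
        define y' where "y' = (if q2 = 0 then [] else y)"
        have y': "q2 = 0 \<or> tape_output (last (snd c)) y'" "tr t2 q2 y' = tr t2 q2 y"
          using c(3) Some by (auto simp: y'_def)
        have "length y' \<le> length u + 2 * length \<pi>"
        proof (cases "q2 = 0")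
          case False
          then show ?thesis using y'(1) len(2)
            by (intro output_length[OF c(1), of "last (snd c)"] last_in_set) (auto simp flip: length_0_conv)
        qed (simp add: y'_def)
        then have ly: "length y' \<le> Y ?n" using uv(1) \<pi> by (simp add: Y_def)
        have "length (tr t2 q2 y') \<le> L2 * (length y' + 1)"
          using t2(1) by (intro length_tr) (auto simp: fst_bounded_def)
        also have "\<dots> \<le> T ?n" unfolding T_def using ly by (intro mult_le_mono) auto
        finally have lt: "length (tr t2 q2 y') \<le> T ?n" .
        let ?w = "v @ tr t2 q2 y'"
        have w: "length ?w \<le> N ?n + T ?n" using uv(2) lt by simp
        have "Tr (RF (start_state F), a # snd (init_config F u) @ (out_tape v # replicate lM blank_tape))
          (poly pM (length ?w) + (N ?n + T ?n) + T ?n + Y ?n + poly pF (N ?n) + 5) (VM ?w)"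
          by (rule Tr_run[OF det pM c(1,2) _ y'(1) refl \<pi> lt ly w]) (use c(3) Some in auto)
        from tree_mono[OF this, of "R ?n"] show ?thesis
          using poly_nat_mono[OF w, of pM] by (simp add: pipe_outcome_def Some y'(2) R_def)
      qed
      then show "Tr (if guided then RG (start_state F) 0 else RF (start_state F),
        a # snd (init_config F u) @ (out_tape v # replicate lM blank_tape)) (R ?n) (?W u v)"
        using g by (simp only: if_False)
    qed
  qed
qed

lemma length_rst: "length (rst T q w) \<le> length w"
  by (induction w arbitrary: q) (auto intro: le_SucI)

lemma pipe_guided:
  assumes g: "guided" and t1: "fst_bounded t1 B1 L1" "1 < B1" and t2: "fst_bounded t2 B2 L2" "q2 < B2"
    and g0: "g0 = 0" and M: "deterministic M"
  shows "\<exists>G e. mach e G (\<lambda>x. if follows F (init_config F (sel True (tr t1 1 x))) (rst t1 1 x)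
      then {#([], last (out_tape (sel False (tr t1 1 x)) # replicate lM blank_tape))#} else {#}) \<and>
    deterministic G"
proof -
  let ?W = "\<lambda>x u v. if follows F (init_config F u) (rst t1 1 x)
      then {#([], last (out_tape v # replicate lM blank_tape))#} else {#}"
  define B where "B k = Suc (Suc k + L1 * (k + 1)) + 2 * (L1 * (k + 1)) + k + 2" for k
  have B: "pbounded B" unfolding B_def
    by (intro pbounded_Suc pbounded_mult pbounded_const pbounded_add pbounded_id)
  have "\<exists>G e. mach e G (\<lambda>x. guess (?W x) g0 (tr t1 1 x) [] []) \<and>
      (g0 \<noteq> 1 \<and> deterministic M \<longrightarrow> deterministic G)"
  proof (rule compile_pipe[OF t1 t2 _ B])
    fix x :: str
    show "Tr (T1 g0 1 [], input_tape x # (out_tape [] # replicate lF blank_tape) @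
      (out_tape [] # replicate lM blank_tape)) (B (length x)) (guess (?W x) g0 (tr t1 1 x) [] [])"
      unfolding B_def
    proof (rule Tr_init[OF t1(1)])
      fix a and u v :: str assume a: "tape_output a (rst t1 1 x)"
      have "Tr (RG (start_state F) 0, a # snd (init_config F u) @ (out_tape v # replicate lM blank_tape))
        (Suc (length (rst t1 1 x))) (if follows F (start_state F, snd (init_config F u)) (replicate 0 True @ rst t1 1 x)
         then {#([], last (out_tape v # replicate lM blank_tape))#} else {#})"
        by (rule Tr_guided[OF _ a]) (use length_init_config[OF wfF] lF in auto)
      then have "Tr (RG (start_state F) 0, a # snd (init_config F u) @ (out_tape v # replicate lM blank_tape))
        (Suc (length x)) (?W x u v)"
        using tree_mono length_rst[of t1 1 x] by (fastforce simp: init_config_def)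
      then show "Tr (if guided then RG (start_state F) 0 else RF (start_state F),
        a # snd (init_config F u) @ (out_tape v # replicate lM blank_tape)) (Suc (length x)) (?W x u v)"
        using g by (simp only: if_True)
    qed
  qed (use g in simp)
  then obtain G e where G: "mach e G (\<lambda>x. guess (?W x) g0 (tr t1 1 x) [] [])"
    "g0 \<noteq> 1 \<and> deterministic M \<longrightarrow> deterministic G" by blast
  from G(2) have "deterministic G" using g0 M by simp
  with G(1) show ?thesis unfolding g0 guess_0 append_Nil by blast
qed

end

lemma pipeline:
  assumes t1: "fst_bounded t1 B1 L1" "1 < B1" and t2: "fst_bounded t2 B2 L2" "q2 < B2"
    and F: "DPM F" "runs_as F q2 f" and M: "mach eM M VM"
  shows "\<exists>G e. mach e G (\<lambda>x. guess (pipe_outcome (num_tapes M - 1) flag t2 q2 f VM) g0 (tr t1 1 x) [] []) \<and>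
    (g0 \<noteq> 1 \<and> deterministic M \<longrightarrow> deterministic G)"
proof -
  interpret pipe t1 t2 F M "num_tapes F - 1" "num_tapes M - 1" False flag g0 q2 eM
    using F M by unfold_locales (auto simp: DPM_def NPM_def mach_def wf_ntm_def)
  show ?thesis by (rule pipe_run[OF _ t1 t2 F M]) simp
qed

text \<open>A last stage that halts at once: its output is its input, so a pipeline ending in it
  computes what the earlier stages write.\<close>

definition acc_machine :: ntm where
  "acc_machine = \<lparr>num_tapes = 1, start_state = 0, accept_state = 0, program = []\<rparr>"

definition rej_machine :: ntm where
  "rej_machine = \<lparr>num_tapes = 1, start_state = 0, accept_state = 1, program = []\<rparr>"

lemma mach_acc_machine: "mach e acc_machine (\<lambda>x. {#([], input_tape x)#})"
proof -
  have "tree (delta acc_machine) 0 e (0, [input_tape x]) n {#([], input_tape x)#}" for x n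
    by (rule tree_halt) (auto simp: delta_def acc_machine_def)
  then show ?thesis by (simp add: mach_def wf_ntm_def init_config_def) (simp add: acc_machine_def)
qed

lemma mach_rej_machine: "mach e rej_machine (\<lambda>x. {#})"
proof -
  have "tree (delta rej_machine) 1 e (0, [input_tape x]) n {#}" for x n
    by (rule tree_halt) (auto simp: delta_def rej_machine_def)
  then show ?thesis by (simp add: mach_def wf_ntm_def init_config_def) (simp add: rej_machine_def)
qed

lemma det_machines: "deterministic acc_machine" "deterministic rej_machine"
  by (simp_all add: deterministic_def acc_machine_def rej_machine_def)

lemma mach_DPM: "mach e M V \<Longrightarrow> deterministic M \<Longrightarrow> DPM M"
  by (simp add: DPM_def mach_NPM)

lemma Some_in_partial_FP: "Some \<in> partial_FP"
  unfolding partial_FP_def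
  using mach_computes[OF mach_acc_machine, of Some] mach_DPM[OF mach_acc_machine det_machines(1)]
  by auto

subsection \<open>Closure properties of polynomial-time functions\<close>

lemma partial_FP_pipe:
  assumes f: "f \<in> partial_FP" and m: "m \<in> partial_FP"
    and t1: "fst_bounded t1 B1 L1" "1 < B1" and t2: "fst_bounded t2 B2 L2" "1 < B2"
  shows "(\<lambda>x. case f (sel True (tr t1 1 x)) of None \<Rightarrow> None
    | Some y \<Rightarrow> m (sel False (tr t1 1 x) @ tr t2 1 y)) \<in> partial_FP"
proof -
  obtain F where F: "DPM F" "computes F f" using f by (auto simp: partial_FP_def)
  obtain M where M: "DPM M" "computes M m" using m by (auto simp: partial_FP_def)
  obtain VM where VM: "mach (\<lambda>_ _ _. []) M VM" using NPM_mach M(1) by (auto simp: DPM_def)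
  obtain G e where G: "mach e G (\<lambda>x. guess (pipe_outcome (num_tapes M - 1) False t2 1 f VM) 0 (tr t1 1 x) [] [])"
    "deterministic G"
    using pipeline[OF t1 t2 F(1) computes_runs_as[OF F(2)] VM, of False 0] M(1) unfolding DPM_def by auto
  have "computes G (\<lambda>x. case f (sel True (tr t1 1 x)) of None \<Rightarrow> None
    | Some y \<Rightarrow> m (sel False (tr t1 1 x) @ tr t2 1 y))"
    by (rule mach_computes[OF G(1)])
      (use computes_mach[OF M VM] in \<open>force simp: guess_0 pipe_outcome_def split: option.splits\<close>)+
  then show ?thesis unfolding partial_FP_def using mach_DPM[OF G] by blast
qed

lemma runs_as_decider:
  assumes "DPM D"
  shows "runs_as D 0 (\<lambda>u. if u \<in> language D then Some [] else None)"
  unfolding runs_as_def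
proof
  fix u
  show "\<exists>\<pi> c. run D (init_config D u) \<pi> c \<and> halted D c \<and>
     (case if u \<in> language D then Some [] else None of None \<Rightarrow> fst c \<noteq> accept_state D
      | Some y \<Rightarrow> fst c = accept_state D \<and> (0 = 0 \<or> tape_output (last (snd c)) y))"
  proof (cases "u \<in> language D")
    case True
    then show ?thesis by (auto simp: language_def accepting_path_def)
  next
    case False
    then show ?thesis
      using NPM_halting_run[of D u] assms unfolding DPM_def
      by (fastforce simp: language_def accepting_path_def)
  qed
qed

lemma partial_FP_decide:
  assumes D: "DPM D" and t1: "fst_bounded t1 B1 L1" "1 < B1"
  shows "(\<lambda>x. if sel True (tr t1 1 x) \<in> language D then Some (sel False (tr t1 1 x)) else None) \<in> partial_FP"
proof -
  let ?t2 = "\<lambda>(_ :: nat) (_ :: bool option). (0 :: nat, [] :: str)"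
  let ?f = "\<lambda>u. if u \<in> language D then Some [] else None"
  have t2: "fst_bounded ?t2 1 0" "0 < (1 :: nat)" by (auto simp: fst_bounded_def)
  obtain G e where G: "mach e G (\<lambda>x. guess (pipe_outcome (num_tapes acc_machine - 1) False ?t2 0 ?f
      (\<lambda>x. {#([], input_tape x)#})) 0 (tr t1 1 x) [] [])" "deterministic G"
    using pipeline[OF t1 t2 D runs_as_decider[OF D] mach_acc_machine, of False 0] det_machines by auto
  have "computes G (\<lambda>x. if sel True (tr t1 1 x) \<in> language D then Some (sel False (tr t1 1 x)) else None)"
    by (rule mach_computes[OF G(1)])
      (auto simp: guess_0 pipe_outcome_def split: option.splits if_splits)
  then show ?thesis unfolding partial_FP_def using mach_DPM[OF G] by blast
qed

lemma dom_in_P: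
  assumes "f \<in> partial_FP"
  shows "dom f \<in> class_P"
proof -
  obtain M where M: "DPM M" "computes M f" using assms by (auto simp: partial_FP_def)
  obtain VM where VM: "mach (\<lambda>_ _ _. []) M VM" using NPM_mach M(1) by (auto simp: DPM_def)
  have "language M = dom f"
    unfolding mach_language[OF VM] dom_def using computes_mach[OF M VM] by (metis not_None_eq)
  then show ?thesis using M(1) by (auto simp: class_P_def)
qed

definition copy :: "'a \<Rightarrow> nat \<Rightarrow> bool option \<Rightarrow> nat \<times> ('a \<times> bool) list" where
  "copy c q a = (case a of None \<Rightarrow> (0, []) | Some b \<Rightarrow> (1, [(c, b)]))"

definition copy2 :: "nat \<Rightarrow> bool option \<Rightarrow> nat \<times> str" where
  "copy2 q a = (case a of None \<Rightarrow> (0, []) | Some b \<Rightarrow> (1, [b]))"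

definition both :: "nat \<Rightarrow> bool option \<Rightarrow> nat \<times> (bool \<times> bool) list" where
  "both q a = (case a of None \<Rightarrow> (0, []) | Some b \<Rightarrow> (1, [(True, b), (False, b)]))"

lemma fst_bounded_copy: "fst_bounded (copy c) 2 1" "fst_bounded copy2 2 1" "fst_bounded both 2 2"
  by (auto simp: fst_bounded_def copy_def copy2_def both_def split: option.splits)

lemma tr_copy: "sel True (tr (copy True) 1 x) = x" "sel False (tr (copy True) 1 x) = []"
  by (induction x) (auto simp: copy_def)

lemma tr_copy2: "tr copy2 1 x = x"
  by (induction x) (auto simp: copy2_def)

lemma tr_both: "sel c (tr both 1 x) = x"
  by (induction x) (auto simp: both_def)

lemma partial_FP_comp:
  assumes "f \<in> partial_FP" "m \<in> partial_FP"
  shows "(\<lambda>x. case f x of None \<Rightarrow> None | Some y \<Rightarrow> m y) \<in> partial_FP"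
  using partial_FP_pipe[OF assms fst_bounded_copy(1)[of True] _ fst_bounded_copy(2)]
  unfolding tr_copy tr_copy2 append_Nil by simp

lemma FP_transduce:
  assumes "f \<in> FP" "fst_bounded t2 B2 L2" "1 < B2"
  shows "(\<lambda>x. tr t2 1 (f x)) \<in> FP"
  using partial_FP_pipe[OF _ Some_in_partial_FP fst_bounded_copy(1)[of True] _ assms(2,3),
      of "\<lambda>x. Some (f x)"] assms(1)
  unfolding tr_copy append_Nil FP_def by simp

text \<open>With \<open>flag\<close> set and a last stage that always rejects, the pipeline accepts
  exactly when the decider rejects.\<close>

lemma compl_in_P:
  assumes "L \<in> class_P"
  shows "- L \<in> class_P"
proof -
  obtain D where D: "DPM D" "language D = L" using assms by (auto simp: class_P_def)
  let ?t2 = "\<lambda>(_ :: nat) (_ :: bool option). (0 :: nat, [] :: str)"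
  let ?f = "\<lambda>u. if u \<in> language D then Some [] else None"
  have t2: "fst_bounded ?t2 1 0" "0 < (1 :: nat)" by (auto simp: fst_bounded_def)
  obtain G e where G: "mach e G (\<lambda>x. guess (pipe_outcome (num_tapes rej_machine - 1) True ?t2 0 ?f
      (\<lambda>x. {#})) 0 (tr (copy True) 1 x) [] [])" "deterministic G"
    using pipeline[OF fst_bounded_copy(1) _ t2 D(1) runs_as_decider[OF D(1)] mach_rej_machine, of True 0 True]
      det_machines by auto
  have "language G = - L"
    unfolding mach_language[OF G(1)] guess_0 tr_copy append_Nil
    by (auto simp: pipe_outcome_def D(2) split: if_splits)
  then show ?thesis using mach_DPM[OF G] by (auto simp: class_P_def)
qed

subsection \<open>Verifying paths\<close>

text \<open>A marker \<open>True\<close> precedes each bit, and \<open>False\<close> ends the first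
  component of a pair. A finite-state transducer can thus find the border, and the second component
  stays unencoded, ready to be followed as a path.\<close>

definition enc :: "str \<Rightarrow> str" where
  "enc x = concat (map (\<lambda>b. [True, b]) x)"

definition pair :: "str \<Rightarrow> str \<Rightarrow> str" where
  "pair x p = enc x @ False # p"

lemma enc_simps [simp]: "enc [] = []" "enc (b # x) = True # b # enc x"
  by (simp_all add: enc_def)

lemma pair_simps: "pair [] p = False # p" "pair (b # x) p = True # b # pair x p"
  by (simp_all add: pair_def)

lemma pair_inject [simp]: "pair x p = pair y q \<longleftrightarrow> x = y \<and> p = q"
proof (induction x arbitrary: y)
  case Nil
  then show ?case by (cases y) (auto simp: pair_simps)
next
  case (Cons b x)
  then show ?case by (cases y) (auto simp: pair_simps)
qed

lemma length_pair: "length (pair x p) = 2 * length x + 1 + length p"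
  by (induction x) (auto simp: pair_simps)

text \<open>State \<open>1\<close> expects a marker, state \<open>2\<close> a bit. The closing
  marker leads to state \<open>0\<close>, which leaves the second component unread.\<close>

definition parse :: "nat \<Rightarrow> bool option \<Rightarrow> nat \<times> (bool \<times> bool) list" where
  "parse q a = (case a of None \<Rightarrow> (0, [])
    | Some b \<Rightarrow> if q = 1 then (if b then (2, []) else (0, [])) else (1, [(True, b)]))"

lemma fst_bounded_parse: "fst_bounded parse 3 1"
  by (auto simp: fst_bounded_def parse_def split: option.splits)

lemma tr_parse: "sel True (tr parse 1 (pair x p)) = x" "rst parse 1 (pair x p) = p"
  by (induction x) (auto simp: pair_simps parse_def)

lemma acc_follows: "p \<in> acc N x \<longleftrightarrow> follows N (init_config N x) p"
  by (auto simp: acc_def follows_def accepting_path_def)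

text \<open>Following a path takes time linear in the length of the pair, whatever the running time
  of \<open>N\<close>.\<close>

lemma path_verifier:
  assumes "wf_ntm N"
  shows "\<exists>D. DPM D \<and> (\<forall>x p. pair x p \<in> language D \<longleftrightarrow> p \<in> acc N x)"
proof -
  let ?t2 = "\<lambda>(_ :: nat) (_ :: bool option). (0 :: nat, [] :: str)"
  have t2: "fst_bounded ?t2 1 0" "0 < (1 :: nat)" by (auto simp: fst_bounded_def)
  interpret pipe parse ?t2 N acc_machine "num_tapes N - 1" 0 True False 0 0 "\<lambda>_ _ _. []"
    using assms mach_acc_machine by unfold_locales (auto simp: mach_def wf_ntm_def acc_machine_def)
  obtain G e where G: "mach e G (\<lambda>x. if follows N (init_config N (sel True (tr parse 1 x))) (rst parse 1 x)
      then {#([], last (out_tape (sel False (tr parse 1 x)) # replicate 0 blank_tape))#} else {#})"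
    "deterministic G"
    using pipe_guided[OF _ fst_bounded_parse _ t2 _ det_machines(1)] by auto
  have "language G = {x. follows N (init_config N (sel True (tr parse 1 x))) (rst parse 1 x)}"
    unfolding mach_language[OF G(1)] by auto
  then have "pair x p \<in> language G \<longleftrightarrow> p \<in> acc N x" for x p
    by (simp only: mem_Collect_eq tr_parse acc_follows)
  then show ?thesis using mach_DPM[OF G] by blast
qed

subsection \<open>Reading off labels from paths\<close>

text \<open>State \<open>0\<close> is final, so state \<open>q\<close> stands for
  \<open>q - 1\<close> symbols \<open>True\<close> read. The cap \<open>Suc m\<close> keeps the
  states finite and is reached only by indices outside of the program.\<close>

definition path_map :: "nat \<Rightarrow> (nat \<Rightarrow> str) \<Rightarrow> nat \<Rightarrow> bool option \<Rightarrow> nat \<times> str" where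
  "path_map m h q a = (case a of None \<Rightarrow> (0, [])
    | Some b \<Rightarrow> if b then (min (Suc q) (Suc m), []) else (1, if q - 1 < m then h (q - 1) else []))"

lemma fst_bounded_path_map:
  assumes "\<And>i. i < m \<Longrightarrow> length (h i) \<le> L"
  shows "fst_bounded (path_map m h) (m + 2) L"
  using assms by (auto simp: fst_bounded_def path_map_def split: option.splits)

lemma tr_path_map_token:
  "i + j < m \<Longrightarrow> tr (path_map m h) (Suc i) (replicate j True @ False # w) = h (i + j) @ tr (path_map m h) 1 w"
  by (induction j arbitrary: i) (auto simp: path_map_def)

lemma tr_path_map:
  "(\<And>i. i \<in> set \<pi> \<Longrightarrow> i < m) \<Longrightarrow> tr (path_map m h) 1 (encode_path \<pi>) = concat (map h \<pi>)"
  by (induction \<pi>) (use tr_path_map_token[of 0] in \<open>auto simp: path_map_def\<close>)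

lemma run_indices: "run M c \<pi> c' \<Longrightarrow> i \<in> set \<pi> \<Longrightarrow> i < length (program M)"
proof (induction \<pi> arbitrary: c)
  case (Cons j \<pi>)
  then show ?case using Cons.IH[of "apply_instr (program M ! j) c"] by auto
qed simp

text \<open>Used to turn easiness of a composed machine into computability of its guesses, or of the
  paths of its last stage.\<close>

lemma FP_path_lab:
  assumes "g \<in> FP"
  shows "\<exists>g' \<in> FP. \<forall>x. g x \<in> acc N x \<longrightarrow> (\<exists>\<pi>. accepting_path N x \<pi> \<and> g' x = path_lab e N \<pi>)"
proof -
  let ?m = "length (program N)" and ?h = "\<lambda>i. instr_lab e (program N ! i)"
  define L where "L = Max (insert 0 ((\<lambda>i. length (?h i)) ` {..<?m}))"
  have "fst_bounded (path_map ?m ?h) (?m + 2) L"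
    by (rule fst_bounded_path_map) (auto simp: L_def intro!: Max_ge)
  then have "(\<lambda>x. tr (path_map ?m ?h) 1 (g x)) \<in> FP" using FP_transduce[OF assms] by simp
  moreover have "\<exists>\<pi>. accepting_path N x \<pi> \<and> tr (path_map ?m ?h) 1 (g x) = path_lab e N \<pi>"
    if "g x \<in> acc N x" for x
  proof -
    from that obtain \<pi> where \<pi>: "g x = encode_path \<pi>" "accepting_path N x \<pi>" by (auto simp: acc_def)
    have "i < ?m" if "i \<in> set \<pi>" for i
      using \<pi>(2) run_indices that unfolding accepting_path_def by blast
    from tr_path_map[of \<pi>, OF this] show ?thesis using \<pi> by (auto simp: path_lab_def)
  qed
  ultimately show ?thesis by (intro bexI[of _ "\<lambda>x. tr (path_map ?m ?h) 1 (g x)"]) auto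
qed

text \<open>An instruction is determined by its fields, hence a label can name its index. With such
  labels a machine used as last stage leaves its own encoded path in the labels of the
  pipeline.\<close>

lemma path_index_lab:
  assumes "wf_ntm N"
  shows "\<exists>e. \<forall>x \<pi>. accepting_path N x \<pi> \<longrightarrow> path_lab e N \<pi> = encode_path \<pi>"
proof -
  let ?P = "program N"
  define e :: "nat lab" where "e s r d = encode_path [THE i. i < length ?P \<and>
    ?P ! i = \<lparr>src = s, reads = r, dst = fst d, writes = fst (snd d), moves = snd (snd d)\<rparr>]" for s r d
  have the: "(THE i. i < length ?P \<and> ?P ! i = ?P ! j) = j" if "j < length ?P" for j
    using assms that by (intro the_equality) (auto simp: wf_ntm_def nth_eq_iff_index_eq)
  have e: "instr_lab e (?P ! j) = encode_path [j]" if "j < length ?P" for j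
  proof -
    have "\<lparr>src = src \<iota>, reads = reads \<iota>, dst = dst \<iota>, writes = writes \<iota>, moves = moves \<iota>\<rparr> = \<iota>"
      for \<iota> :: instr by (cases \<iota>) simp
    then show ?thesis unfolding instr_lab_def e_def fst_conv snd_conv by (simp only: the[OF that])
  qed
  have "path_lab e N \<pi> = encode_path \<pi>" if "\<forall>i \<in> set \<pi>. i < length ?P" for \<pi>
    using that by (induction \<pi>) (auto simp: path_lab_def e)
  then show ?thesis using run_indices unfolding accepting_path_def by blast
qed

subsection \<open>Finite languages\<close>

definition prefixes_of :: "lang \<Rightarrow> lang" where
  "prefixes_of L = {p. \<exists>w. p @ w \<in> L}"

lemma finite_prefixes_of:
  assumes "finite L"
  shows "finite (prefixes_of L)"
proof -
  have "prefixes_of L \<subseteq> (\<Union>x\<in>L. (\<lambda>n. take n x) ` {..length x})"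
  proof
    fix p assume "p \<in> prefixes_of L"
    then obtain w where "p @ w \<in> L" by (auto simp: prefixes_of_def)
    moreover have "p = take (length p) (p @ w)" by simp
    ultimately show "p \<in> (\<Union>x\<in>L. (\<lambda>n. take n x) ` {..length x})" by fastforce
  qed
  then show ?thesis by (rule finite_subset) (use assms in auto)
qed

text \<open>Transducers start in state \<open>1\<close> and stop in state \<open>0\<close>; nonempty
  prefixes are numbered from \<open>2\<close> on.\<close>

definition trie_state :: "str \<Rightarrow> nat" where
  "trie_state p = (if p = [] then 1 else to_nat p + 2)"

definition trie_prefix :: "nat \<Rightarrow> str" where
  "trie_prefix q = (if q = 1 then [] else from_nat (q - 2))"

lemma trie_prefix_state [simp]: "trie_prefix (trie_state p) = p"
  by (simp add: trie_prefix_def trie_state_def)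

text \<open>
  The outcomes \<open>pair [] []\<close> and \<open>pair [] [True]\<close> are accepted and rejected, respectively, by the path
  verifier of \<open>acc_machine\<close>, whose only accepting path is empty.
\<close>

definition trie :: "lang \<Rightarrow> nat \<Rightarrow> bool option \<Rightarrow> nat \<times> (bool \<times> bool) list" where
  "trie L q a = (case a of
      None \<Rightarrow> (0, map (Pair True) (pair [] (if trie_prefix q \<in> L then [] else [True])))
    | Some b \<Rightarrow> if trie_prefix q @ [b] \<in> prefixes_of L then (trie_state (trie_prefix q @ [b]), [])
        else (0, map (Pair True) (pair [] [True])))"

lemma fst_bounded_trie:
  assumes "finite L"
  shows "fst_bounded (trie L) (Suc (Max (insert 1 (trie_state ` prefixes_of L)))) 2"
  unfolding fst_bounded_def less_Suc_eq_le
  using assms finite_prefixes_of[OF assms]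
  by (auto simp: trie_def pair_simps intro!: Max_ge split: option.splits)

lemma tr_trie:
  "sel True (tr (trie L) (trie_state p) w) = pair [] (if p @ w \<in> L then [] else [True])"
proof (induction w arbitrary: p)
  case Nil
  have "trie_state p \<noteq> 0" by (simp add: trie_state_def)
  then show ?case by (simp add: trie_def pair_simps)
next
  case (Cons b w)
  have 0: "trie_state p \<noteq> 0" by (simp add: trie_state_def)
  show ?case
  proof (cases "p @ [b] \<in> prefixes_of L")
    case True
    then show ?thesis using Cons[of "p @ [b]"] 0 by (simp add: trie_def)
  next
    case False
    then have "p @ b # w \<notin> L" by (auto simp: prefixes_of_def dest: spec[of _ w])
    then show ?thesis using False 0 by (simp add: trie_def pair_simps)
  qed
qed

lemma acc_acc_machine: "p \<in> acc acc_machine x \<longleftrightarrow> p = []"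
proof -
  have "accepting_path acc_machine x \<pi> \<longleftrightarrow> \<pi> = []" for \<pi>
    by (cases \<pi>) (auto simp: accepting_path_def acc_machine_def init_config_def halted_def)
  then show ?thesis by (auto simp: acc_def)
qed

text \<open>Finite languages are easy by definition, so their membership in P needs its own proof. A
  transducer cannot accept; it passes its verdict to a verifier as a valid or an invalid
  path.\<close>

lemma finite_in_P:
  assumes "finite L"
  shows "L \<in> class_P"
proof -
  obtain D where D: "DPM D" "\<And>x p. pair x p \<in> language D \<longleftrightarrow> p = []"
    using path_verifier[of acc_machine] mach_acc_machine by (auto simp: mach_def acc_acc_machine)
  let ?f = "\<lambda>x. if sel True (tr (trie L) 1 x) \<in> language D then Some (sel False (tr (trie L) 1 x)) else None"
  have st: "sel True (tr (trie L) 1 x) = pair [] (if x \<in> L then [] else [True])" for x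
    using tr_trie[of L "[]" x] unfolding trie_state_def append_Nil by simp
  have "1 < Suc (Max (insert 1 (trie_state ` prefixes_of L)))"
    unfolding less_Suc_eq_le by (intro Max_ge) (use finite_prefixes_of[OF assms] in auto)
  then have f: "?f \<in> partial_FP"
    by (rule partial_FP_decide[OF D(1) fst_bounded_trie[OF assms]])
  have "dom ?f = L"
    unfolding dom_def st D(2) by auto
  with dom_in_P[OF f] show ?thesis by simp
qed

subsection \<open>Easy languages\<close>

text \<open>While \<open>F\<close> works on \<open>x\<close>, the tape of \<open>M\<close> already
  holds \<open>x\<close> in pair encoding with its closing marker; appending the output of
  \<open>F\<close> completes the pair.\<close>

definition dup :: "nat \<Rightarrow> bool option \<Rightarrow> nat \<times> (bool \<times> bool) list" where
  "dup q a = (case a of None \<Rightarrow> (0, [(False, False)])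
    | Some b \<Rightarrow> (1, [(True, b), (False, True), (False, b)]))"

lemma fst_bounded_dup: "fst_bounded dup 2 3"
  by (auto simp: fst_bounded_def dup_def split: option.splits)

lemma tr_dup: "sel True (tr dup 1 x) = x" "sel False (tr dup 1 x) @ p = pair x p"
  by (induction x) (auto simp: dup_def pair_simps)

lemma partial_FP_pair:
  assumes "f \<in> partial_FP" "m \<in> partial_FP"
  shows "(\<lambda>x. case f x of None \<Rightarrow> None | Some y \<Rightarrow> m (pair x y)) \<in> partial_FP"
  using partial_FP_pipe[OF assms fst_bounded_dup _ fst_bounded_copy(2)]
  unfolding tr_dup tr_copy2 by simp

lemma decider_partial_FP:
  assumes "DPM D"
  shows "\<exists>m \<in> partial_FP. dom m = language D"
  using partial_FP_decide[OF assms fst_bounded_copy(1)[of True]]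
  unfolding tr_copy by (intro bexI) (auto simp: dom_def)

text \<open>For \<open>x\<close> outside of \<open>L\<close> no string is an accepting path of
  \<open>N\<close>, so verifying the computed \<open>f x\<close> decides \<open>L\<close>.\<close>

lemma Easy_subset_P: "Easy_all_all_UP \<subseteq> class_P"
proof
  fix L assume L: "L \<in> Easy_all_all_UP"
  show "L \<in> class_P"
  proof (cases "finite L")
    case True
    then show ?thesis by (rule finite_in_P)
  next
    case False
    then obtain N where N: "UP_machine N" "language N = L"
      using L by (auto simp: Easy_all_all_UP_def class_UP_def)
    then obtain f where f: "f \<in> FP" "\<And>x. x \<in> L \<Longrightarrow> f x \<in> acc N x"
      using L False unfolding Easy_all_all_UP_def by blast
    obtain D where D: "DPM D" "\<And>x p. pair x p \<in> language D \<longleftrightarrow> p \<in> acc N x"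
      using path_verifier[of N] N(1) by (auto simp: UP_machine_def NPM_def)
    obtain m where m: "m \<in> partial_FP" "dom m = language D"
      using decider_partial_FP[OF D(1)] by blast
    have "(\<lambda>x. m (pair x (f x))) \<in> partial_FP"
      using partial_FP_pair[OF _ m(1), of "\<lambda>x. Some (f x)"] f(1) by (simp add: FP_def)
    from dom_in_P[OF this] have "{x. f x \<in> acc N x} \<in> class_P"
      using D(2) m(2) by (simp add: dom_def set_eq_iff)
    moreover have "{x. f x \<in> acc N x} = L"
      using f(2) N(2) by (auto simp: acc_def language_def)
    ultimately show ?thesis by simp
  qed
qed

lemma UNIV_in_P: "UNIV \<in> class_P"
proof -
  have "language acc_machine = UNIV" by (simp add: mach_language[OF mach_acc_machine])
  then show ?thesis
    using mach_DPM[OF mach_acc_machine det_machines(1)] by (auto simp: class_P_def)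
qed

lemma P_subset_UP: "class_P \<subseteq> class_UP"
  using DPM_UP by (auto simp: class_P_def class_UP_def)

lemma P_subset_Easy:
  assumes "UNIV \<in> Easy_all_all_UP"
  shows "class_P \<subseteq> Easy_all_all_UP"
proof
  fix L assume L: "L \<in> class_P"
  then obtain D where D: "DPM D" "language D = L" by (auto simp: class_P_def)
  have "\<exists>f \<in> FP. \<forall>x \<in> L. f x \<in> acc N x" if N: "UP_machine N" "language N = L" for N
  proof -
    have wf: "NPM N" "wf_ntm N" using N(1) by (auto simp: UP_machine_def NPM_def)
    obtain e where e: "\<And>x \<pi>. accepting_path N x \<pi> \<Longrightarrow> path_lab e N \<pi> = encode_path \<pi>"
      using path_index_lab[OF wf(2)] by blast
    obtain VN where VN: "mach e N VN" using NPM_mach[OF wf(1)] .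
    let ?t2 = "\<lambda>(_ :: nat) (_ :: bool option). (0 :: nat, [] :: str)"
    let ?f = "\<lambda>u. if u \<in> language D then Some [] else None"
    have t2: "fst_bounded ?t2 1 0" "0 < (1 :: nat)" by (auto simp: fst_bounded_def)
    \<comment> \<open>\<open>both\<close> hands the input to \<open>D\<close> and to
      \<open>N\<close>. On \<open>L\<close> the outcomes are those of \<open>N\<close>; elsewhere
      \<open>flag\<close> yields a single one with empty label. In either case there is exactly
      one.\<close>
    let ?V = "\<lambda>x. pipe_outcome (num_tapes N - 1) True ?t2 0 ?f VN x x"
    obtain G e' where "mach e' G (\<lambda>x. guess (pipe_outcome (num_tapes N - 1) True ?t2 0 ?f VN) 0 (tr both 1 x) [] [])"
      using pipeline[OF fst_bounded_copy(3) _ t2 D(1) runs_as_decider[OF D(1)] VN, of True 0] by auto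
    then have G: "mach e' G ?V" unfolding guess_0 tr_both append_Nil .
    have size: "size (VN x) \<le> 1" for x by (rule UP_size[OF N(1) VN])
    have VN_lab: "s \<in> acc N x" if st: "(s, t) \<in># VN x" for x s t
    proof -
      obtain \<pi> c where "run N (init_config N x) \<pi> c" "halted N c" "fst c = accept_state N"
        "s = path_lab e N \<pi>" "t = last (snd c)" by (rule mach_complete[OF VN st])
      then have "accepting_path N x \<pi>" "s = path_lab e N \<pi>"
        unfolding accepting_path_def by blast+
      with e[of x \<pi>] show ?thesis by (auto simp: acc_def)
    qed
    have VN_ne: "VN x \<noteq> {#}" if "x \<in> L" for x
      using mach_language[OF VN] N(2) that by auto
    have "UP_machine G"
      by (rule mach_UP[OF G]) (use size in \<open>simp add: pipe_outcome_def\<close>)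
    moreover have "language G = UNIV"
      unfolding mach_language[OF G] using VN_ne D(2) by (auto simp: pipe_outcome_def)
    ultimately have "\<exists>g \<in> FP. \<forall>x \<in> UNIV. g x \<in> acc G x"
      using assms unfolding Easy_all_all_UP_def by (simp add: infinite_UNIV_listI)
    then obtain g where g: "g \<in> FP" "\<And>x. g x \<in> acc G x" by blast
    obtain g' where g': "g' \<in> FP" "\<And>x. \<exists>\<pi>. accepting_path G x \<pi> \<and> g' x = path_lab e' G \<pi>"
      using FP_path_lab[OF g(1)] g(2) by metis
    have "g' x \<in> acc N x" if "x \<in> L" for x
    proof -
      obtain t where "(g' x, t) \<in># ?V x" using g'(2)[of x] mach_accepting[OF G] by metis
      then show ?thesis using that D(2) VN_lab by (auto simp: pipe_outcome_def)
    qed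
    then show ?thesis using g'(1) by blast
  qed
  then show "L \<in> Easy_all_all_UP"
    using L P_subset_UP by (auto simp: Easy_all_all_UP_def)
qed

subsection \<open>A one-way function from a hard UP machine\<close>

text \<open>
  On strings that are not pairs, the string sent to the path verifier is completed to a pair with the
  invalid path \<open>[True]\<close>.
\<close>

definition unpair :: "nat \<Rightarrow> bool option \<Rightarrow> nat \<times> (bool \<times> bool) list" where
  "unpair q a = (case a of
      None \<Rightarrow> (0, if q = 1 then [(True, False), (True, True)]
        else if q = 2 then [(True, True), (True, False), (True, True)] else [])
    | Some b \<Rightarrow> if q = 1 then (if b then (2, [(True, True)]) else (3, [(True, False)]))
        else if q = 2 then (1, [(True, b), (False, b)]) else (3, [(True, b)]))"

lemma fst_bounded_unpair: "fst_bounded unpair 4 3"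
  by (auto simp: fst_bounded_def unpair_def split: option.splits)

lemma tr_unpair_3: "sel True (tr unpair 3 p) = p" "sel False (tr unpair 3 p) = []"
  by (induction p) (auto simp: unpair_def)

lemma tr_unpair: "sel True (tr unpair 1 (pair x p)) = pair x p" "sel False (tr unpair 1 (pair x p)) = x"
  by (induction x) (auto simp: pair_simps unpair_def tr_unpair_3)

text \<open>Marker and bit are consumed together, hence the induction in steps of two.\<close>

lemma unpair_cases: "(\<exists>x p. z = pair x p) \<or> (\<exists>x. sel True (tr unpair 1 z) = pair x [True])"
proof (induction z rule: induct_list012)
  case 1
  have "sel True (tr unpair 1 []) = pair [] [True]" by (simp add: unpair_def pair_simps)
  then show ?case by blast
next
  case (2 b)
  show ?case
  proof (cases b)
    case True
    then have "sel True (tr unpair 1 [b]) = pair [True] [True]" by (simp add: unpair_def pair_simps)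
    then show ?thesis by blast
  next
    case False
    then have "[b] = pair [] []" by (simp add: pair_simps)
    then show ?thesis by blast
  qed
next
  case (3 b b' z)
  show ?case
  proof (cases b)
    case True
    from 3(1) show ?thesis
    proof (elim disjE exE)
      fix x p assume "z = pair x p"
      then have "b # b' # z = pair (b' # x) p" using True by (simp add: pair_simps)
      then show ?thesis by blast
    next
      fix x assume "sel True (tr unpair 1 z) = pair x [True]"
      then have "sel True (tr unpair 1 (b # b' # z)) = pair (b' # x) [True]"
        using True by (simp add: pair_simps unpair_def)
      then show ?thesis by blast
    qed
  next
    case False
    then have "b # b' # z = pair [] (b' # z)" by (simp add: pair_simps)
    then show ?thesis by blast
  qed
qed

definition second :: "nat \<Rightarrow> bool option \<Rightarrow> nat \<times> str" where
  "second q a = (case a of None \<Rightarrow> (0, [])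
    | Some b \<Rightarrow> if q = 1 then (if b then (2, []) else (3, []))
        else if q = 2 then (1, []) else (3, [b]))"

lemma second_simps:
  "second q None = (0, [])"
  "second q (Some b) = (if q = 1 then (if b then (2, []) else (3, []))
        else if q = 2 then (1, []) else (3, [b]))"
  by (simp_all add: second_def)

lemma fst_bounded_second: "fst_bounded second 4 1"
  by (auto simp: fst_bounded_def second_def split: option.splits)

lemma tr_second_3: "tr second 3 p = p"
  by (induction p) (auto simp: second_simps)

lemma tr_second: "tr second 1 (pair x p) = p"
  by (induction x) (auto simp: pair_simps second_simps tr_second_3)

text \<open>Every nonempty encoded path ends in \<open>False\<close>, so \<open>[True]\<close> is an
  invalid path for every machine.\<close>

lemma encode_path_neq_True: "encode_path \<pi> \<noteq> [True]"
proof (cases \<pi>)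
  case (Cons i \<rho>)
  then show ?thesis by (cases i) auto
qed simp

lemma length_encode_path:
  "(\<And>i. i \<in> set \<pi> \<Longrightarrow> i < m) \<Longrightarrow> length (encode_path \<pi>) \<le> m * length \<pi>"
proof (induction \<pi>)
  case (Cons i \<pi>)
  then have "length (encode_path \<pi>) \<le> m * length \<pi>" "Suc i \<le> m" by (simp_all add: Suc_le_eq)
  then show ?case by simp
qed simp

text \<open>Injectivity of \<open>f\<close> is the unambiguity of \<open>N\<close>, surjectivity is
  \<open>language N = UNIV\<close>, and honesty is the time bound of \<open>N\<close>. From the
  value of an inverse, \<open>second\<close> would extract an accepting path.\<close>

lemma one_way_if_UNIV_not_Easy:
  assumes "UNIV \<notin> Easy_all_all_UP"
  shows "\<exists>f. one_one_one_way f \<and> ran f = UNIV"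
proof -
  \<comment> \<open>Since \<open>UNIV\<close> is in UP, it can fail to be easy only through a UP
    machine whose paths are hard to compute.\<close>
  have "UNIV \<in> class_UP" using UNIV_in_P P_subset_UP by blast
  then obtain N where N: "UP_machine N" "language N = UNIV"
    and hard: "\<And>f. f \<in> FP \<Longrightarrow> \<exists>x. f x \<notin> acc N x"
    using assms unfolding Easy_all_all_UP_def by blast
  have NPM: "NPM N" "wf_ntm N" using N(1) by (auto simp: UP_machine_def NPM_def)
  obtain D where D: "DPM D" "\<And>x p. pair x p \<in> language D \<longleftrightarrow> p \<in> acc N x"
    using path_verifier[OF NPM(2)] by blast
  define f where "f z = (if sel True (tr unpair 1 z) \<in> language D then Some (sel False (tr unpair 1 z))
    else None)" for z
  have FP: "f \<in> partial_FP"
    unfolding f_def by (rule partial_FP_decide[OF D(1) fst_bounded_unpair]) simp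
  have f_pair: "f (pair x p) = Some x" if "p \<in> acc N x" for x p
    using that unfolding f_def tr_unpair D(2) by simp
  have f_Some: "\<exists>p. z = pair x p \<and> p \<in> acc N x" if "f z = Some x" for z x
    using unpair_cases[of z]
  proof (elim disjE exE)
    fix y p assume z: "z = pair y p"
    show ?thesis using that unfolding f_def z tr_unpair D(2) by (auto split: if_splits)
  next
    fix y assume y: "sel True (tr unpair 1 z) = pair y [True]"
    have "[True] \<notin> acc N y" 
      using encode_path_neq_True[symmetric] unfolding acc_def by blast
    then have "f z = None" unfolding f_def y D(2) by simp
    then show ?thesis using that by simp
  qed
  have ran: "ran f = UNIV"
  proof -
    have "x \<in> ran f" for x
    proof -
      have "x \<in> language N" using N(2) by simp
      then obtain p where "p \<in> acc N x" by (auto simp: language_def acc_def)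
      then show ?thesis using f_pair by (auto simp: ran_def)
    qed
    then show ?thesis by blast
  qed
  have inj: "inj_on f (dom f)"
  proof (rule inj_onI)
    fix z z' assume "z \<in> dom f" "z' \<in> dom f" "f z = f z'"
    then obtain x where "f z = Some x" "f z' = Some x" by auto
    then obtain p p' where "z = pair x p" "p \<in> acc N x" "z' = pair x p'" "p' \<in> acc N x"
      using f_Some by metis
    then show "z = z'" using N(1) unfolding UP_machine_def acc_def by blast
  qed
  have "honest f"
  proof -
    obtain q :: "nat poly" where
      q: "\<And>x \<pi> c. run N (init_config N x) \<pi> c \<Longrightarrow> length \<pi> \<le> poly q (length x)"
      using NPM(1) unfolding NPM_def poly_time_def by blast
    let ?m = "length (program N)"
    \<comment> \<open>\<open>2 * n + 1\<close> is the length of the pair without the path, and each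
      index of the path costs at most \<open>?m\<close> symbols.\<close>
    have "pbounded (\<lambda>n. 2 * n + 1 + ?m * poly q n)"
      by (intro pbounded_add pbounded_mult pbounded_const pbounded_id pbounded_poly)
    then obtain p :: "nat poly" where p: "\<And>n. 2 * n + 1 + ?m * poly q n \<le> poly p n"
      unfolding pbounded_def by blast
    have "length z \<le> poly p (length x)" if z: "f z = Some x" for z x
    proof -
      obtain w where w: "z = pair x w" "w \<in> acc N x" using f_Some[OF z] by blast
      then obtain \<pi> c where \<pi>: "w = encode_path \<pi>" "run N (init_config N x) \<pi> c"
        by (auto simp: acc_def accepting_path_def)
      have "length w \<le> ?m * length \<pi>"
        unfolding \<pi>(1) by (rule length_encode_path) (rule run_indices[OF \<pi>(2)])
      also have "\<dots> \<le> ?m * poly q (length x)" using q[OF \<pi>(2)] by simp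
      finally have "length z \<le> 2 * length x + 1 + ?m * poly q (length x)"
        by (simp add: w(1) length_pair)
      then show ?thesis using p[of "length x"] by linarith
    qed
    then show ?thesis unfolding honest_def by blast
  qed
  moreover have "\<not> FP_invertible f"
  proof
    assume "FP_invertible f"
    then obtain g where g: "g \<in> FP" "\<And>y. f (g y) = Some y" unfolding FP_invertible_def ran by blast
    have "(\<lambda>y. tr second 1 (g y)) \<in> FP"
      by (rule FP_transduce[OF g(1) fst_bounded_second]) simp
    from hard[OF this] obtain y where y: "tr second 1 (g y) \<notin> acc N y" by blast
    obtain p where p: "g y = pair y p" "p \<in> acc N y" using f_Some[OF g(2)] by blast
    show False using y p(2) unfolding p(1) tr_second by simp
  qed
  ultimately show ?thesis using FP inj ran unfolding one_one_one_way_def by blast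
qed

subsection \<open>Clocks\<close>

text \<open>
  The head of the second tape, which holds a copy of the input, sweeps back and forth, writing a symbol
  on the third tape in each step, while the head of the first tape counts the sweeps.
\<close>

definition square_step :: "nat trans" where
  "square_step q r = (let a = r ! 0; b = r ! 1; c = r ! 2 in
     if q = 0 then (if a \<noteq> blank then {(0, [a, a, c], [MoveRight, MoveRight, Stay])}
       else {(1, [a, b, c], [MoveLeft, MoveLeft, Stay])})
     else if q = 1 then (if b \<noteq> blank then {(1, [a, b, bit_sym True], [Stay, MoveLeft, MoveRight])}
       else if a \<noteq> blank then {(2, [a, b, c], [MoveLeft, MoveRight, Stay])}
       else {(3, [a, b, c], [Stay, Stay, MoveLeft])})
     else if q = 2 then (if b \<noteq> blank then {(2, [a, b, bit_sym True], [Stay, MoveRight, MoveRight])}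
       else if a \<noteq> blank then {(1, [a, b, c], [MoveLeft, MoveLeft, Stay])}
       else {(3, [a, b, c], [Stay, Stay, MoveLeft])})
     else if q = 3 then (if c \<noteq> blank then {(3, [a, b, c], [Stay, Stay, MoveLeft])}
       else {(4, [a, b, c], [Stay, Stay, MoveRight])})
     else {})"

lemma square_step_eq:
  "square_step q [a, b, c] = (
     if q = 0 then (if a \<noteq> blank then {(0, [a, a, c], [MoveRight, MoveRight, Stay])}
       else {(1, [a, b, c], [MoveLeft, MoveLeft, Stay])})
     else if q = 1 then (if b \<noteq> blank then {(1, [a, b, bit_sym True], [Stay, MoveLeft, MoveRight])}
       else if a \<noteq> blank then {(2, [a, b, c], [MoveLeft, MoveRight, Stay])}
       else {(3, [a, b, c], [Stay, Stay, MoveLeft])})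
     else if q = 2 then (if b \<noteq> blank then {(2, [a, b, bit_sym True], [Stay, MoveRight, MoveRight])}
       else if a \<noteq> blank then {(1, [a, b, c], [MoveLeft, MoveLeft, Stay])}
       else {(3, [a, b, c], [Stay, Stay, MoveLeft])})
     else if q = 3 then (if c \<noteq> blank then {(3, [a, b, c], [Stay, Stay, MoveLeft])}
       else {(4, [a, b, c], [Stay, Stay, MoveRight])})
     else {})"
  by (simp add: square_step_def)

definition head_at :: "str \<Rightarrow> int \<Rightarrow> tape" where
  "head_at u j = (fst (input_tape u), j)"

lemma head_at_move [simp]: "tape_update (head_at u j) (tape_read (head_at u j)) d = head_at u (j + shift d)"
  by (simp add: tape_update_read head_at_def)

lemma head_at_move_blank [simp]:
  "tape_read (head_at u j) = blank \<Longrightarrow> tape_update (head_at u j) blank d = head_at u (j + shift d)"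
  by (metis head_at_move)

lemma out_tape_Stay [simp]: "tape_update (out_tape w) blank Stay = out_tape w"
  using tape_update_Stay[of "out_tape w"] by simp

lemma read_head_at: "tape_read (head_at u j) = blank \<longleftrightarrow> j < 0 \<or> int (length u) \<le> j"
  by (auto simp: head_at_def tape_read_def input_tape_def)

abbreviation "SqT \<equiv> tree square_step 4 (\<lambda>_ _ _. [])"

lemma square_det:
  assumes "square_step q [tape_read a, tape_read b, tape_read c] = {(q', [x, y, z], [d1, d2, d3])}"
    and "SqT (q', [tape_update a x d1, tape_update b y d2, tape_update c z d3]) n V"
  shows "SqT (q, [a, b, c]) (Suc n) V"
  by (rule tree_det[where q' = q' and w = "[x, y, z]" and m = "[d1, d2, d3]" and n = n]) (use assms in auto)

lemma square_rewind:
  "k \<le> length w \<Longrightarrow> SqT (3, [a, b, head_at w (int k - 1)]) (k + 1) {#([], input_tape w)#}"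
proof (induction k)
  case 0
  have r: "tape_read (head_at w (-1)) = blank" by (simp add: read_head_at)
  have t: "SqT (4, [a, b, head_at w 0]) n {#([], head_at w 0)#}" for n
    by (rule tree_halt) (auto simp: square_step_eq)
  have i: "head_at w 0 = input_tape w" by (simp add: head_at_def input_tape_def)
  have m: "tape_update (head_at w (-1)) blank MoveRight = input_tape w"
    using head_at_move[of w "-1" MoveRight] by (simp only: r) (simp add: i)
  have "SqT (3, [a, b, head_at w (-1)]) (Suc 0) {#([], input_tape w)#}"
    by (rule square_det[where q' = 4 and x = "tape_read a" and y = "tape_read b" and z = "tape_read (head_at w (-1))"
          and ?d1.0 = Stay and ?d2.0 = Stay and ?d3.0 = MoveRight])
      (use t r m in \<open>auto simp: square_step_eq i\<close>)
  then show ?case by simp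
next
  case (Suc k)
  have r: "tape_read (head_at w (int k)) \<noteq> blank" using Suc.prems by (simp add: read_head_at)
  have "SqT (3, [a, b, head_at w (int k)]) (Suc (k + 1)) {#([], input_tape w)#}"
    by (rule square_det[where q' = 3 and x = "tape_read a" and y = "tape_read b" and z = "tape_read (head_at w (int k))"
          and ?d1.0 = Stay and ?d2.0 = Stay and ?d3.0 = MoveLeft])
      (use Suc r in \<open>auto simp: square_step_eq\<close>)
  then show ?case by simp
qed

text \<open>The head position with \<open>i\<close> cells still to cross, leftwards in state
  \<open>1\<close> and rightwards in state \<open>2\<close>; for \<open>i = 0\<close> it is the
  blank beyond the end.\<close>

definition sweep_pos :: "nat \<Rightarrow> nat \<Rightarrow> nat \<Rightarrow> int" where
  "sweep_pos s n i = (if s = 1 then int i - 1 else int n - int i)"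

lemma square_sweep:
  assumes s: "s = 1 \<or> s = 2"
  shows "i \<le> length u \<Longrightarrow>
    SqT (s, [a, head_at u (sweep_pos s (length u) 0), out_tape (w @ replicate i True)]) n V \<Longrightarrow>
    SqT (s, [a, head_at u (sweep_pos s (length u) i), out_tape w]) (n + i) V"
proof (induction i arbitrary: w)
  case (Suc i)
  let ?b = "head_at u (sweep_pos s (length u) (Suc i))"
  let ?d = "if s = 1 then MoveLeft else MoveRight"
  have r: "tape_read ?b \<noteq> blank" using Suc.prems(1) by (auto simp: read_head_at sweep_pos_def)
  have "SqT (s, [a, head_at u (sweep_pos s (length u) i), out_tape (w @ [True])]) (n + i) V"
    by (rule Suc.IH) (use Suc.prems in auto)
  moreover have "sweep_pos s (length u) (Suc i) + shift ?d = sweep_pos s (length u) i"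
    by (simp add: sweep_pos_def)
  ultimately have "SqT (s, [a, ?b, out_tape w]) (Suc (n + i)) V"
    by (intro square_det[where q' = s and x = "tape_read a" and y = "tape_read ?b" and z = "bit_sym True"
          and ?d1.0 = Stay and ?d2.0 = ?d and ?d3.0 = MoveRight])
      (use r s in \<open>auto simp: square_step_eq\<close>)
  then show ?case by simp
qed simp

text \<open>With the counter head at \<open>j - 1\<close>, \<open>j + 1\<close> sweeps remain: its
  blank is noticed only after a last sweep. The direction alternates, as \<open>3 - s\<close>
  exchanges \<open>1\<close> and \<open>2\<close>.\<close>

lemma square_sweeps:
  assumes "j \<le> length u" "s = 1 \<or> s = 2"
  shows "SqT (s, [head_at u (int j - 1), head_at u (sweep_pos s (length u) (length u)), out_tape w])
    ((j + 1) * (length u + 1) + (length w + (j + 1) * length u) + 1)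
    {#([], input_tape (w @ replicate ((j + 1) * length u) True))#}"
  using assms
proof (induction j arbitrary: s w)
  case 0
  let ?n = "length u" and ?w = "w @ replicate (length u) True"
  let ?a = "head_at u (-1)" and ?b = "head_at u (sweep_pos s (length u) 0)"
  have r: "tape_read ?a = blank" "tape_read ?b = blank"
    using 0(2) by (auto simp: read_head_at sweep_pos_def)
  have o: "tape_update (out_tape ?w) blank MoveLeft = head_at ?w (int (length ?w) - 1)"
    by (simp only: out_tape_left head_at_def)
  have "SqT (s, [?a, ?b, out_tape ?w]) (Suc (length ?w + 1)) {#([], input_tape ?w)#}"
    by (rule square_det[where q' = 3 and x = "tape_read ?a" and y = "tape_read ?b" and z = blank
          and ?d1.0 = Stay and ?d2.0 = Stay and ?d3.0 = MoveLeft])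
      (use 0(2) r square_rewind[OF order_refl, of ?a ?b ?w] in \<open>auto simp: square_step_eq o simp del: length_append\<close>)
  from square_sweep[OF 0(2) order_refl this] show ?case by (simp add: algebra_simps)
next
  case (Suc j)
  let ?n = "length u" and ?w = "w @ replicate (length u) True" and ?s = "3 - s"
  let ?a = "head_at u (int j)" and ?b = "head_at u (sweep_pos s (length u) 0)"
  let ?d = "if s = 1 then MoveRight else MoveLeft"
  let ?V = "{#([], input_tape (w @ replicate ((Suc j + 1) * length u) True))#}"
  let ?t = "(j + 1) * (length u + 1) + (length ?w + (j + 1) * length u) + 1"
  have r: "tape_read ?a \<noteq> blank" "tape_read ?b = blank"
    using Suc.prems by (auto simp: read_head_at sweep_pos_def)
  have "SqT (?s, [head_at u (int j - 1), head_at u (sweep_pos ?s ?n ?n), out_tape ?w]) ?t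
      {#([], input_tape (?w @ replicate ((j + 1) * length u) True))#}"
    by (rule Suc.IH) (use Suc.prems in auto)
  moreover have "?w @ replicate ((j + 1) * length u) True = w @ replicate ((Suc j + 1) * length u) True"
    by (simp add: replicate_add)
  moreover have "sweep_pos s ?n 0 + shift ?d = sweep_pos ?s ?n ?n"
    using Suc.prems(2) by (auto simp: sweep_pos_def)
  ultimately have "SqT (s, [?a, ?b, out_tape ?w]) (Suc ?t) ?V"
    by (intro square_det[where q' = ?s and x = "tape_read ?a" and y = "tape_read ?b" and z = "tape_read (out_tape ?w)"
          and ?d1.0 = MoveLeft and ?d2.0 = ?d and ?d3.0 = Stay])
      (use r Suc.prems(2) in \<open>auto simp: square_step_eq\<close>)
  then have "SqT (s, [?a, ?b, out_tape (w @ replicate ?n True)]) (Suc ?t) ?V" .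
  from square_sweep[OF Suc.prems(2) order_refl this]
  show ?case by (simp add: algebra_simps)
qed

text \<open>The factor \<open>length u + 1\<close> is the number of sweeps, one for each cell of the
  counter and a last one on its blank. Later only the lower bound \<open>length u * length u\<close>
  is used.\<close>

definition square :: "str \<Rightarrow> str" where
  "square u = replicate ((length u + 1) * length u) True"

lemma square_copy:
  "u = u1 @ u2 \<Longrightarrow> SqT (0, [head_at u (int (length u1)), out_tape u1, out_tape []])
    (length u2 + 1 + ((length u + 1) * (length u + 1) + (length u + 1) * length u + 1))
    {#([], input_tape (square u))#}"
proof (induction u2 arbitrary: u1)
  case Nil
  then have u: "u = u1" by simp
  let ?a = "head_at u (int (length u))"
  have r: "tape_read ?a = blank" by (simp add: read_head_at)
  have b: "tape_update (out_tape u) blank MoveLeft = head_at u (int (length u) - 1)"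
    by (simp only: out_tape_left head_at_def)
  have a: "tape_update ?a blank MoveLeft = head_at u (int (length u) - 1)"
    using head_at_move[of u "int (length u)" MoveLeft] by (simp only: r) simp
  have "SqT (1, [head_at u (int (length u) - 1), head_at u (int (length u) - 1), out_tape []])
    ((length u + 1) * (length u + 1) + (length u + 1) * length u + 1)
    {#([], input_tape (square u))#}"
    using square_sweeps[OF order_refl[of "length u"], of 1 "[]"]
    by (simp add: sweep_pos_def square_def)
  then have "SqT (0, [?a, out_tape u, out_tape []])
    (Suc ((length u + 1) * (length u + 1) + (length u + 1) * length u + 1))
    {#([], input_tape (square u))#}"
    by (intro square_det[where q' = 1 and x = blank and y = blank and z = blank
          and ?d1.0 = MoveLeft and ?d2.0 = MoveLeft and ?d3.0 = Stay])
      (use r a b in \<open>simp_all add: square_step_eq\<close>)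
  then show ?case using u by simp
next
  case (Cons b u2)
  let ?a = "head_at u (int (length u1))"
  have r: "tape_read ?a = bit_sym b"
    using Cons.prems by (simp add: head_at_def tape_read_def input_tape_def)
  have "SqT (0, [head_at u (int (length (u1 @ [b]))), out_tape (u1 @ [b]), out_tape []])
    (length u2 + 1 + ((length u + 1) * (length u + 1) + (length u + 1) * length u + 1))
    {#([], input_tape (square u))#}"
    using Cons.IH[of "u1 @ [b]"] Cons.prems by simp
  moreover have "tape_update ?a (bit_sym b) MoveRight = head_at u (int (length (u1 @ [b])))"
    using head_at_move[of u "int (length u1)" MoveRight] by (simp only: r) (simp add: add.commute)
  ultimately have "SqT (0, [?a, out_tape u1, out_tape []])
    (Suc (length u2 + 1 + ((length u + 1) * (length u + 1) + (length u + 1) * length u + 1)))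
    {#([], input_tape (square u))#}"
    by (intro square_det[where q' = 0 and x = "bit_sym b" and y = "bit_sym b" and z = blank
          and ?d1.0 = MoveRight and ?d2.0 = MoveRight and ?d3.0 = Stay])
      (use r in \<open>simp_all add: square_step_eq\<close>)
  then show ?case by simp
qed

lemma square_in_FP: "square \<in> FP"
proof -
  let ?B = "\<lambda>n. n + 1 + ((n + 1) * (n + 1) + (n + 1) * n + 1)"
  have "\<exists>M e. mach e M (\<lambda>u. {#([], input_tape (square u))#}) \<and>
    ((\<forall>q\<in>{..4}. \<forall>r d d'. d \<in> square_step q r \<longrightarrow> d' \<in> square_step q r \<longrightarrow> d = d') \<longrightarrow> deterministic M)"
  proof (rule compile[where K = 3 and A = 3 and B = ?B and ?q0.0 = 0])
    show "pbounded ?B" by (intro pbounded_add pbounded_mult pbounded_const pbounded_id)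
    show "finite (square_step q r)" for q r by (simp add: square_step_def Let_def)
    show "q' \<in> {..4} \<and> w \<in> symtuples 3 3 \<and> length m = 3"
      if "q \<in> {..4}" "r \<in> symtuples 3 3" "(q', w, m) \<in> square_step q r" for q r q' w m
    proof -
      from that(2) obtain a b c where "r = [a, b, c]" "a < 3" "b < 3" "c < 3"
        by (auto simp: symtuples_def length_Suc_conv numeral_3_eq_3)
      then show ?thesis using that(3)
        by (auto simp: square_step_def symtuples_def split: if_splits)
    qed
    show "SqT (0, input_tape u # replicate (3 - 1) blank_tape) (?B (length u)) {#([], input_tape (square u))#}" for u
      using square_copy[of u "[]" u] by (simp add: head_at_def out_tape_Nil input_tape_def numeral_2_eq_2)
  qed auto
  moreover have "\<forall>q\<in>{..4}. \<forall>r d d'. d \<in> square_step q r \<longrightarrow> d' \<in> square_step q r \<longrightarrow> d = d'"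
    by (auto simp: square_step_def Let_def split: if_splits)
  ultimately obtain M e where M: "mach e M (\<lambda>u. {#([], input_tape (square u))#})" "deterministic M"
    by blast
  have "computes M (\<lambda>u. Some (square u))" by (rule mach_computes[OF M(1)]) auto
  then show ?thesis unfolding FP_def partial_FP_def using mach_DPM[OF M] by blast
qed

text \<open>Reads to the end, unlike \<open>parse\<close>: the second component goes to
  \<open>F\<close>, to be transformed or replaced by guesses, while the first waits for
  \<open>M\<close> as an open pair.\<close>

definition split :: "nat \<Rightarrow> bool option \<Rightarrow> nat \<times> (bool \<times> bool) list" where
  "split q a = (case a of None \<Rightarrow> (0, [])
    | Some b \<Rightarrow> if q = 1 then (if b then 2 else 3, [(False, b)])
        else if q = 2 then (1, [(False, b)]) else (3, [(True, b)]))"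

lemma fst_bounded_split: "fst_bounded split 4 1"
  by (auto simp: fst_bounded_def split_def split: option.splits)

lemma tr_split_3: "sel True (tr split 3 p) = p" "sel False (tr split 3 p) = []"
  by (induction p) (auto simp: split_def)

lemma tr_split: "sel True (tr split 1 (pair x p)) = p" "sel False (tr split 1 (pair x p)) = pair x []"
  by (induction x) (auto simp: pair_simps split_def tr_split_3)

lemma pair_append: "pair x [] @ p = pair x p"
  by (simp add: pair_def)

text \<open>Two extra symbols make the base of the powers at least \<open>2\<close>, even for the
  empty input.\<close>

definition pad :: "nat \<Rightarrow> bool option \<Rightarrow> nat \<times> str" where
  "pad q a = (case a of None \<Rightarrow> (0, [True, True]) | Some b \<Rightarrow> (1, [b]))"

lemma fst_bounded_pad: "fst_bounded pad 2 2"
  by (auto simp: fst_bounded_def pad_def split: option.splits)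

lemma tr_pad: "tr pad 1 x = x @ [True, True]"
  by (induction x) (auto simp: pad_def)

text \<open>The input is carried along in a pair, so that each round can square the clock alone;
  \<open>j\<close> rounds give the exponent \<open>2 ^ j\<close>.\<close>

lemma clock:
  "\<exists>c. (\<lambda>y. Some (pair y (c y))) \<in> partial_FP \<and> (\<forall>y. (length y + 2) ^ (2 ^ j) \<le> length (c y))"
proof (induction j)
  case 0
  have "(\<lambda>y. Some (pair y (y @ [True, True]))) \<in> partial_FP"
    using partial_FP_pipe[OF Some_in_partial_FP Some_in_partial_FP fst_bounded_dup _ fst_bounded_pad]
    unfolding tr_dup tr_pad by simp
  then show ?case by (intro exI[of _ "\<lambda>y. y @ [True, True]"]) simp
next
  case (Suc j)
  then obtain c where c: "(\<lambda>y. Some (pair y (c y))) \<in> partial_FP"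
    "\<And>y. (length y + 2) ^ (2 ^ j) \<le> length (c y)" by blast
  let ?sq = "\<lambda>z. Some (sel False (tr split 1 z) @ square (sel True (tr split 1 z)))"
  have sq: "?sq \<in> partial_FP"
    using partial_FP_pipe[OF _ Some_in_partial_FP fst_bounded_split _ fst_bounded_copy(2),
        of "\<lambda>x. Some (square x)"] square_in_FP
    unfolding tr_copy2 FP_def by simp
  have "(\<lambda>y. Some (pair y (square (c y)))) \<in> partial_FP"
    using partial_FP_comp[OF c(1) sq] unfolding option.case tr_split pair_append .
  moreover have "(length y + 2) ^ (2 ^ Suc j) \<le> length (square (c y))" for y
  proof -
    have "(length y + 2) ^ (2 ^ Suc j) = (length y + 2) ^ (2 ^ j) * (length y + 2) ^ (2 ^ j)"
      by (simp add: power_add[symmetric] mult_2)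
    also have "\<dots> \<le> length (c y) * length (c y)" by (intro mult_le_mono c(2))
    also have "\<dots> \<le> length (square (c y))" by (simp add: square_def)
    finally show ?thesis .
  qed
  ultimately show ?case by (intro exI[of _ "\<lambda>y. square (c y)"]) simp
qed

text \<open>As the base is at least \<open>2\<close>, the coefficient \<open>a\<close> is absorbed
  by \<open>2 ^ a\<close>; one more factor \<open>n + 2\<close> pays for the Horner step.\<close>

lemma poly_le_power: "\<exists>k. \<forall>n. poly p n \<le> (n + 2) ^ k" for p :: "nat poly"
proof (induction p)
  case (pCons a p)
  then obtain k where k: "\<And>n. poly p n \<le> (n + 2) ^ k" by blast
  have "poly (pCons a p) n \<le> (n + 2) ^ (a + k + 1)" for n
  proof -
    have "a \<le> 2 ^ a" by (rule less_imp_le) (rule less_exp)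
    also have "\<dots> \<le> (n + 2) ^ a" by (rule power_mono) auto
    also have "\<dots> \<le> (n + 2) ^ (a + k)" by (rule power_increasing) auto
    finally have a: "a \<le> (n + 2) ^ (a + k)" .
    have "poly p n \<le> (n + 2) ^ (a + k)"
      by (rule order_trans[OF k power_increasing]) auto
    then have "a + n * poly p n \<le> (n + 2) ^ (a + k) + n * (n + 2) ^ (a + k)"
      using a by (intro add_mono mult_le_mono) auto
    also have "\<dots> \<le> (n + 2) ^ (a + k + 1)" by simp
    finally show ?thesis by simp
  qed
  then show ?case by blast
qed simp

lemma poly_clock:
  fixes p :: "nat poly"
  shows "\<exists>c. (\<lambda>y. Some (pair y (c y))) \<in> partial_FP \<and> (\<forall>y. poly p (length y) \<le> length (c y))"
proof -
  obtain k where k: "\<And>n. poly p n \<le> (n + 2) ^ k" using poly_le_power by blast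
  obtain c where c: "(\<lambda>y. Some (pair y (c y))) \<in> partial_FP"
    "\<And>y. (length y + 2) ^ (2 ^ k) \<le> length (c y)" using clock[of k] by blast
  have "poly p (length y) \<le> length (c y)" for y
  proof -
    have "(length y + 2) ^ k \<le> (length y + 2) ^ (2 ^ k)"
      by (rule power_increasing) (auto intro: less_imp_le less_exp)
    then show ?thesis using k[of "length y"] c(2)[of y] by linarith
  qed
  then show ?thesis using c(1) by blast
qed

subsection \<open>Inverting one-way functions by guessing\<close>

text \<open>Equality is tested by verifying a path of this machine, whose only accepting path spells out its input.\<close>

definition eq_machine :: ntm where
  "eq_machine = \<lparr>num_tapes = 1, start_state = 0, accept_state = 1, program =
     [\<lparr>src = 0, reads = [1], dst = 0, writes = [1], moves = [MoveRight]\<rparr>,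
      \<lparr>src = 0, reads = [2], dst = 0, writes = [2], moves = [MoveRight]\<rparr>,
      \<lparr>src = 0, reads = [0], dst = 1, writes = [0], moves = [Stay]\<rparr>]\<rparr>"

text \<open>Instruction \<open>0\<close> of \<open>eq_machine\<close> reads the bit
  \<open>False\<close>, \<open>1\<close> the bit \<open>True\<close> and \<open>2\<close> the final
  blank; their codes are \<open>[False]\<close>, \<open>[True, False]\<close> and
  \<open>[True, True, False]\<close>.\<close>

definition spell :: "nat \<Rightarrow> bool option \<Rightarrow> nat \<times> str" where
  "spell q a = (case a of None \<Rightarrow> (0, [True, True, False])
    | Some b \<Rightarrow> (1, if b then [True, False] else [False]))"

lemma spell_simps: "tr spell 1 [] = [True, True, False]"
  "tr spell 1 (b # y) = (if b then [True, False] else [False]) @ tr spell 1 y"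
  by (auto simp: spell_def)

lemma fst_bounded_spell: "fst_bounded spell 2 3"
  by (auto simp: fst_bounded_def spell_def split: option.splits)

lemma spell_inject: "tr spell 1 x = tr spell 1 y \<longleftrightarrow> x = y"
proof (induction x arbitrary: y)
  case Nil
  show ?case by (cases y) (auto simp only: spell_simps, auto split: if_splits)
next
  case (Cons b x)
  show ?case
  proof (cases y)
    case Nil
    then show ?thesis by (cases b) (auto simp only: spell_simps, auto)
  next
    case (Cons b' y')
    then show ?thesis using Cons.IH[of y'] by (cases b; cases b') (auto simp only: spell_simps, auto)
  qed
qed

lemma spell_path: "tr spell 1 y = encode_path (map (\<lambda>b. if b then 1 else 0) y @ [2])"
proof (induction y)
  case Nil
  show ?case by (simp only: spell_simps) (simp add: numeral_2_eq_2)
next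
  case (Cons b y)
  then show ?case by (cases b) (auto simp only: spell_simps, auto)
qed

text \<open>In state \<open>0\<close> the symbol under the head admits exactly one instruction, so
  the path is forced.\<close>

lemma eq_machine_run:
  "tape_output t y \<Longrightarrow> (\<exists>c. run eq_machine (0, [t]) \<pi> c \<and> halted eq_machine c \<and> fst c = 1) \<longleftrightarrow>
    \<pi> = map (\<lambda>b. if b then 1 else 0) y @ [2]"
proof (induction y arbitrary: t \<pi>)
  case Nil
  have r: "tape_read t = 0" using tape_output_Nil[OF Nil] by (simp add: blank_def)
  show ?case
  proof (cases \<pi>)
    case Nil
    then show ?thesis by auto
  next
    case (Cons i \<rho>)
    have app: "i < length (program eq_machine) \<and> applicable (program eq_machine ! i) (0, [t]) \<longleftrightarrow> i = 2"
      using r by (auto simp: eq_machine_def applicable_def less_Suc_eq nth_Cons')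
    have nxt: "apply_instr (program eq_machine ! 2) (0, [t]) = (1, [t])"
      using r tape_update_Stay[of t] by (simp add: eq_machine_def apply_instr_def)
    have "run eq_machine (1, [t]) \<rho> c \<longleftrightarrow> \<rho> = [] \<and> c = (1, [t])" for c
      by (cases \<rho>) (auto simp: eq_machine_def applicable_def less_Suc_eq nth_Cons')
    moreover have "halted eq_machine (1, [t])"
      by (auto simp: halted_def eq_machine_def applicable_def)
    ultimately show ?thesis using app nxt Cons by auto
  qed
next
  case (Cons b y)
  let ?i = "if b then 1 else 0 :: nat"
  let ?t = "tape_update t (bit_sym b) MoveRight"
  have r: "tape_read t = bit_sym b" using tape_output_Cons_read[OF Cons.prems] .
  show ?case
  proof (cases \<pi>)
    case Nil
    then show ?thesis by auto
  next
    case (Cons i \<rho>)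
    have app: "i < length (program eq_machine) \<and> applicable (program eq_machine ! i) (0, [t]) \<longleftrightarrow> i = ?i"
      using r by (auto simp: eq_machine_def applicable_def less_Suc_eq nth_Cons' bit_sym_def)
    have nxt: "apply_instr (program eq_machine ! ?i) (0, [t]) = (0, [?t])"
      by (simp add: eq_machine_def apply_instr_def bit_sym_def)
    show ?thesis
      using app nxt Cons Cons.IH[OF tape_output_Cons_move[OF Cons.prems], of \<rho>] by auto
  qed
qed

lemma acc_eq_machine: "p \<in> acc eq_machine y \<longleftrightarrow> p = tr spell 1 y"
proof -
  have "init_config eq_machine y = (0, [input_tape y])" "accept_state eq_machine = 1"
    by (simp_all add: init_config_def eq_machine_def)
  then have "accepting_path eq_machine y \<pi> \<longleftrightarrow> \<pi> = map (\<lambda>b. if b then 1 else 0) y @ [2]" for \<pi>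
    using eq_machine_run[OF tape_output_input[of y], of \<pi>] unfolding accepting_path_def by simp
  then show ?thesis unfolding acc_def spell_path by auto
qed

lemma UNIV_not_Easy_if_one_way:
  assumes f: "one_one_one_way f" and ran: "ran f = UNIV"
  shows "UNIV \<notin> Easy_all_all_UP"
proof
  assume Easy: "UNIV \<in> Easy_all_all_UP"
  from f have inj: "inj_on f (dom f)" and FP: "f \<in> partial_FP" and not_inv: "\<not> FP_invertible f"
    by (auto simp: one_one_one_way_def)
  from f obtain p :: "nat poly" where p: "\<And>x y. f x = Some y \<Longrightarrow> length x \<le> poly p (length y)"
    unfolding one_one_one_way_def honest_def using ran by blast
  obtain c where c: "(\<lambda>y. Some (pair y (c y))) \<in> partial_FP" "\<And>y. poly p (length y) \<le> length (c y)"
    using poly_clock by blast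
  have "\<exists>x. f x = Some y" for y
    using UNIV_I[of y] unfolding ran[symmetric] by (auto simp: ran_def)
  then obtain inv where inv: "\<And>y. f (inv y) = Some y" by metis
  have inv_unique: "x = inv y" if "f x = Some y" for x y
    by (rule inj_onD[OF inj]) (use that inv[of y] in auto)
  obtain F where F: "DPM F" "computes F f" using FP by (auto simp: partial_FP_def)
  have "wf_ntm eq_machine" by (auto simp: wf_ntm_def eq_machine_def)
  \<comment> \<open>\<open>D\<close> is the equality test: by \<open>spell_inject\<close> it accepts
    \<open>pair y (tr spell 1 z)\<close> iff \<open>z = y\<close>.\<close>
  then obtain D where D: "DPM D" "\<And>x p. pair x p \<in> language D \<longleftrightarrow> p = tr spell 1 x"
    using path_verifier[of eq_machine] unfolding acc_eq_machine by blast
  obtain VD where VD: "mach (\<lambda>_ _ _. []) D VD" using NPM_mach D(1) by (auto simp: DPM_def)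
  have VD_size: "size (VD x) \<le> 1" for x
    by (rule UP_size[OF DPM_UP[OF D(1)] VD])
  \<comment> \<open>A silent labelling of \<open>D\<close> leaves the guessed bits as the only
    labels of the pipeline.\<close>
  have VD_lab: "s = []" if "(s, t) \<in># VD x" for s t x
    by (rule mach_complete[OF VD that]) (simp add: path_lab_def instr_lab_def)
  have VD_empty: "VD x = {#} \<longleftrightarrow> x \<notin> language D" for x
    unfolding mach_language[OF VD] by simp
  let ?W = "pipe_outcome (num_tapes D - 1) False spell 1 f VD"
  \<comment> \<open>\<open>split\<close> sends the clock to \<open>F\<close>; in mode
    \<open>1\<close> its symbols only determine how many bits may be guessed. \<open>F\<close> then
    computes the value at the guess, and \<open>D\<close> compares it with \<open>y\<close>.\<close>
  obtain G e where G: "mach e G (\<lambda>x. guess ?W 1 (tr split 1 x) [] [])"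
    using pipeline[OF fst_bounded_split _ fst_bounded_spell _ F(1) computes_runs_as[OF F(2)] VD,
        where flag = False and ?g0.0 = 1 and ?q2.0 = 1] by auto
  have W: "?W u (pair y []) = {#}" if "u \<noteq> inv y" for u y
    unfolding pipe_outcome_def pair_append using that inv_unique[of u]
    by (auto simp: VD_empty D(2) spell_inject simp del: One_nat_def split: option.split)
  have V: "\<exists>t. guess ?W 1 (tr split 1 (pair y (c y))) [] [] = {#(inv y, t)#}" for y
  proof -
    have "VD (pair y (tr spell 1 y)) \<noteq> {#}" unfolding VD_empty D(2) by simp
    with VD_size[of "pair y (tr spell 1 y)"] obtain s t where t: "VD (pair y (tr spell 1 y)) = {#(s, t)#}"
      by (metis One_nat_def le_Suc_eq le_zero_eq size_1_singleton_mset size_eq_0_iff_empty surj_pair)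
    have s: "s = []" by (rule VD_lab[of s t "pair y (tr spell 1 y)"]) (unfold t, simp)
    have "length (inv y) \<le> length (c y)" using p[OF inv[of y]] c(2)[of y] by simp
    \<comment> \<open>Honesty and the clock put \<open>inv y\<close> into the range of the sum;
      injectivity removes all other summands.\<close>
    then have "(\<Sum>u' | length u' \<le> length (c y). pref u' (?W u' (pair y []))) =
        (\<Sum>u'\<in>{inv y}. pref u' (?W u' (pair y [])))"
      by (intro sum.mono_neutral_right ballI) (auto simp: W simp del: One_nat_def)
    also have "\<dots> = {#(inv y, t)#}"
      by (simp add: pipe_outcome_def inv pair_append t s del: One_nat_def)
    finally show ?thesis unfolding guess_1 tr_split append_Nil by blast
  qed
  obtain C where C: "DPM C" "computes C (\<lambda>y. Some (pair y (c y)))" using c(1) by (auto simp: partial_FP_def)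
  \<comment> \<open>A second pipeline, without guesses of its own, puts the clock in front of
    \<open>G\<close>; the outcomes of \<open>G\<close> pass through unchanged.\<close>
  obtain N e' where "mach e' N (\<lambda>x. guess (pipe_outcome (num_tapes G - 1) False copy2 1
      (\<lambda>y. Some (pair y (c y))) (\<lambda>x. guess ?W 1 (tr split 1 x) [] [])) 0 (tr (copy True) 1 x) [] [])"
    using pipeline[OF fst_bounded_copy(1)[of True] _ fst_bounded_copy(2) _ C(1) computes_runs_as[OF C(2)] G,
        where flag = False and ?g0.0 = 0 and ?q2.0 = 1]
    by auto
  then have N: "mach e' N (\<lambda>y. guess ?W 1 (tr split 1 (pair y (c y))) [] [])"
    unfolding guess_0 tr_copy append_Nil pipe_outcome_def[of "num_tapes G - 1"] option.case tr_copy2 .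
  let ?V = "\<lambda>y. guess ?W 1 (tr split 1 (pair y (c y))) [] []"
  have "size (?V y) \<le> 1" "?V y \<noteq> {#}" for y
    using V[of y] by (metis size_single order_refl, metis empty_not_add_mset)
  note V' = this
  have "UP_machine N" by (rule mach_UP[OF N V'(1)])
  moreover have "language N = UNIV"
    unfolding mach_language[OF N] using V'(2) by (intro equalityI subset_UNIV subsetI CollectI)
  ultimately have "\<exists>g \<in> FP. \<forall>x \<in> UNIV. g x \<in> acc N x"
    using Easy unfolding Easy_all_all_UP_def by (simp add: infinite_UNIV_listI)
  then obtain g where g: "g \<in> FP" "\<And>x. g x \<in> acc N x" by blast
  obtain g' where g': "g' \<in> FP" "\<And>y. \<exists>\<pi>. accepting_path N y \<pi> \<and> g' y = path_lab e' N \<pi>"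
    using FP_path_lab[OF g(1)] g(2) by metis
  have "g' y = inv y" for y
  proof -
    obtain t where "(g' y, t) \<in># guess ?W 1 (tr split 1 (pair y (c y))) [] []"
      using g'(2)[of y] mach_accepting[OF N] by metis
    then show ?thesis using V[of y] by auto
  qed
  then have "FP_invertible f" unfolding FP_invertible_def using g'(1) inv by metis
  with not_inv show False ..
qed

theorem theorem1:
  "(Easy_all_all_UP \<noteq> class_P \<longleftrightarrow> (\<exists>f. one_one_one_way f \<and> ran f = UNIV)) \<and>
   ((\<exists>f. one_one_one_way f \<and> ran f = UNIV) \<longleftrightarrow> (UNIV :: lang) \<notin> Easy_all_all_UP) \<and>
   ((UNIV :: lang) \<notin> Easy_all_all_UP \<longleftrightarrow> \<not> (\<forall>L \<in> Easy_all_all_UP. - L \<in> Easy_all_all_UP))"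
proof -
  have 23: "(\<exists>f. one_one_one_way f \<and> ran f = UNIV) \<longleftrightarrow> (UNIV :: lang) \<notin> Easy_all_all_UP"
    using one_way_if_UNIV_not_Easy UNIV_not_Easy_if_one_way by blast
  have eq: "Easy_all_all_UP = class_P" if "(UNIV :: lang) \<in> Easy_all_all_UP"
    using Easy_subset_P P_subset_Easy[OF that] by blast
  \<comment> \<open>If \<open>UNIV\<close> is not easy, the classes differ because
    \<open>UNIV\<close> is in P.\<close>
  then have 13: "Easy_all_all_UP \<noteq> class_P \<longleftrightarrow> (UNIV :: lang) \<notin> Easy_all_all_UP"
    using UNIV_in_P by auto
  have "{} \<in> Easy_all_all_UP" by (simp add: Easy_all_all_UP_def)
  then have "(UNIV :: lang) \<in> Easy_all_all_UP" if "\<forall>L \<in> Easy_all_all_UP. - L \<in> Easy_all_all_UP"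
    using that by fastforce
  moreover have "\<forall>L \<in> Easy_all_all_UP. - L \<in> Easy_all_all_UP" if "(UNIV :: lang) \<in> Easy_all_all_UP"
    unfolding eq[OF that] using compl_in_P by blast
  ultimately show ?thesis using 13 23 by blast
qed


end
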